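(* Let $f(x)\in\mathbb Z[x]$ have degree greater than $1$, and let $f^0(x)=x$, $f^m(x)=f(f^{m-1}(x))$. Then for every $N\ge0$ the partial sum $\sum_{n=0}^{N}\frac1{f^n(x)}\in\mathbb Q(x)$ has a specializable continued fraction if and only if $f(x)$ satisfies one of the following congruences in $\mathbb Z[x]$: (1) $f\equiv0\pmod{x^2}$; (2) $f\equiv-x\pmod{x^2}$; (3) $f\equiv1\pmod{x^2(x-1)}$; (4) $f\equiv-1\pmod{x^2(x+1)}$; (5) $f\equiv x^3-x^2-x+1\pmod{x^2(x-1)^2}$; (6) $f\equiv-x^3+2x^2-x+1\pmod{x^2(x-1)^2}$; (7) $f\equiv-x^3+3x^2-2x+1\pmod{x^2(x-1)^2}$; (8) $f\equiv x^3+x^2-x-1\pmod{x^2(x+1)^2}$; (9) $f\equiv-x^3-2x^2-x-1\pmod{x^2(x+1)^2}$; (10) $f\equiv-x^3-3x^2-2x-1\pmod{x^2(x+1)^2}$; (11) $f\equiv x^2-x+1\pmod{x^2(x-1)^2}$; (12) $f\equiv x^2-2x+1\pmod{x^2(x-1)^2}$; (13) $f\equiv-x^2-x-1\pmod{x^2(x+1)^2}$; (14) $f\equiv-x^2-2x-1\pmod{x^2(x+1)^2}$.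
   Context: An element of $\mathbb Q(x)$ is said to have a specializable continued fraction if it can be written as a finite continued fraction $[b_0,b_1,\dots,b_m]=b_0+\cfrac{1}{b_1+\cfrac{1}{\ddots+\cfrac1{b_m}}}$ with all partial quotients $b_i\in\mathbb Z[x]$ (zero or negative partial quotients allowed). *)

theory Defs
  imports "HOL-Computational_Algebra.Computational_Algebra"
begin

text \<open>The field \<open>\<rat>(x)\<close> is \<^typ>\<open>rat poly fract\<close>; this is the embedding \<open>\<int>[x] \<rightarrow> \<rat>(x)\<close>.\<close>

definition to_Qx :: "int poly \<Rightarrow> rat poly fract" where
  "to_Qx p = to_fract (map_poly rat_of_int p)"

text \<open>Value of the finite continued fraction \<open>[b\<^sub>0, \<dots>, b\<^sub>m]\<close>. The empty list is not a
  continued fraction; its value is a dummy.\<close>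

fun cfrac_val :: "'a::field list \<Rightarrow> 'a" where
  "cfrac_val [] = 0"
| "cfrac_val [b] = b"
| "cfrac_val (b # c # cs) = b + 1 / cfrac_val (c # cs)"

text \<open>Partial quotients may be zero, so a denominator of the nested fraction may vanish. A
  continued fraction counts only if it has at least one partial quotient and no denominator is
  \<open>0\<close>; in particular the HOL convention \<open>1 / 0 = 0\<close> plays no role.\<close>

fun cfrac_wf :: "'a::field list \<Rightarrow> bool" where
  "cfrac_wf [] \<longleftrightarrow> False"
| "cfrac_wf [b] \<longleftrightarrow> True"
| "cfrac_wf (b # c # cs) \<longleftrightarrow> cfrac_wf (c # cs) \<and> cfrac_val (c # cs) \<noteq> 0"

definition specializable :: "rat poly fract \<Rightarrow> bool" where
  "specializable r \<longleftrightarrow>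
     (\<exists>bs :: int poly list. cfrac_wf (map to_Qx bs) \<and> cfrac_val (map to_Qx bs) = r)"

primrec poly_iter :: "int poly \<Rightarrow> nat \<Rightarrow> int poly" where
  "poly_iter f 0 = [:0, 1:]"
| "poly_iter f (Suc m) = pcompose f (poly_iter f m)"

text \<open>The library constant \<open>cong\<close> needs a Euclidean ring, which \<^typ>\<open>int poly\<close> is not.\<close>

definition poly_cong :: "int poly \<Rightarrow> int poly \<Rightarrow> int poly \<Rightarrow> bool"
  ("(1[_ \<equiv>/ _] '(polymod _'))") where
  "[f \<equiv> g] (polymod m) \<longleftrightarrow> m dvd f - g"

abbreviation x_poly :: "int poly" ("\<x>") where
  "\<x> \<equiv> [:0, 1:]"

end

theory Submission
  imports Defs
begin

text \<open>A rational function is specializable iff it is \<open>p/q\<close> for a column \<open>(p, q)\<close> in the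
  \<open>GE\<^sub>2(\<int>[x])\<close>-orbit of \<open>(1, 0)\<close>. If \<open>P/Q\<close> is specializable and \<open>PP' \<equiv> 1 (mod Q)\<close>, applying a matrix
  with first column \<open>(P, Q)\<close> shows that \<open>P/Q + \<epsilon>\<close> is specializable iff \<open>P'/Q + 1/(Q\<^sup>2\<epsilon>)\<close> is.
  For each congruence class this removes all but boundedly many terms of the partial sum.
  Conversely, \<open>\<int>[x]\<close> is discretely ordered with \<open>x\<close> infinitely large, so a specializable \<open>A/B\<close>
  has an integral polynomial as its floor, and the leading coefficient of \<open>B\<close> divides that of \<open>A\<close>
  when \<open>deg A > deg B\<close>. Applied to suitable reductions of the partial sums with at most four terms,
  this test leaves only the listed classes.\<close>

section \<open>Columns of invertible matrices\<close>

text \<open>Coprimality is not enough: (1 + 2x)/4 satisfies (1 + 2x)(1 - 2x) + 4 x^2 = 1, yet 4 does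
  not divide 2, so the floor test rejects it. An invertible matrix over Z[x] therefore need not
  preserve the orbit, and it may be applied only when one of its columns is already known to lie
  there. This is why the sufficiency arguments carry explicit inverses modulo the denominators, and
  why each new partial sum is traced back to earlier ones already known to be specializable. The
  classes describe the orbit of 0 under f. Either 0 is fixed, with f'(0) = 0 or -1; or, up to
  conjugation by x -> -x, 0 goes to 1, and 1 is either fixed or sent back to 0. The moduli record
  the values and derivatives of f at 0 and 1. They arise because the divisions of the necessity part
  end in remainders like c + (b + 1) x, whose leading coefficients must be units.\<close>

inductive ge2_column :: "'a::comm_ring_1 \<Rightarrow> 'a \<Rightarrow> bool" where
  unit: "ge2_column 1 0"
| swap: "ge2_column a b \<Longrightarrow> ge2_column b a"
| add: "ge2_column a b \<Longrightarrow> ge2_column (a + c * b) b"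
| neg: "ge2_column a b \<Longrightarrow> ge2_column (- a) b"

lemma ge2_swap_iff: "ge2_column a b \<longleftrightarrow> ge2_column b a"
  using ge2_column.swap by blast

lemma ge2_add_iff: "ge2_column (a + c * b) b \<longleftrightarrow> ge2_column a b"
  using ge2_column.add[of "a + c * b" b "- c"] ge2_column.add[of a b c] by (auto simp: algebra_simps)

lemma ge2_neg_iff [simp]: "ge2_column (- a) b \<longleftrightarrow> ge2_column a b"
  using ge2_column.neg[of a b] ge2_column.neg[of "-a" b] by auto

lemma ge2_neg_iff2 [simp]: "ge2_column a (- b) \<longleftrightarrow> ge2_column a b"
  using ge2_swap_iff ge2_neg_iff by metis

lemma ge2_unimodular:
  assumes "ge2_column a b"
  shows "\<exists>u v. u * a + v * b = 1"
  using assms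
proof induction
  case unit
  show ?case by (rule exI[of _ 1]) simp
next
  case (swap a b)
  then show ?case by (metis add.commute)
next
  case (add a b c)
  then obtain u v where "u * a + v * b = 1" by blast
  then have "u * (a + c * b) + (v - u * c) * b = 1" by (simp add: algebra_simps)
  then show ?case by blast
next
  case (neg a b)
  then obtain u v where "u * a + v * b = 1" by blast
  then have "(- u) * (- a) + v * b = 1" by simp
  then show ?case by blast
qed

lemma ge2_matrix:
  assumes "ge2_column P Q" "P * Q' - P' * Q = 1 \<or> P * Q' - P' * Q = - 1"
  shows "ge2_column (P * s + P' * t) (Q * s + Q' * t) \<longleftrightarrow> ge2_column s t"
  using assms
proof (induction arbitrary: P' Q')
  case unit
  then have "Q' = 1 \<or> Q' = - 1" by auto
  then show ?case by (auto simp: ge2_add_iff)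
next
  case (swap a b)
  have "a * P' - Q' * b = - (b * Q' - P' * a)" by (simp add: algebra_simps)
  then have "a * P' - Q' * b = 1 \<or> a * P' - Q' * b = - 1"
    using swap.prems by (metis minus_minus)
  from swap.IH[OF this] show ?case using ge2_swap_iff by metis
next
  case (add a b c)
  have "a * Q' - (P' - c * Q') * b = 1 \<or> a * Q' - (P' - c * Q') * b = - 1"
    using add.prems by (auto simp: algebra_simps)
  from add.IH[OF this]
  have "ge2_column (a * s + (P' - c * Q') * t) (b * s + Q' * t) = ge2_column s t" .
  moreover have "(a + c * b) * s + P' * t
      = (a * s + (P' - c * Q') * t) + c * (b * s + Q' * t)"
    by (simp add: algebra_simps)
  ultimately show ?case by (simp only: ge2_add_iff)
next
  case (neg a b)
  have "a * Q' - (- P') * b = - (- a * Q' - P' * b)" by (simp add: algebra_simps)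
  then have "a * Q' - (- P') * b = 1 \<or> a * Q' - (- P') * b = - 1"
    using neg.prems by (metis minus_minus)
  from neg.IH[OF this]
  have "ge2_column (a * s + (- P') * t) (b * s + Q' * t) = ge2_column s t" .
  moreover have "- a * s + P' * t = - (a * s + (- P') * t)" by simp
  ultimately show ?case by (simp only: ge2_neg_iff)
qed

section \<open>Specializable functions as quotients of orbit columns\<close>

lemma to_Qx_simps [simp]:
  "to_Qx (p + q) = to_Qx p + to_Qx q"
  "to_Qx (p * q) = to_Qx p * to_Qx q"
  "to_Qx (- p) = - to_Qx p"
  "to_Qx (p - q) = to_Qx p - to_Qx q"
  "to_Qx 0 = 0" "to_Qx 1 = 1"
proof -
  have m: "map_poly rat_of_int (p * q) = map_poly rat_of_int p * map_poly rat_of_int q" for p q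
    by (rule poly_eqI) (simp add: coeff_mult coeff_map_poly)
  have a: "map_poly rat_of_int (p + q) = map_poly rat_of_int p + map_poly rat_of_int q" for p q
    by (rule poly_eqI) (simp add: coeff_map_poly)
  have n: "map_poly rat_of_int (- p) = - map_poly rat_of_int p" for p
    by (rule poly_eqI) (simp add: coeff_map_poly)
  have d: "map_poly rat_of_int (p - q) = map_poly rat_of_int p - map_poly rat_of_int q" for p q
    by (rule poly_eqI) (simp add: coeff_map_poly)
  show "to_Qx (p + q) = to_Qx p + to_Qx q"
    "to_Qx (p * q) = to_Qx p * to_Qx q"
    "to_Qx (- p) = - to_Qx p"
    "to_Qx (p - q) = to_Qx p - to_Qx q"
    "to_Qx 0 = 0" "to_Qx 1 = 1"
    by (simp_all add: to_Qx_def m a n d)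
qed

lemma to_Qx_power [simp]: "to_Qx (p ^ k) = to_Qx p ^ k"
  by (induction k) simp_all

lemma to_Qx_numeral [simp]: "to_Qx (numeral k) = numeral k"
proof -
  have "to_Qx (of_nat j) = of_nat j" for j by (induction j) simp_all
  from this[of "numeral k"] show ?thesis by simp
qed

lemma to_Qx_eq_iff [simp]: "to_Qx p = to_Qx q \<longleftrightarrow> p = q"
proof
  assume "to_Qx p = to_Qx q"
  then have "map_poly rat_of_int p = map_poly rat_of_int q" by (simp add: to_Qx_def)
  then have "coeff (map_poly rat_of_int p) i = coeff (map_poly rat_of_int q) i" for i by simp
  then show "p = q" by (intro poly_eqI) (simp add: coeff_map_poly)
qed simp

lemma to_Qx_eq_0_iff [simp]: "to_Qx p = 0 \<longleftrightarrow> p = 0"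
  using to_Qx_eq_iff[of p 0] by simp

lemma specializable_to_Qx [simp]: "specializable (to_Qx b)"
  unfolding specializable_def by (rule exI[of _ "[b]"]) simp

lemma specializable_inverse:
  assumes "specializable r"
  shows "specializable (1 / r)"
proof (cases "r = 0")
  case True
  then show ?thesis using specializable_to_Qx[of 0] by simp
next
  case False
  from assms obtain bs where "cfrac_wf (map to_Qx bs)" "cfrac_val (map to_Qx bs) = r"
    unfolding specializable_def by blast
  with False show ?thesis
    unfolding specializable_def by (cases bs) (auto intro!: exI[of _ "0 # bs"])
qed

lemma specializable_add:
  assumes "specializable r"
  shows "specializable (r + to_Qx c)"
proof -
  from assms obtain bs where "cfrac_wf (map to_Qx bs)" "cfrac_val (map to_Qx bs) = r"
    unfolding specializable_def by blast
  then show ?thesis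
    unfolding specializable_def
    by (cases bs; cases "tl bs") (auto intro!: exI[of _ "(hd bs + c) # tl bs"])
qed

lemma specializable_neg:
  assumes "specializable r"
  shows "specializable (- r)"
proof -
  have "cfrac_val (map uminus bs) = - cfrac_val bs" "cfrac_wf (map uminus bs) \<longleftrightarrow> cfrac_wf bs"
    for bs :: "rat poly fract list"
    by (induction bs rule: cfrac_val.induct) auto
  moreover have "map to_Qx (map uminus bs) = map uminus (map to_Qx bs)" for bs
    by simp
  ultimately show ?thesis
    using assms unfolding specializable_def by metis
qed

lemma specializable_iff:
  "specializable r \<longleftrightarrow> (\<exists>p q. ge2_column p q \<and> q \<noteq> 0 \<and> r = to_Qx p / to_Qx q)"
proof
  assume "specializable r"
  then obtain bs where "cfrac_wf (map to_Qx bs)" "cfrac_val (map to_Qx bs) = r"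
    unfolding specializable_def by blast
  then show "\<exists>p q. ge2_column p q \<and> q \<noteq> 0 \<and> r = to_Qx p / to_Qx q"
  proof (induction bs arbitrary: r rule: induct_list012)
    case 1
    then show ?case by simp
  next
    case (2 b)
    have "ge2_column b 1"
      using ge2_column.add[OF ge2_column.swap[OF ge2_column.unit], of b] by simp
    moreover have "r = to_Qx b / to_Qx 1" using 2(2) by simp
    ultimately show ?case using one_neq_zero by blast
  next
    case (3 b c cs)
    let ?s = "cfrac_val (map to_Qx (c # cs))"
    have wf: "cfrac_wf (map to_Qx (c # cs))" and s: "?s \<noteq> 0"
      using 3(3) by simp_all
    from 3(2)[OF wf refl] obtain p q
      where pq: "ge2_column p q" "q \<noteq> 0" "?s = to_Qx p / to_Qx q" by blast
    from s have "p \<noteq> 0" unfolding pq(3) by auto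
    moreover have "ge2_column (q + b * p) p"
      by (rule ge2_column.add[OF ge2_column.swap[OF pq(1)]])
    moreover have "r = to_Qx (q + b * p) / to_Qx p"
    proof -
      have "r = to_Qx b + 1 / ?s" using 3(4) by simp
      then show ?thesis unfolding pq(3) using \<open>p \<noteq> 0\<close> pq(2) by (simp add: field_simps)
    qed
    ultimately show ?case using \<open>p \<noteq> 0\<close> by (intro exI[of _ "q + b * p"] exI[of _ p] conjI)
  qed
next
  \<comment> \<open>The claim includes q = 0, where the quotient is 0 by convention, so that the
    induction can pass through columns such as (1, 0).\<close>
  have "specializable (to_Qx p / to_Qx q)" if "ge2_column p q" for p q
    using that
  proof induction
    case unit
    show ?case using specializable_to_Qx[of 0] by simp
  next
    case (swap a b)
    from specializable_inverse[OF this(2)] show ?case by simp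
  next
    case (add a b c)
    show ?case
    proof (cases "b = 0")
      case True
      then show ?thesis using specializable_to_Qx[of 0] by simp
    next
      case False
      then show ?thesis using specializable_add[OF add(2), of c] by (simp add: field_simps)
    qed
  next
    case (neg a b)
    from specializable_neg[OF this(2)] show ?case by simp
  qed
  then show "specializable r" if "\<exists>p q. ge2_column p q \<and> q \<noteq> 0 \<and> r = to_Qx p / to_Qx q"
    using that by blast
qed

lemma specializable_inverse_iff: "specializable (1 / r) \<longleftrightarrow> specializable r"
  using specializable_inverse[of r] specializable_inverse[of "1 / r"] by auto

lemma specializable_neg_iff [simp]: "specializable (- r) \<longleftrightarrow> specializable r"
  using specializable_neg[of r] specializable_neg[of "- r"] by auto

section \<open>Congruence modulo Z[x] and dual pairs\<close>

definition Zx :: "rat poly fract set" where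
  "Zx = range to_Qx"

lemma Zx_E:
  assumes "r \<in> Zx"
  obtains p where "r = to_Qx p"
  using assms unfolding Zx_def by (rule rangeE)

lemma Zx_intros:
  "to_Qx p \<in> Zx" "0 \<in> Zx" "1 \<in> Zx" "numeral k \<in> Zx"
  "r \<in> Zx \<Longrightarrow> s \<in> Zx \<Longrightarrow> r + s \<in> Zx"
  "r \<in> Zx \<Longrightarrow> s \<in> Zx \<Longrightarrow> r - s \<in> Zx"
  "r \<in> Zx \<Longrightarrow> s \<in> Zx \<Longrightarrow> r * s \<in> Zx"
  "r \<in> Zx \<Longrightarrow> - r \<in> Zx"
  "r \<in> Zx \<Longrightarrow> r ^ j \<in> Zx"
proof -
  have I: "to_Qx p \<in> Zx" for p unfolding Zx_def by (rule rangeI)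
  then show "to_Qx p \<in> Zx" .
  show "0 \<in> Zx" "1 \<in> Zx" "numeral k \<in> Zx"
    using I[of 0] I[of 1] I[of "numeral k"] by simp_all
  have *: "to_Qx a + to_Qx b \<in> Zx" "to_Qx a - to_Qx b \<in> Zx" "to_Qx a * to_Qx b \<in> Zx"
    "- to_Qx a \<in> Zx" "to_Qx a ^ j \<in> Zx" for a b
    using I[of "a + b"] I[of "a - b"] I[of "a * b"] I[of "- a"] I[of "a ^ j"] by simp_all
  show "r \<in> Zx \<Longrightarrow> s \<in> Zx \<Longrightarrow> r + s \<in> Zx" "r \<in> Zx \<Longrightarrow> s \<in> Zx \<Longrightarrow> r - s \<in> Zx"
    "r \<in> Zx \<Longrightarrow> s \<in> Zx \<Longrightarrow> r * s \<in> Zx" "r \<in> Zx \<Longrightarrow> - r \<in> Zx" "r \<in> Zx \<Longrightarrow> r ^ j \<in> Zx"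
    by (elim Zx_E; simp only: *)+
qed

lemma specializable_Zx: "r \<in> Zx \<Longrightarrow> specializable r"
  by (elim Zx_E) simp

lemma specializable_cong:
  assumes "r - s \<in> Zx"
  shows "specializable r \<longleftrightarrow> specializable s"
proof -
  obtain c where c: "r - s = to_Qx c" using assms by (rule Zx_E)
  show ?thesis
    using specializable_add[of s c] specializable_add[of r "- c"] by (auto simp: c[symmetric])
qed

text \<open>\<open>rq\<close> and \<open>sq\<close> are mutually inverse modulo \<open>q\<close>. This makes \<open>q\<close> the reduced denominator of
  both \<open>r\<close> and \<open>s\<close>.\<close>

definition dual :: "rat poly fract \<Rightarrow> rat poly fract \<Rightarrow> rat poly fract \<Rightarrow> bool" where
  "dual q r s \<longleftrightarrow> q \<noteq> 0 \<and> q \<in> Zx \<and> r * q \<in> Zx \<and> s * q \<in> Zx \<and> q * r * s - 1 / q \<in> Zx"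

lemma dual_sym: "dual q r s \<Longrightarrow> dual q s r"
  unfolding dual_def by (simp add: mult.commute mult.left_commute)

lemma is_unit_int_poly:
  fixes p :: "int poly"
  assumes "p dvd 1"
  shows "p = 1 \<or> p = - 1"
proof -
  obtain c where c: "p = [:c:]" "c dvd 1" using assms by (auto simp: is_unit_poly_iff)
  then have "c = 1 \<or> c = - 1" by (simp add: zdvd1_eq abs_eq_iff')
  moreover have "[:- 1:] = - (1 :: int poly)" by (simp add: one_pCons)
  ultimately show ?thesis using c(1) pCons_one by metis
qed

text \<open>The fraction P/Q need not be the one that witnesses specializability. But both columns
  are unimodular and proportional over Q(x), so the factor between them is a unit of Z[x], that is 1
  or -1, and membership in the orbit carries over to (P, Q).\<close>

lemma dual_imp_ge2:
  assumes "dual q r s" "specializable r"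
  obtains P Q Q' P' where "q = to_Qx Q" "r = to_Qx P / to_Qx Q" "s = to_Qx Q' / to_Qx Q"
    "P * Q' - P' * Q = 1" "Q \<noteq> 0" "ge2_column P Q"
proof -
  have mem: "q \<in> Zx" "r * q \<in> Zx" "s * q \<in> Zx" "q * r * s - 1 / q \<in> Zx" and q0: "q \<noteq> 0"
    using assms(1) unfolding dual_def by blast+
  obtain Q where Q: "q = to_Qx Q" using mem(1) by (rule Zx_E)
  obtain P where P: "r * q = to_Qx P" using mem(2) by (rule Zx_E)
  obtain Q' where Q': "s * q = to_Qx Q'" using mem(3) by (rule Zx_E)
  obtain P' where P': "q * r * s - 1 / q = to_Qx P'" using mem(4) by (rule Zx_E)
  have nz: "Q \<noteq> 0" using q0 Q by auto
  have r: "r = to_Qx P / to_Qx Q" and s: "s = to_Qx Q' / to_Qx Q"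
    using P Q' nz by (auto simp: Q field_simps)
  have "to_Qx (P * Q' - P' * Q) = to_Qx 1"
    using P' nz unfolding r s Q by (simp add: field_simps power2_eq_square)
  then have det: "P * Q' - P' * Q = 1" by (simp only: to_Qx_eq_iff)
  from assms(2) obtain p t where pt: "ge2_column p t" "t \<noteq> 0" "r = to_Qx p / to_Qx t"
    unfolding specializable_iff by blast
  have "to_Qx (P * t) = to_Qx (p * Q)"
    using pt(2,3) nz unfolding r by (simp add: field_simps)
  then have eq: "P * t = p * Q" by (simp only: to_Qx_eq_iff)
  obtain u v where uv: "u * p + v * t = 1" using ge2_unimodular[OF pt(1)] by blast
  \<comment> \<open>If P = g p and Q = g t, then u p + v t = 1 forces this value of g.\<close>
  define g where "g = u * P + v * Q"
  have "g * p = P * (u * p) + v * (P * t)" unfolding g_def eq by (simp add: algebra_simps)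
  also have "\<dots> = P * (u * p + v * t)" by (simp add: algebra_simps)
  finally have gp: "P = g * p" using uv by simp
  have "g * t = u * (p * Q) + v * Q * t" unfolding g_def eq[symmetric] by (simp add: algebra_simps)
  also have "\<dots> = Q * (u * p + v * t)" by (simp add: algebra_simps)
  finally have gt: "Q = g * t" using uv by simp
  have "1 = g * (p * Q' - P' * t)" using det unfolding gp gt by (simp add: algebra_simps)
  then have "g dvd 1" by (metis dvd_triv_left)
  then have "g = 1 \<or> g = - 1" by (rule is_unit_int_poly)
  then have "ge2_column P Q" using pt(1) gp gt by auto
  with that Q r s det nz show ?thesis by blast
qed

lemma dual_specializable:
  assumes "dual q r s" "specializable r"
  shows "specializable s"
proof -
  obtain P Q Q' P' where *: "q = to_Qx Q" "r = to_Qx P / to_Qx Q" "s = to_Qx Q' / to_Qx Q"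
    "P * Q' - P' * Q = 1" "Q \<noteq> 0" "ge2_column P Q"
    using dual_imp_ge2[OF assms] .
  \<comment> \<open>(Q', -Q) is the preimage of (1, 0) under the matrix with columns (P, Q) and (P',
    Q').\<close>
  have "ge2_column (P * Q' + P' * (- Q)) (Q * Q' + Q' * (- Q)) \<longleftrightarrow> ge2_column Q' (- Q)"
    by (rule ge2_matrix) (use * in auto)
  moreover have "P * Q' + P' * (- Q) = 1" "Q * Q' + Q' * (- Q) = 0"
    using *(4) by (simp_all add: algebra_simps)
  ultimately have "ge2_column Q' Q" using ge2_column.unit ge2_neg_iff2 by metis
  then show ?thesis unfolding specializable_iff using * by blast
qed

text \<open>The matrix in \<open>GE\<^sub>2(\<int>[x])\<close> with first column \<open>(rq, q)\<close> sends \<open>-(s + 1/(q\<^sup>2\<epsilon>))\<close> to \<open>r + \<epsilon>\<close>.\<close>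

lemma dual_add_imp:
  assumes d: "dual q r s" and r: "specializable r" and e: "e \<noteq> 0" and re: "specializable (r + e)"
  shows "specializable (s + 1 / (q\<^sup>2 * e))"
proof -
  obtain P Q Q' P' where *: "q = to_Qx Q" "r = to_Qx P / to_Qx Q" "s = to_Qx Q' / to_Qx Q"
    "P * Q' - P' * Q = 1" "Q \<noteq> 0" "ge2_column P Q"
    using dual_imp_ge2[OF d r] .
  obtain a b where ab: "ge2_column a b" "b \<noteq> 0" "r + e = to_Qx a / to_Qx b"
    using re unfolding specializable_iff by blast
  \<comment> \<open>(m, n) is the preimage of (a, b) under the matrix with columns (P, Q) and (P',
    Q').\<close>
  define m where "m = Q' * a - P' * b"
  define n where "n = P * b - Q * a"
  have "P * m + P' * n = (P * Q' - P' * Q) * a" "Q * m + Q' * n = (P * Q' - P' * Q) * b"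
    unfolding m_def n_def by (simp_all add: algebra_simps)
  then have "ge2_column m n"
    using ge2_matrix[OF *(6), of Q' P' m n] *(4) ab(1) by simp
  have eb: "e = to_Qx a / to_Qx b - to_Qx P / to_Qx Q" using ab(3) *(2) by (simp add: algebra_simps)
  have n: "to_Qx n = - e * to_Qx b * to_Qx Q"
    unfolding eb n_def using ab(2) *(5) by (simp add: field_simps)
  have det: "to_Qx P * to_Qx Q' - to_Qx P' * to_Qx Q = 1"
    using arg_cong[OF *(4), of to_Qx] by simp
  have "to_Qx m * to_Qx Q - to_Qx b * (1 + to_Qx Q' * e * to_Qx Q)
      = to_Qx b * (to_Qx P * to_Qx Q' - to_Qx P' * to_Qx Q - 1)"
    unfolding eb m_def using ab(2) *(5) by (simp add: field_simps)
  then have m: "to_Qx m = to_Qx b * (1 + to_Qx Q' * e * to_Qx Q) / to_Qx Q"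
    using *(5) det by (simp add: field_simps)
  have "n \<noteq> 0" using n e ab(2) *(5) by (metis mult_eq_0_iff neg_equal_0_iff_equal to_Qx_eq_0_iff)
  with \<open>ge2_column m n\<close> have "specializable (to_Qx m / to_Qx n)"
    unfolding specializable_iff by blast
  moreover have "to_Qx m / to_Qx n = - (s + 1 / (q\<^sup>2 * e))"
    unfolding m n *(1,3) using e ab(2) *(5) by (simp add: field_simps power2_eq_square)
  ultimately show ?thesis using specializable_neg_iff by metis
qed

lemma dual_add_iff:
  assumes d: "dual q r s" and r: "specializable r" and e: "e \<noteq> 0"
  shows "specializable (r + e) \<longleftrightarrow> specializable (s + 1 / (q\<^sup>2 * e))"
proof
  assume "specializable (s + 1 / (q\<^sup>2 * e))"
  moreover have q: "q \<noteq> 0" using d by (simp add: dual_def)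
  moreover have "1 / (q\<^sup>2 * e) \<noteq> 0" using q e by simp
  ultimately have "specializable (r + 1 / (q\<^sup>2 * (1 / (q\<^sup>2 * e))))"
    using dual_add_imp[OF dual_sym[OF d] dual_specializable[OF d r]] by blast
  moreover have "1 / (q\<^sup>2 * (1 / (q\<^sup>2 * e))) = e" using q e by simp
  ultimately show "specializable (r + e)" by metis
qed (rule dual_add_imp[OF assms])

section \<open>The floor test\<close>

text \<open>The sign is that of the leading coefficient, so a positive polynomial is a positive
  integer or exceeds every integer.\<close>

lemma int_poly_pos_ge_1:
  fixes p :: "int poly"
  assumes "0 < p"
  shows "1 \<le> p"
proof (rule ccontr)
  assume "\<not> 1 \<le> p"
  then have "p < 1" by simp
  then have *: "pos_poly (1 - p)" and p: "pos_poly p"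
    using assms by (simp_all add: less_poly_def)
  show False
  proof (cases "degree p = 0")
    case True
    then obtain c where "p = [:c:]" by (rule degree_eq_zeroE)
    then show False using * p by (simp add: one_pCons pos_poly_def)
  next
    case False
    then have "degree (1 - p) = degree p" "lead_coeff (1 - p) = - lead_coeff p"
      using degree_add_eq_right[of 1 "- p"] lead_coeff_add_le[of 1 "- p"] by simp_all
    then show False using * p by (simp add: pos_poly_def)
  qed
qed

text \<open>The regular continued fractions of the ordered ring \<open>\<int>[x]\<close>: all partial quotients but the
  first are positive, because the remainder satisfies \<open>0 \<le> r < b\<close>.\<close>

inductive floor_cfrac :: "int poly \<Rightarrow> int poly \<Rightarrow> bool" where
  base: "floor_cfrac 1 0"
| step: "floor_cfrac b r \<Longrightarrow> 0 \<le> r \<Longrightarrow> r < b \<Longrightarrow> floor_cfrac (c * b + r) b"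

lemma floor_cfrac_0: "floor_cfrac a 0 \<longleftrightarrow> a = 1"
  by (auto elim: floor_cfrac.cases intro: floor_cfrac.base)

lemma floor_cfracE:
  assumes "floor_cfrac a b" "0 < b"
  obtains c r where "a = c * b + r" "0 \<le> r" "r < b" "floor_cfrac b r"
  using assms by (auto elim: floor_cfrac.cases)

lemma floor_cfrac_add:
  assumes "floor_cfrac a b" "0 < b"
  shows "floor_cfrac (a + c * b) b"
proof -
  obtain d r where "a = d * b + r" "0 \<le> r" "r < b" "floor_cfrac b r"
    using floor_cfracE[OF assms] .
  then show ?thesis using floor_cfrac.step[of b r "d + c"] by (simp add: algebra_simps)
qed

text \<open>This serves negation: if a = c b + r with r > 0, the remainder of -a is b - r. Write b =
  c r + s. For c = 1 one has b - r = s and b = r + s; for c > 1 the expansion of b/(b - r) starts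
  with the partial quotients 1 and c - 1.\<close>

lemma floor_cfrac_reflect:
  assumes "floor_cfrac b r" "0 < r" "r < b"
  shows "floor_cfrac b (b - r)"
proof -
  obtain c s where b: "b = c * r + s" and s: "0 \<le> s" "s < r" and rs: "floor_cfrac r s"
    using floor_cfracE[OF assms(1,2)] .
  have "0 < c"
  proof (rule ccontr)
    assume "\<not> 0 < c"
    then have "c * r \<le> 0" using assms(2) by (simp add: mult_nonpos_nonneg)
    then show False using b s assms(3) by linarith
  qed
  show ?thesis
  proof (cases "c = 1")
    case True
    then have br: "b - r = s" using b by simp
    have "0 < s" using br assms(3) by linarith
    moreover have "b = r + 1 * s" using b True by simp
    ultimately show ?thesis using floor_cfrac_add[OF rs, of 1] br by metis
  next
    case False
    have "1 \<le> c - 1" using int_poly_pos_ge_1[of "c - 1"] int_poly_pos_ge_1[OF \<open>0 < c\<close>] False by simp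
    then have "1 * r \<le> (c - 1) * r" using assms(2) by (intro mult_right_mono) auto
    then have le: "r \<le> (c - 1) * r" by simp
    have br: "b - r = (c - 1) * r + s" using b by (simp add: algebra_simps)
    have fr: "floor_cfrac (b - r) r" unfolding br by (rule floor_cfrac.step[OF rs s])
    show ?thesis
    proof (cases "r < b - r")
      case True
      then show ?thesis using floor_cfrac.step[OF fr, of 1] assms(2) by simp
    next
      case False
      \<comment> \<open>Here the partial quotients 1, 1 collapse to 2, because r is not smaller than
        b - r. This happens only for b = 2, r = 1.\<close>
      then have eq: "b - r = r" using le br s by linarith
      then have "(c - 1) * r + s = r" using br by simp
      then have "s = 0" using le s by linarith
      then have "r = 1" using rs floor_cfrac_0 by simp
      then have "b = 2 * 1 + 0" using eq by (simp add: algebra_simps)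
      then show ?thesis using floor_cfrac.step[of 1 0 2] floor_cfrac.base eq \<open>r = 1\<close> by simp
    qed
  qed
qed

lemma floor_cfrac_neg:
  assumes "floor_cfrac a b" "0 < b"
  shows "floor_cfrac (- a) b"
proof -
  obtain c r where a: "a = c * b + r" and r: "0 \<le> r" "r < b" and br: "floor_cfrac b r"
    using floor_cfracE[OF assms] .
  show ?thesis
  proof (cases "r = 0")
    case True
    then show ?thesis using floor_cfrac.step[OF br r, of "- c"] a by simp
  next
    case False
    then have "floor_cfrac b (b - r)" using r br by (intro floor_cfrac_reflect) auto
    then have "floor_cfrac ((- c - 1) * b + (b - r)) b"
      using r False by (intro floor_cfrac.step) auto
    then show ?thesis using a by (simp add: algebra_simps)
  qed
qed

lemma floor_cfrac_swap:
  assumes "floor_cfrac a b" "0 < b" "0 < a"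
  shows "floor_cfrac b a"
proof -
  obtain c r where a: "a = c * b + r" and r: "0 \<le> r" "r < b" and br: "floor_cfrac b r"
    using floor_cfracE[OF assms(1,2)] .
  consider "b < a" | "a = b" | "a < b" by fastforce
  then show ?thesis
  proof cases
    case 1
    then show ?thesis using floor_cfrac.step[OF assms(1), of 0] assms by simp
  next
    case 2
    then show ?thesis using assms by simp
  next
    case 3
    have "c = 0"
    proof (rule ccontr)
      assume "c \<noteq> 0"
      then consider "0 < c" | "0 < - c" by fastforce
      then show False
      proof cases
        case 1
        then have "1 * b \<le> c * b" using assms(2) int_poly_pos_ge_1 by (intro mult_right_mono) auto
        then show False using a r 3 by linarith
      next
        case 2
        then have "1 * b \<le> - c * b" using assms(2) int_poly_pos_ge_1[OF 2] by (intro mult_right_mono) auto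
        then have "c * b + r < 0" using r by (simp add: algebra_simps)
        then show False using a assms(3) by simp
      qed
    qed
    then show ?thesis using a br by simp
  qed
qed

text \<open>The columns with a terminating floor expansion, up to the sign of b, are closed under
  the generators of the orbit. Thus arbitrary partial quotients are traded for regular ones.\<close>

lemma ge2_floor_cfrac:
  fixes a b :: "int poly"
  assumes "ge2_column a b"
  shows "(0 < b \<longrightarrow> floor_cfrac a b) \<and> (b < 0 \<longrightarrow> floor_cfrac a (- b)) \<and> (b = 0 \<longrightarrow> a = 1 \<or> a = - 1)"
  using assms
proof induction
  case unit
  show ?case by simp
next
  case (swap a b)
  have unit: "floor_cfrac 0 1" using floor_cfrac.step[OF floor_cfrac.base, of 0] by simp
  have b0: "b = 1 \<or> b = - 1" if "a = 0"
  proof -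
    have "x = 1" if "floor_cfrac 0 x" "0 < x" for x
    proof -
      obtain c r where *: "0 = c * x + r" "0 \<le> r" "r < x" "floor_cfrac x r"
        using floor_cfracE[OF \<open>floor_cfrac 0 x\<close> \<open>0 < x\<close>] .
      have "c = 0"
      proof (rule ccontr)
        assume "c \<noteq> 0"
        then consider "0 < c" | "0 < - c" by fastforce
        then show False
        proof cases
          case 1
          then have "0 < c * x" using that by simp
          then show False using * by simp
        next
          case 2
          then have "1 * x \<le> - c * x" using that(2) int_poly_pos_ge_1[OF 2] by (intro mult_right_mono) auto
          then have "c * x + r < 0" using * by (simp add: algebra_simps)
          then show False using *(1) by simp
        qed
      qed
      then show ?thesis using * floor_cfrac_0 by simp
    qed
    then have x: "x = 1" if "floor_cfrac 0 x" "0 < x" for x using that by blast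
    consider "b = 0" | "0 < b" | "0 < - b" by fastforce
    then show ?thesis
    proof cases
      case 3
      then have "- b = 1" using swap.IH \<open>a = 0\<close> x[of "- b"] by simp
      then show ?thesis by (metis minus_minus)
    qed (use swap.IH \<open>a = 0\<close> x in auto)
  qed
  have pos: "floor_cfrac a \<bar>b\<bar>" if "b \<noteq> 0"
    using swap.IH that by (auto simp: abs_if neq_iff)
  have pos': "floor_cfrac \<bar>a\<bar> \<bar>b\<bar>" if "b \<noteq> 0"
    using pos[OF that] floor_cfrac_neg[OF pos[OF that]] that by (auto simp: abs_if)
  have ba: "floor_cfrac b \<bar>a\<bar>" if "a \<noteq> 0"
  proof (cases "b = 0")
    case True
    then show ?thesis using swap.IH unit by auto
  next
    case False
    have "floor_cfrac \<bar>b\<bar> \<bar>a\<bar>" using floor_cfrac_swap[OF pos'[OF False]] that False by simp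
    then show ?thesis using floor_cfrac_neg[of "\<bar>b\<bar>" "\<bar>a\<bar>"] that by (auto simp: abs_if split: if_splits)
  qed
  then show ?case using b0 by (auto simp: abs_if)
next
  case (add a b c)
  have "floor_cfrac (a + c * b) b" if "0 < b" using add.IH floor_cfrac_add that by blast
  moreover have "floor_cfrac (a + c * b) (- b)" if "b < 0"
    using add.IH floor_cfrac_add[of a "- b" "- c"] that by simp
  ultimately show ?case using add.IH by auto
next
  case (neg a b)
  then show ?case using floor_cfrac_neg[of a b] floor_cfrac_neg[of a "- b"] by auto
qed

lemma degree_le_if_nonneg_less:
  fixes r b :: "int poly"
  assumes "0 \<le> r" "r < b"
  shows "degree r \<le> degree b"
proof (rule ccontr)
  assume *: "\<not> degree r \<le> degree b"
  then have r: "pos_poly r" using assms(1) by (auto simp: less_eq_poly_def)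
  have "degree (b - r) = degree r" "lead_coeff (b - r) = - lead_coeff r"
    using * degree_add_eq_right[of b "- r"] lead_coeff_add_le[of b "- r"] by simp_all
  moreover have "pos_poly (b - r)" using assms(2) by (simp add: less_poly_def)
  ultimately show False using r by (simp add: pos_poly_def)
qed

text \<open>Euclidean division of the first numerator by the first denominator must succeed in
  \<open>\<int>[x]\<close>, because \<open>\<int>[x]\<close> is discretely ordered.\<close>

lemma ge2_floor:
  fixes a b :: "int poly"
  assumes "ge2_column a b" "b \<noteq> 0"
  obtains c where "degree (a - c * b) \<le> degree b"
proof -
  have *: "\<exists>c. degree (a - c * x) \<le> degree x" if x: "floor_cfrac a x" "0 < x" for x
  proof -
    obtain c r where "a = c * x + r" "0 \<le> r" "r < x" using x by (rule floor_cfracE)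
    then show ?thesis using degree_le_if_nonneg_less[of r x] by (intro exI[of _ c]) simp
  qed
  show ?thesis
  proof (cases "0 < b")
    case True
    then show ?thesis using * ge2_floor_cfrac[OF assms(1)] that by blast
  next
    case False
    then have "0 < - b" "floor_cfrac a (- b)" using assms(2) ge2_floor_cfrac[OF assms(1)] by auto
    from *[OF this(2,1)] obtain c where "degree (a - c * - b) \<le> degree (- b)" by blast
    then show ?thesis using that[of "- c"] by simp
  qed
qed

text \<open>The integral floor c leaves A - c B of degree at most that of B, so A and c B have the
  same leading term. Since A q = p B, the fraction A/B may be unreduced.\<close>

lemma specializable_lead_coeff_dvd:
  assumes s: "specializable (to_Qx A / to_Qx B)" and B: "B \<noteq> 0" and deg: "degree B < degree A"
  shows "lead_coeff B dvd lead_coeff A"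
proof -
  obtain p q where pq: "ge2_column p q" "q \<noteq> 0" "to_Qx A / to_Qx B = to_Qx p / to_Qx q"
    using s unfolding specializable_iff by blast
  have "to_Qx (A * q) = to_Qx (p * B)" using pq(2,3) B by (simp add: field_simps)
  then have eq: "A * q = p * B" by (simp only: to_Qx_eq_iff)
  obtain c where c: "degree (p - c * q) \<le> degree q" using ge2_floor[OF pq(1,2)] .
  have "(A - c * B) * q = B * (p - c * q)" using eq by (simp add: algebra_simps)
  then have "degree ((A - c * B) * q) \<le> degree B + degree q"
    using c degree_mult_le[of B "p - c * q"] by simp
  then have le: "degree (A - c * B) \<le> degree B"
    using pq(2) by (cases "A - c * B = 0") (auto simp: degree_mult_eq)
  have "c * B = A + - (A - c * B)" by simp
  moreover have "degree (- (A - c * B)) < degree A" unfolding degree_minus using le deg by (rule le_less_trans)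
  ultimately have "lead_coeff (c * B) = lead_coeff A"
    by (metis lead_coeff_add_le add.commute)
  then show ?thesis by (metis lead_coeff_mult dvd_triv_right)
qed

section \<open>Coprime iterates\<close>

lemma pcompose_x: "pcompose [:0, 1:] (W :: int poly) = W"
  by (simp add: pcompose_pCons)

lemmas pcompose_hom = pcompose_add pcompose_mult pcompose_diff pcompose_uminus pcompose_1 pcompose_x

lemma degree_poly_iter: "degree (poly_iter f n) = degree f ^ n"
  by (induction n) (simp_all add: degree_pcompose)

lemma poly_iter_nonconst:
  assumes "degree f > 1"
  shows "poly_iter f n \<noteq> [:c:]"
proof -
  have "0 < degree f ^ n" using assms by simp
  then have "degree (poly_iter f n) > 0" by (simp add: degree_poly_iter)
  then show ?thesis by auto
qed

lemma poly_iter_ne: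
  assumes "degree f > 1"
  shows "poly_iter f n \<noteq> 0" "poly_iter f n \<noteq> 1" "poly_iter f n \<noteq> - 1"
  using poly_iter_nonconst[OF assms, of n 0] poly_iter_nonconst[OF assms, of n 1]
    poly_iter_nonconst[OF assms, of n "- 1"] by (auto simp: one_pCons)

section \<open>The folding lemma and the classes modulo x^2\<close>

text \<open>This is the folding lemma for continued fractions. With e = 1/(q^2 g), the product (r +
  e)(e - r) is e^2 - r^2, and q^2 g r^2 is integral because q r is.\<close>

lemma dual_fold:
  assumes "dual q r s" "g \<in> Zx" "g \<noteq> 0"
  shows "dual (q\<^sup>2 * g) (r + 1 / (q\<^sup>2 * g)) (- r + 1 / (q\<^sup>2 * g))"
proof -
  from assms(1) have q: "q \<noteq> 0" "q \<in> Zx" "r * q \<in> Zx" unfolding dual_def by auto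
  have "r * (q\<^sup>2 * g) = (r * q) * q * g" by (simp add: power2_eq_square)
  then have rq: "r * (q\<^sup>2 * g) \<in> Zx" using q assms by (simp only: Zx_intros)
  have 1: "(r + 1 / (q\<^sup>2 * g)) * (q\<^sup>2 * g) = r * (q\<^sup>2 * g) + 1"
    "(- r + 1 / (q\<^sup>2 * g)) * (q\<^sup>2 * g) = 1 - r * (q\<^sup>2 * g)"
    using q assms by (simp_all add: field_simps)
  have 2: "q\<^sup>2 * g * (r + 1 / (q\<^sup>2 * g)) * (- r + 1 / (q\<^sup>2 * g)) - 1 / (q\<^sup>2 * g)
      = - ((r * q)\<^sup>2 * g)"
    using q assms by (simp add: field_simps power2_eq_square)
  show ?thesis unfolding dual_def 1 2 using q assms rq by (simp add: Zx_intros)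
qed

text \<open>Duality turns the added term 1/(q^2 g) into the integral summand g.\<close>

lemma specializable_fold:
  assumes d: "dual q r s" and r: "specializable r" and g: "g \<in> Zx"
  shows "specializable (r + 1 / (q\<^sup>2 * g))"
proof (cases "g = 0")
  case True
  then show ?thesis using r by simp
next
  case False
  have q: "q \<noteq> 0" using d by (simp add: dual_def)
  have "specializable (s + g)"
    using specializable_cong[of "s + g" s] g dual_specializable[OF d r] by simp
  moreover have "1 / (q\<^sup>2 * (1 / (q\<^sup>2 * g))) = g" using q False by simp
  ultimately show ?thesis using dual_add_iff[OF d r, of "1 / (q\<^sup>2 * g)"] q False by simp
qed

lemma dual_inverse: "q \<in> Zx \<Longrightarrow> q \<noteq> 0 \<Longrightarrow> dual q (1 / q) (1 / q)"
  unfolding dual_def by (simp add: Zx_intros)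

lemma dual_1: "dual 1 0 0"
  unfolding dual_def using Zx_intros by simp

text \<open>The current iterate y is also the denominator of the partial sum, and the next iterate
  is y^2 h(y). So every new term is a fold.\<close>

lemma specializable_sum_0_mod_x2:
  assumes deg: "degree f > 1" and f: "f = [:0, 1:]^2 * h"
  shows "specializable (\<Sum>n=0..N. 1 / to_Qx (poly_iter f n))
      \<and> (\<exists>s. dual (to_Qx (poly_iter f N)) (\<Sum>n=0..N. 1 / to_Qx (poly_iter f n)) s)"
proof (induction N)
  case 0
  let ?x = "to_Qx [:0, 1:]"
  have "specializable (1 / ?x)" by (intro specializable_inverse) simp
  moreover have "dual ?x (1 / ?x) (1 / ?x)" by (intro dual_inverse Zx_intros) simp
  ultimately show ?case by auto
next
  case (Suc N)
  let ?y = "to_Qx (poly_iter f N)" and ?g = "to_Qx (pcompose h (poly_iter f N))"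
  let ?r = "\<Sum>n=0..N. 1 / to_Qx (poly_iter f n)"
  obtain s where d: "dual ?y ?r s" and sp: "specializable ?r" using Suc by blast
  have "poly_iter f (Suc N) = (poly_iter f N)^2 * pcompose h (poly_iter f N)"
    by (simp add: f power2_eq_square pcompose_hom del: mult_pCons_left mult_pCons_right)
  then have eq: "to_Qx (poly_iter f (Suc N)) = ?y\<^sup>2 * ?g" by simp
  moreover have "?g \<noteq> 0" using eq poly_iter_ne(1)[OF deg, of "Suc N"] by auto
  ultimately show ?case
    using dual_fold[OF d, of ?g] specializable_fold[OF d sp, of ?g] Zx_intros(1) by auto
qed

text \<open>Consecutive partial sums P/H and P1/H1 are neighbours: they differ by 1/(H H1), where H
  H1 is the next iterate. Hence their columns form a matrix of determinant 1 or -1, and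
  \<open>ge2_matrix\<close> moves the orbit property from one to the next.\<close>

lemma specializable_sum_minus_x_mod_x2:
  fixes f g :: "int poly"
  assumes deg: "degree f > 1" and f: "f = - [:0, 1:] + [:0, 1:]^2 * g"
  shows "specializable (\<Sum>n=0..N. 1 / to_Qx (poly_iter f n))"
proof -
  define S where "S N = (\<Sum>n=0..N. 1 / to_Qx (poly_iter f n))" for N
  have "\<exists>P H P1 H1. ge2_column P H \<and> S N = to_Qx P / to_Qx H \<and> poly_iter f (Suc N) = H * H1
      \<and> P1 * H - P * H1 = 1" for N
  proof (induction N)
    case 0
    let ?x = "[:0, 1:] :: int poly"
    have "ge2_column 1 ?x"
      using ge2_column.add[OF ge2_column.swap[OF ge2_column.unit], of ?x] ge2_column.swap by simp
    moreover have "poly_iter f (Suc 0) = ?x * (- 1 + ?x * g)"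
      by (simp only: f poly_iter.simps pcompose_idR) (simp add: algebra_simps power2_eq_square)
    moreover have "g * ?x - 1 * (- 1 + ?x * g) = 1" by simp
    moreover have "S 0 = to_Qx 1 / to_Qx ?x" by (simp add: S_def)
    ultimately show ?case by blast
  next
    case (Suc N)
    then obtain P H P1 H1 where ge: "ge2_column P H" and S: "S N = to_Qx P / to_Qx H"
      and it: "poly_iter f (Suc N) = H * H1" and det: "P1 * H - P * H1 = 1"
      by blast
    let ?G = "pcompose g (H * H1)"
    have nz: "H \<noteq> 0" "H1 \<noteq> 0" using it poly_iter_ne(1)[OF deg, of "Suc N"] by auto
    have "P * H1 - P1 * H = - 1" using det by (simp add: algebra_simps)
    then have "ge2_column (P * 0 + P1 * 1) (H * 0 + H1 * 1)"
      using ge2_matrix[OF ge, of H1 P1 0 1] ge2_column.swap[OF ge2_column.unit] by blast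
    then have "ge2_column P1 H1" by simp
    moreover have "S (Suc N) = to_Qx P1 / to_Qx H1"
    proof -
      have "to_Qx P1 * to_Qx H - to_Qx P * to_Qx H1 = 1"
        using arg_cong[OF det, of to_Qx] by simp
      then have "to_Qx P / to_Qx H + 1 / (to_Qx H * to_Qx H1) = to_Qx P1 / to_Qx H1"
        using nz by (simp add: field_simps)
      then show ?thesis using S it by (simp add: S_def)
    qed
    moreover have "poly_iter f (Suc (Suc N)) = H1 * (H * (- 1 + H * H1 * ?G))"
    proof -
      have "poly_iter f (Suc (Suc N)) = pcompose f (H * H1)" using it by simp
      also have "\<dots> = - (H * H1) + (H * H1)^2 * ?G"
        by (simp only: f power2_eq_square pcompose_hom)
      finally show ?thesis by (simp add: algebra_simps power2_eq_square)
    qed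
    \<comment> \<open>The new denominator is H times the factor - 1 + H H1 G. The numerator is P
      times the same factor, corrected by G H to make the determinant 1.\<close>
    moreover have "(P * (- 1 + H * H1 * ?G) + ?G * H) * H1 - P1 * (H * (- 1 + H * H1 * ?G)) = 1"
    proof -
      have "(P * (- 1 + H * H1 * ?G) + ?G * H) * H1 - P1 * (H * (- 1 + H * H1 * ?G))
          = (P1 * H - P * H1) * (1 - H * H1 * ?G) + H * H1 * ?G"
        by (simp add: algebra_simps)
      then show ?thesis using det by simp
    qed
    ultimately show ?case by blast
  qed
  from this[of N] obtain P H P1 H1 where *: "ge2_column P H" "S N = to_Qx P / to_Qx H"
    "poly_iter f (Suc N) = H * H1" by blast
  then have "H \<noteq> 0" using poly_iter_ne(1)[OF deg, of "Suc N"] by auto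
  with * show ?thesis unfolding specializable_iff S_def by blast
qed

section \<open>Classes with f(0) = f(1) = 1\<close>

text \<open>If \<open>f = 1 + x (x - 1) m\<close>, then \<open>f\<^sup>N(x) = 1 + QR\<close>, where \<open>Q\<close> is the product of the preceding
  iterates, and \<open>R\<close> is multiplied by \<open>m(f\<^sup>N(x))\<close> in each step.\<close>

lemma dual_coprime_step:
  assumes "dual Q r s" "R \<in> Zx" "w \<noteq> 0" "w = 1 + Q * R"
  shows "dual (Q * w) (r + 1 / w) (s + R\<^sup>2 / w)"
proof -
  from assms(1) have q: "Q \<noteq> 0" "Q \<in> Zx" "r * Q \<in> Zx" "s * Q \<in> Zx" "Q * r * s - 1 / Q \<in> Zx"
    unfolding dual_def by auto
  have w: "w \<in> Zx" using assms q by (simp add: Zx_intros)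
  have 1: "(r + 1 / w) * (Q * w) = r * Q * w + Q" "(s + R\<^sup>2 / w) * (Q * w) = s * Q * w + R\<^sup>2 * Q"
    using assms(3) by (simp_all add: field_simps)
  have QR: "Q * R = w - 1" using assms(4) by simp
  have "Q * w * (r + 1 / w) * (s + R\<^sup>2 / w) - 1 / (Q * w)
      = w * (Q * r * s - 1 / Q) + (r * Q) * R\<^sup>2 + s * Q + (w\<^sup>2 - 1 + (Q * R)\<^sup>2) / (Q * w)"
    using assms(3) q(1) by (simp add: field_simps power2_eq_square)
  also have "w\<^sup>2 - 1 + (Q * R)\<^sup>2 = 2 * w * (Q * R)"
    unfolding QR by (simp add: algebra_simps power2_eq_square)
  also have "2 * w * (Q * R) / (Q * w) = 2 * R" using assms(3) q(1) by simp
  finally have 2: "Q * w * (r + 1 / w) * (s + R\<^sup>2 / w) - 1 / (Q * w)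
      = w * (Q * r * s - 1 / Q) + (r * Q) * R\<^sup>2 + s * Q + 2 * R" .
  show ?thesis unfolding dual_def 1 2 using q assms w by (simp add: Zx_intros)
qed

text \<open>The dual of the increment 1/w is w/Q^2, which splits into R/Q + 1/Q^2.\<close>

lemma specializable_coprime_step_iff:
  assumes "dual Q r s" "specializable r" "w \<noteq> 0" "w = 1 + Q * R"
  shows "specializable (r + 1 / w) \<longleftrightarrow> specializable (s + R / Q + 1 / Q\<^sup>2)"
proof -
  have "Q \<noteq> 0" using assms(1) by (simp add: dual_def)
  then have "1 / (Q\<^sup>2 * (1 / w)) = R / Q + 1 / Q\<^sup>2"
    using assms(3) by (simp add: assms(4) field_simps power2_eq_square)
  then show ?thesis using dual_add_iff[OF assms(1,2), of "1 / w"] assms(3) by (simp add: add.assoc)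
qed

text \<open>The invariant \<open>X\<close> relates the dual s to R/Q. It has to make s + R/Q +
  1/Q^2, which is equivalent to the next partial sum, specializable. The classes differ only in this
  relation.\<close>

lemma specializable_sum_coprime:
  assumes deg: "degree f > 1" and f: "f = 1 + [:0, 1:] * ([:0, 1:] - 1) * m"
    and X0: "X 1 0 (to_Qx [:0, 1:] - 1)"
    and step: "\<And>Q r s R W. dual Q r s \<Longrightarrow> specializable r \<Longrightarrow> R \<in> Zx \<Longrightarrow> to_Qx W = 1 + Q * R \<Longrightarrow> W \<noteq> 0
      \<Longrightarrow> X Q s R \<Longrightarrow> X (Q * to_Qx W) (s + R\<^sup>2 / to_Qx W) (R * to_Qx (pcompose m W))"
    and X: "\<And>Q r s R. dual Q r s \<Longrightarrow> specializable r \<Longrightarrow> R \<in> Zx \<Longrightarrow> X Q s R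
      \<Longrightarrow> specializable (s + R / Q + 1 / Q\<^sup>2)"
  shows "specializable (\<Sum>n<N. 1 / to_Qx (poly_iter f n))
    \<and> (\<exists>Q s R. dual Q (\<Sum>n<N. 1 / to_Qx (poly_iter f n)) s \<and> R \<in> Zx
         \<and> to_Qx (poly_iter f N) = 1 + Q * R \<and> X Q s R)"
proof (induction N)
  case 0
  have "to_Qx [:0, 1:] - 1 \<in> Zx" by (simp add: Zx_intros)
  moreover have "specializable 0" by (rule specializable_Zx) (rule Zx_intros)
  moreover have "to_Qx (poly_iter f 0) = 1 + 1 * (to_Qx [:0, 1:] - 1)" by simp
  ultimately have "\<exists>R. dual 1 0 0 \<and> R \<in> Zx \<and> to_Qx (poly_iter f 0) = 1 + 1 * R \<and> X 1 0 R"
    using X0 dual_1 by blast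
  then show ?case using \<open>specializable 0\<close> by (simp only: lessThan_0 sum.empty) blast
next
  case (Suc N)
  let ?r = "\<Sum>n<N. 1 / to_Qx (poly_iter f n)" and ?W = "poly_iter f N"
  from Suc obtain Q s R where r: "specializable ?r" and d: "dual Q ?r s" and R: "R \<in> Zx"
    and W: "to_Qx ?W = 1 + Q * R" and XX: "X Q s R" by blast
  have nz: "?W \<noteq> 0" by (rule poly_iter_ne[OF deg])
  then have nz': "to_Qx ?W \<noteq> 0" by simp
  have "specializable (?r + 1 / to_Qx ?W)"
    using specializable_coprime_step_iff[OF d r nz' W] X[OF d r R XX] by blast
  moreover have "dual (Q * to_Qx ?W) (?r + 1 / to_Qx ?W) (s + R\<^sup>2 / to_Qx ?W)"
    by (rule dual_coprime_step[OF d R nz' W])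
  moreover have "X (Q * to_Qx ?W) (s + R\<^sup>2 / to_Qx ?W) (R * to_Qx (pcompose m ?W))"
    by (rule step[OF d r R W nz XX])
  moreover have "to_Qx (poly_iter f (Suc N)) = 1 + Q * to_Qx ?W * (R * to_Qx (pcompose m ?W))"
  proof -
    have "poly_iter f (Suc N) = 1 + ?W * (?W - 1) * pcompose m ?W"
      by (simp only: poly_iter.simps f pcompose_hom)
    then have "to_Qx (poly_iter f (Suc N)) = 1 + to_Qx ?W * (to_Qx ?W - 1) * to_Qx (pcompose m ?W)"
      by simp
    then show ?thesis unfolding W by (simp add: algebra_simps)
  qed
  moreover have "R * to_Qx (pcompose m ?W) \<in> Zx" using R by (simp add: Zx_intros)
  ultimately show ?case by (auto simp: lessThan_Suc add.commute)
qed

lemma specializable_sum_coprime_0: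
  assumes deg: "degree f > 1" and f: "f = 1 + [:0, 1:] * ([:0, 1:] - 1) * ([:0, 1:] * h)"
  shows "specializable (\<Sum>n<N. 1 / to_Qx (poly_iter f n))"
proof (rule specializable_sum_coprime[THEN conjunct1, OF deg f, of "\<lambda>Q s R. R / Q \<in> Zx"])
  show "(to_Qx [:0, 1:] - 1) / 1 \<in> Zx" by (simp add: Zx_intros)
next
  fix Q r s R :: "rat poly fract" and W :: "int poly"
  assume d: "dual Q r s" "W \<noteq> 0" and RQ: "R / Q \<in> Zx"
  have "pcompose ([:0, 1:] * h) W = W * pcompose h W" by (simp only: pcompose_hom)
  then have eq: "R * to_Qx (pcompose ([:0, 1:] * h) W) / (Q * to_Qx W) = R / Q * to_Qx (pcompose h W)"
    using d by simp
  show "R * to_Qx (pcompose ([:0, 1:] * h) W) / (Q * to_Qx W) \<in> Zx"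
    unfolding eq using RQ by (simp only: Zx_intros)
next
  fix Q r s R :: "rat poly fract"
  assume d: "dual Q r s" and r: "specializable r" and RQ: "R / Q \<in> Zx"
  have "specializable (s + 1 / Q\<^sup>2)"
    using specializable_fold[OF dual_sym[OF d] dual_specializable[OF d r], of 1] Zx_intros by simp
  then show "specializable (s + R / Q + 1 / Q\<^sup>2)"
    using specializable_cong[of "s + R / Q + 1 / Q\<^sup>2" "s + 1 / Q\<^sup>2"] RQ by simp
qed

text \<open>Here s cancels R/Q modulo Z[x], which leaves 1/Q^2. The class contains x^2 - x + 1, the
  recursion of Sylvester's sequence.\<close>

lemma specializable_sum_coprime_1:
  assumes deg: "degree f > 1"
    and f: "f = 1 + [:0, 1:] * ([:0, 1:] - 1) * (1 + [:0, 1:] * ([:0, 1:] - 1) * h)"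
  shows "specializable (\<Sum>n<N. 1 / to_Qx (poly_iter f n))"
proof (rule specializable_sum_coprime[THEN conjunct1, OF deg f, of "\<lambda>Q s R. s + R / Q \<in> Zx"])
  show "0 + (to_Qx [:0, 1:] - 1) / 1 \<in> Zx" by (simp add: Zx_intros)
next
  fix Q r s R :: "rat poly fract" and W :: "int poly"
  assume d: "dual Q r s" "W \<noteq> 0" and W: "to_Qx W = 1 + Q * R" and RQ: "s + R / Q \<in> Zx" and R: "R \<in> Zx"
  have "pcompose (1 + [:0, 1:] * ([:0, 1:] - 1) * h) W = 1 + W * (W - 1) * pcompose h W"
    by (simp only: pcompose_hom)
  then have M: "to_Qx (pcompose (1 + [:0, 1:] * ([:0, 1:] - 1) * h) W)
      = 1 + to_Qx W * (Q * R) * to_Qx (pcompose h W)" using W by simp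
  have "Q \<noteq> 0" "to_Qx W \<noteq> 0" using d by (auto simp: dual_def)
  then have "s + R\<^sup>2 / to_Qx W + R * (1 + to_Qx W * (Q * R) * to_Qx (pcompose h W)) / (Q * to_Qx W)
      = s + R / Q * (1 + Q * R) / to_Qx W + R\<^sup>2 * to_Qx (pcompose h W)"
    by (simp add: field_simps power2_eq_square)
  also have "\<dots> = (s + R / Q) + R\<^sup>2 * to_Qx (pcompose h W)"
    unfolding W[symmetric] using \<open>to_Qx W \<noteq> 0\<close> by simp
  finally show "s + R\<^sup>2 / to_Qx W + R * to_Qx (pcompose (1 + [:0, 1:] * ([:0, 1:] - 1) * h) W)
      / (Q * to_Qx W) \<in> Zx"
    unfolding M using RQ R by (simp only: Zx_intros)
next
  fix Q r s R :: "rat poly fract"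
  assume d: "dual Q r s" and RQ: "s + R / Q \<in> Zx"
  have "specializable (1 / Q\<^sup>2)"
    using d by (intro specializable_inverse specializable_Zx) (simp add: dual_def Zx_intros)
  then show "specializable (s + R / Q + 1 / Q\<^sup>2)"
    using specializable_cong[of "s + R / Q + 1 / Q\<^sup>2" "1 / Q\<^sup>2"] RQ by simp
qed

text \<open>Here R/Q is - 2 s modulo Z[x], which leaves - s + 1/Q^2, the negative of a fold with
  factor -1.\<close>

lemma specializable_sum_coprime_2:
  assumes deg: "degree f > 1"
    and f: "f = 1 + [:0, 1:] * ([:0, 1:] - 1) * (2 - [:0, 1:] + [:0, 1:] * ([:0, 1:] - 1) * h)"
  shows "specializable (\<Sum>n<N. 1 / to_Qx (poly_iter f n))"
proof (rule specializable_sum_coprime[THEN conjunct1, OF deg f, of "\<lambda>Q s R. 2 * s + R / Q \<in> Zx"])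
  show "2 * 0 + (to_Qx [:0, 1:] - 1) / 1 \<in> Zx" by (simp add: Zx_intros)
next
  fix Q r s R :: "rat poly fract" and W :: "int poly"
  assume d: "dual Q r s" "W \<noteq> 0" and W: "to_Qx W = 1 + Q * R" and RQ: "2 * s + R / Q \<in> Zx" and R: "R \<in> Zx"
  have "pcompose 2 W = 2" using pcompose_const[of 2 W] by (simp add: numeral_poly)
  then have "pcompose (2 - [:0, 1:] + [:0, 1:] * ([:0, 1:] - 1) * h) W = 2 - W + W * (W - 1) * pcompose h W"
    by (simp only: pcompose_hom)
  then have M: "to_Qx (pcompose (2 - [:0, 1:] + [:0, 1:] * ([:0, 1:] - 1) * h) W)
      = 1 - Q * R + to_Qx W * (Q * R) * to_Qx (pcompose h W)" using W by simp
  have "Q \<noteq> 0" "to_Qx W \<noteq> 0" using d by (auto simp: dual_def)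
  then have "2 * (s + R\<^sup>2 / to_Qx W)
      + R * (1 - Q * R + to_Qx W * (Q * R) * to_Qx (pcompose h W)) / (Q * to_Qx W)
      = 2 * s + R / Q * (1 + Q * R) / to_Qx W + R\<^sup>2 * to_Qx (pcompose h W)"
    by (simp add: field_simps power2_eq_square)
  also have "\<dots> = (2 * s + R / Q) + R\<^sup>2 * to_Qx (pcompose h W)"
    unfolding W[symmetric] using \<open>to_Qx W \<noteq> 0\<close> by simp
  finally show "2 * (s + R\<^sup>2 / to_Qx W)
      + R * to_Qx (pcompose (2 - [:0, 1:] + [:0, 1:] * ([:0, 1:] - 1) * h) W) / (Q * to_Qx W) \<in> Zx"
    unfolding M using RQ R by (simp only: Zx_intros)
next
  fix Q r s R :: "rat poly fract"
  assume d: "dual Q r s" and r: "specializable r" and RQ: "2 * s + R / Q \<in> Zx"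
  have "specializable (s + 1 / (Q\<^sup>2 * - 1))"
    by (rule specializable_fold[OF dual_sym[OF d] dual_specializable[OF d r]]) (auto intro: Zx_intros)
  then have "specializable (- (s + 1 / (Q\<^sup>2 * - 1)))" by (simp only: specializable_neg_iff)
  then show "specializable (s + R / Q + 1 / Q\<^sup>2)"
    using specializable_cong[of "s + R / Q + 1 / Q\<^sup>2" "- s + 1 / Q\<^sup>2"] RQ by (simp add: algebra_simps)
qed

text \<open>No integral relation is carried along; the invariant is the desired conclusion itself.
  After a step, the new s and the new R/Q add up to the old s modulo Z[x], so that the next
  expression is the fold of the old s with factor W^2.\<close>

lemma specializable_sum_coprime_3:
  assumes deg: "degree f > 1"
    and f: "f = 1 + [:0, 1:] * ([:0, 1:] - 1) * (1 - [:0, 1:] + [:0, 1:] * ([:0, 1:] - 1) * h)"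
  shows "specializable (\<Sum>n<N. 1 / to_Qx (poly_iter f n))"
proof (rule specializable_sum_coprime[THEN conjunct1, OF deg f,
      of "\<lambda>Q s R. specializable (s + R / Q + 1 / Q\<^sup>2)"])
  show "specializable (0 + (to_Qx [:0, 1:] - 1) / 1 + 1 / 1\<^sup>2)"
    by (rule specializable_Zx) (simp add: Zx_intros)
next
  fix Q r s R :: "rat poly fract" and W :: "int poly"
  assume d: "dual Q r s" "W \<noteq> 0" and r: "specializable r" and W: "to_Qx W = 1 + Q * R"
    and R: "R \<in> Zx"
  have "pcompose (1 - [:0, 1:] + [:0, 1:] * ([:0, 1:] - 1) * h) W = 1 - W + W * (W - 1) * pcompose h W"
    by (simp only: pcompose_hom)
  then have M: "to_Qx (pcompose (1 - [:0, 1:] + [:0, 1:] * ([:0, 1:] - 1) * h) W)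
      = - (Q * R) + to_Qx W * (Q * R) * to_Qx (pcompose h W)" using W by simp
  have "Q \<noteq> 0" "to_Qx W \<noteq> 0" using d by (auto simp: dual_def)
  then have eq: "s + R\<^sup>2 / to_Qx W
      + R * (- (Q * R) + to_Qx W * (Q * R) * to_Qx (pcompose h W)) / (Q * to_Qx W)
      = s + R\<^sup>2 * to_Qx (pcompose h W)"
    by (simp add: field_simps power2_eq_square)
  have iff: "specializable (s + R\<^sup>2 / to_Qx W
      + R * to_Qx (pcompose (1 - [:0, 1:] + [:0, 1:] * ([:0, 1:] - 1) * h) W) / (Q * to_Qx W)
      + 1 / (Q * to_Qx W)\<^sup>2)
     \<longleftrightarrow> specializable (s + 1 / (Q\<^sup>2 * (to_Qx W)\<^sup>2))"
    unfolding M eq using specializable_cong[of "s + R\<^sup>2 * to_Qx (pcompose h W) + 1 / (Q\<^sup>2 * (to_Qx W)\<^sup>2)"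
        "s + 1 / (Q\<^sup>2 * (to_Qx W)\<^sup>2)"] R
    by (simp add: power_mult_distrib Zx_intros)
  have "specializable (s + 1 / (Q\<^sup>2 * (to_Qx W)\<^sup>2))"
    by (rule specializable_fold[OF dual_sym[OF d(1)] dual_specializable[OF d(1) r]]) (simp add: Zx_intros)
  with iff show "specializable (s + R\<^sup>2 / to_Qx W
      + R * to_Qx (pcompose (1 - [:0, 1:] + [:0, 1:] * ([:0, 1:] - 1) * h) W) / (Q * to_Qx W)
      + 1 / (Q * to_Qx W)\<^sup>2)" by blast
qed

section \<open>Critical cycles\<close>

lemma Zx_divide_intros:
  "a / p \<in> Zx \<Longrightarrow> b / p \<in> Zx \<Longrightarrow> (a + b) / p \<in> Zx"
  "a / p \<in> Zx \<Longrightarrow> b / p \<in> Zx \<Longrightarrow> (a - b) / p \<in> Zx"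
  "a / p \<in> Zx \<Longrightarrow> b \<in> Zx \<Longrightarrow> (a * b) / p \<in> Zx"
  "a \<in> Zx \<Longrightarrow> b / p \<in> Zx \<Longrightarrow> (a * b) / p \<in> Zx"
  using Zx_intros(5)[of "a / p" "b / p"] Zx_intros(6)[of "a / p" "b / p"]
    Zx_intros(7)[of "a / p" b] Zx_intros(7)[of a "b / p"]
  by (simp_all add: add_divide_distrib diff_divide_distrib)

lemmas inverse_expand = divide_inverse inverse_mult_distrib power_inverse[symmetric] power_mult_distrib

lemma dual_cong: "dual q r s \<Longrightarrow> s - s' \<in> Zx \<Longrightarrow> dual q r s'"
proof -
  assume d: "dual q r s" and z: "s - s' \<in> Zx"
  then have m: "q \<in> Zx" "r * q \<in> Zx" "s * q \<in> Zx" "q * r * s - 1 / q \<in> Zx" "q \<noteq> 0"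
    unfolding dual_def by auto
  have "s' * q = s * q - (s - s') * q" "q * r * s' - 1 / q = (q * r * s - 1 / q) - (r * q) * (s - s')"
    by (simp_all add: algebra_simps)
  then show "dual q r s'" unfolding dual_def using m z by (simp only: Zx_intros simp_thms)
qed

lemma dual_neg: "dual q r s \<Longrightarrow> dual q (- r) (- s)"
  using Zx_intros(8) unfolding dual_def by fastforce

lemma Zx_two_poles:
  assumes t: "t = a / p + b / q" "a \<in> Zx" "b \<in> Zx" and w: "w / p \<in> Zx" "w / q \<in> Zx"
  shows "t * w \<in> Zx"
proof -
  have "t * w = a * (w / p) + b * (w / q)" using t by (simp add: algebra_simps)
  then show ?thesis using t w by (simp only: Zx_intros)
qed

text \<open>The mixed term 2 a b/(p q) of the square is split by partial fractions, which is
  possible in Z[x] because p is 1 modulo q.\<close>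

lemma Zx_two_poles_square:
  assumes t: "t = a / p + b / q" "a \<in> Zx" "b \<in> Zx" and w: "w / p\<^sup>2 \<in> Zx" "w / q\<^sup>2 \<in> Zx"
    and pq: "p \<noteq> 0" "q \<noteq> 0" "p \<in> Zx" "q \<in> Zx" "(p - 1) / q \<in> Zx"
  shows "t\<^sup>2 * w \<in> Zx"
proof -
  have "t\<^sup>2 * w = a\<^sup>2 * (w / p\<^sup>2) + 2 * a * b * (q * (w / q\<^sup>2) - ((p - 1) / q) * (p * (w / p\<^sup>2))) + b\<^sup>2 * (w / q\<^sup>2)"
    using pq(1,2) unfolding t(1) by (simp add: field_simps power2_eq_square)
  then show ?thesis using t w pq by (simp only: Zx_intros)
qed

text \<open>The iterates of a polynomial \<open>f = (1 - x)\<^sup>2 (1 + b x + x\<^sup>2 L)\<close>, for which \<open>0\<close> and \<open>1\<close> form a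
  critical cycle, preceded by a dummy element \<open>g 0 = 1\<close>.\<close>

locale critical_cycle =
  fixes g L :: "nat \<Rightarrow> rat poly fract" and b :: "rat poly fract"
  assumes g0: "g 0 = 1" and g_Zx: "g k \<in> Zx" and L_Zx: "L k \<in> Zx" and b_Zx: "b \<in> Zx"
    and g_nz: "g k \<noteq> 0" and g_nm1: "0 < k \<Longrightarrow> g k \<noteq> - 1"
    and rec: "0 < k \<Longrightarrow> g (Suc k) = (1 - g k)\<^sup>2 * (1 + b * g k + (g k)\<^sup>2 * L k)"
begin

definition s :: "nat \<Rightarrow> rat poly fract" where
  "s k = (\<Sum>i<k. 1 / g (Suc i))"

lemma s_0: "s 0 = 0" and s_Suc: "s (Suc k) = s k + 1 / g (Suc k)"
  by (simp_all add: s_def)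

text \<open>Integral because f(0) = 1. Its residues modulo \<open>g k\<close> and
  \<open>g (k - 1)\<close> determine the dual of \<open>s (Suc k)\<close>.\<close>

definition n :: "nat \<Rightarrow> rat poly fract" where
  "n k = (g (Suc k) - 1) / g k"

lemma n_mult: "g (Suc k) = 1 + g k * n k"
  using g_nz by (simp add: n_def)

lemma n_eq: "0 < k \<Longrightarrow> n k = - 2 + g k + (1 - g k)\<^sup>2 * (b + g k * L k)"
  using g_nz[of k] by (simp add: n_def rec field_simps power2_eq_square)

lemma n_Zx: "n k \<in> Zx"
proof (cases "k = 0")
  case True
  then show ?thesis by (simp add: n_def g0 g_Zx Zx_intros)
next
  case False
  then show ?thesis by (simp add: n_eq g_Zx L_Zx b_Zx Zx_intros)
qed

lemma g_mod: "(g (Suc k) - 1) / g k \<in> Zx"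
  using n_Zx unfolding n_def .

text \<open>One turn of the cycle: \<open>g k\<close> divides \<open>g (Suc k) - 1\<close>, and f
  has a double zero at 1.\<close>

lemma g_square: "g (Suc (Suc k)) / (g k)\<^sup>2 \<in> Zx"
proof -
  have "g (Suc (Suc k)) = (g k)\<^sup>2 * ((n k)\<^sup>2 * (1 + b * g (Suc k) + (g (Suc k))\<^sup>2 * L (Suc k)))"
    by (subst rec, simp) (simp add: n_mult[of k] power2_eq_square)
  then have "g (Suc (Suc k)) / (g k)\<^sup>2 = (n k)\<^sup>2 * (1 + b * g (Suc k) + (g (Suc k))\<^sup>2 * L (Suc k))"
    using g_nz by simp
  then show ?thesis using g_Zx L_Zx n_Zx b_Zx by (simp only: Zx_intros)
qed

lemma g_div: "g (Suc (Suc k)) / g k \<in> Zx"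
proof -
  have "g (Suc (Suc k)) / g k = g k * (g (Suc (Suc k)) / (g k)\<^sup>2)"
    using g_nz by (simp add: power2_eq_square)
  then show ?thesis using g_square g_Zx by (simp only: Zx_intros)
qed

text \<open>Each iterate divides the next but one, so all earlier terms can be absorbed into the
  last two denominators.\<close>

lemma s_poles: "\<exists>\<alpha> \<beta>. \<alpha> \<in> Zx \<and> \<beta> \<in> Zx \<and> s k = \<alpha> / g k + \<beta> / g (k - 1)"
proof (induction k)
  case 0
  have "s 0 = 0 / g 0 + 0 / g (0 - 1)" by (simp add: s_0)
  then show ?case using Zx_intros(2) by blast
next
  case (Suc k)
  then obtain \<alpha> \<beta> where ab: "\<alpha> \<in> Zx" "\<beta> \<in> Zx" "s k = \<alpha> / g k + \<beta> / g (k - 1)" by blast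
  show ?case
  proof (cases k)
    case 0
    have "s (Suc k) = 1 / g (Suc k) + 0 / g (Suc k - 1)" by (simp add: s_Suc s_0 0)
    then show ?thesis using Zx_intros(2,3) by blast
  next
    case (Suc j)
    have "s (Suc k) = (1 + \<beta> * (g (Suc k) / g (k - 1))) / g (Suc k) + \<alpha> / g (Suc k - 1)"
      using g_nz[of "Suc k"] g_nz[of "k - 1"] by (simp add: s_Suc ab(3) add_divide_distrib)
    moreover have "1 + \<beta> * (g (Suc k) / g (k - 1)) \<in> Zx"
      using ab g_div[of j] Suc by (simp add: Zx_intros del: times_divide_eq_right)
    ultimately show ?thesis using ab(1) by blast
  qed
qed

lemma s_mult_Zx:
  assumes "w / g k \<in> Zx" "w / g (k - 1) \<in> Zx"
  shows "s k * w \<in> Zx"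
  using s_poles[of k] Zx_two_poles assms by blast

text \<open>For k = 0 the truncated index k - 1 gives the dummy \<open>g 0\<close> = 1, and nothing
  is to be shown. The same convention covers the initial case of the other statements with index k -
  1.\<close>

lemma g_mod_pred: "(g k - 1) / g (k - 1) \<in> Zx"
  using g_mod[of "k - 1"] Zx_intros(2) by (cases k) (simp_all add: g0)

lemma s_square_Zx:
  assumes "w / (g k)\<^sup>2 \<in> Zx" "w / (g (k - 1))\<^sup>2 \<in> Zx"
  shows "(s k)\<^sup>2 * w \<in> Zx"
  using s_poles[of k] Zx_two_poles_square[OF _ _ _ assms g_nz g_nz g_Zx g_Zx g_mod_pred] by blast

lemma n_plus_1: "(n (Suc k) + 1) / g k \<in> Zx"
proof -
  have "n (Suc k) + 1 = (g (Suc k) - 1) * (1 + (g (Suc k) - 1) * (b + g (Suc k) * L (Suc k)))"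
    by (simp add: n_eq algebra_simps power2_eq_square)
  then have "(n (Suc k) + 1) / g k = n k * (1 + (g (Suc k) - 1) * (b + g (Suc k) * L (Suc k)))"
    by (simp add: n_def)
  then show ?thesis using g_Zx L_Zx n_Zx b_Zx by (simp only: Zx_intros)
qed

lemma g_square_pred: "g (Suc k) / (g (k - 1))\<^sup>2 \<in> Zx"
  using g_square[of "k - 1"] g_Zx by (cases k) (simp_all add: g0)

lemma g_div_pred: "g (Suc k) / g (k - 1) \<in> Zx"
  using g_div[of "k - 1"] g_Zx by (cases k) (simp_all add: g0)

lemma g_plus_1_nz: "1 + g (Suc k) \<noteq> 0"
  using g_nm1[of "Suc k"] by (metis add_eq_0_iff minus_minus zero_less_Suc)

lemma s_1: "s (Suc 0) = 1 / g (Suc 0)"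
  by (simp add: s_Suc s_0)

lemma specializable_s_1: "specializable (s (Suc 0))"
  unfolding s_1 by (rule specializable_inverse, rule specializable_Zx, rule g_Zx)

end

section \<open>The critical cycle with f'(0) = -2\<close>

locale critical_cycle_0 = critical_cycle g L 0 for g L
begin

lemma n_plus_2: "(n (Suc k) + 2) / g (Suc k) \<in> Zx"
proof -
  have "n (Suc k) + 2 = g (Suc k) * (1 + (1 - g (Suc k))\<^sup>2 * L (Suc k))"
    by (simp add: n_eq algebra_simps)
  then have "(n (Suc k) + 2) / g (Suc k) = 1 + (1 - g (Suc k))\<^sup>2 * L (Suc k)"
    using g_nz by simp
  then show ?thesis using g_Zx L_Zx by (simp only: Zx_intros)
qed

lemma dual_s:
  "dual (g (Suc k) * g k) (s (Suc k)) (- (s k + (g (Suc k) - 1) / (g (Suc k) * (g k)\<^sup>2)))"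
proof (cases k)
  case 0
  have "1 / g 1 - (- ((g 1 - 1) / g 1)) = 1" using g_nz[of 1] by (simp add: field_simps)
  then have "dual (g 1) (1 / g 1) (- ((g 1 - 1) / g 1))"
    using dual_cong[OF dual_inverse[OF g_Zx g_nz]] Zx_intros(3) by metis
  then show ?thesis by (simp add: 0 g0 s_0 s_Suc)
next
  case (Suc j)
  define y z t m where "y = g (Suc j)" and "z = g (Suc (Suc j))" and "t = s j" and "m = n (Suc j)"
  have nz: "y \<noteq> 0" "z \<noteq> 0" unfolding y_def z_def by (rule g_nz)+
  have z: "z = 1 + y * m" unfolding y_def z_def m_def by (rule n_mult)
  have mem: "y \<in> Zx" "z \<in> Zx" "m \<in> Zx" unfolding y_def z_def m_def by (rule g_Zx n_Zx)+
  have m2: "(m + 2) / y \<in> Zx" unfolding m_def y_def by (rule n_plus_2)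
  have yj: "y / (g (j - 1)) \<in> Zx" "y / (g (j - 1))\<^sup>2 \<in> Zx"
    unfolding y_def by (rule g_div_pred g_square_pred)+
  have zj: "z / g j \<in> Zx" "z / (g j)\<^sup>2 \<in> Zx" unfolding z_def by (rule g_div g_square)+
  have t1: "t * (y * z) \<in> Zx" unfolding t_def
    by (rule s_mult_Zx) (use yj zj mem in \<open>simp_all only: Zx_divide_intros\<close>)
  have t2: "t\<^sup>2 * (y * z) \<in> Zx" unfolding t_def
    by (rule s_square_Zx) (use yj zj mem in \<open>simp_all only: Zx_divide_intros\<close>)
  \<comment> \<open>This is, up to sign, the coefficient of t in z y r r'. It vanishes at both poles
    of t: modulo \<open>g j\<close> since y, z, m are 1, 0, -1 there, and modulo
    \<open>g (j - 1)\<close> since it is a multiple of y, as z = 1 and m = -2 modulo y.\<close>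
  have t3: "t * (y + 2 * z + m) \<in> Zx" unfolding t_def
  proof (rule s_mult_Zx)
    have eq: "y + 2 * z + m = (y - 1) + 2 * z + (m + 1)" by simp
    have "(y - 1) / g j \<in> Zx" "(m + 1) / g j \<in> Zx"
      unfolding y_def m_def by (rule g_mod n_plus_1)+
    then show "(y + 2 * z + m) / g j \<in> Zx"
      unfolding eq using zj by (simp only: Zx_divide_intros Zx_intros)
    have "y + 2 * z + m = y * (1 + 2 * m + (m + 2) / y)" using nz(1) z by (simp add: field_simps)
    then show "(y + 2 * z + m) / g (j - 1) \<in> Zx"
      using yj mem m2 by (simp only: Zx_divide_intros Zx_intros)
  qed
  define r where "r = t + 1 / y + 1 / z"
  define r' where "r' = - (t + 1 / y + m / (z * y))"
  have "r * (z * y) = t * (y * z) + z + y" "r' * (z * y) = - (t * (y * z) + z + m)"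
    unfolding r_def r'_def using nz by (simp_all add: field_simps)
  moreover have "z * y * r * r' - 1 / (z * y)
      = - (t\<^sup>2 * (y * z) + t * (y + 2 * z + m) + m + (m + 2) / y + 1)"
    using right_inverse[OF nz(1)] right_inverse[OF nz(2)] z
    unfolding r_def r'_def inverse_expand by algebra
  ultimately have "dual (z * y) r r'"
    unfolding dual_def using nz mem t1 t2 t3 m2 by (simp add: Zx_intros)
  moreover have "s (Suc k) = r" unfolding r_def t_def y_def z_def Suc by (simp add: s_Suc)
  moreover have "s k + (g (Suc k) - 1) / (g (Suc k) * (g k)\<^sup>2) = - r'"
  proof -
    have "(z - 1) / (z * y\<^sup>2) = m / (z * y)"
      using right_inverse[OF nz(1)] z unfolding inverse_expand by algebra
    then show ?thesis unfolding r'_def t_def y_def z_def Suc by (simp add: s_Suc)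
  qed
  ultimately show ?thesis unfolding Suc y_def z_def by simp
qed

lemma dual_s_pred: "\<exists>s'. dual (g k * g (k - 1)) (s k) s'"
  using dual_s[of "k - 1"] dual_1 by (cases k) (auto simp: g0 s_0)

text \<open>Duality alternates with reduction modulo Z[x]. Up to sign, the chain leads from
  \<open>s (j + 3)\<close> to \<open>s (j + 1)\<close> + (1 + y)/y^2, then to a fold of
  \<open>s j\<close> with an extra term, and ends at the dual of \<open>s (j + 1)\<close>.\<close>

lemma specializable_s_step:
  assumes sp: "specializable (s (Suc (Suc j)))" "specializable (s (Suc j))" "specializable (s j)"
  shows "specializable (s (Suc (Suc (Suc j))))"
proof -
  define u' u y z t m l where "u' = g j" and "u = g (Suc j)" and "y = g (Suc (Suc j))"
    and "z = g (Suc (Suc (Suc j)))" and "t = s j" and "m = n (Suc j)" and "l = L (Suc (Suc j))"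
  have nz: "u' \<noteq> 0" "u \<noteq> 0" "y \<noteq> 0" "z \<noteq> 0" unfolding u'_def u_def y_def z_def by (rule g_nz)+
  have mem: "u' \<in> Zx" "u \<in> Zx" "y \<in> Zx" "m \<in> Zx" "l \<in> Zx"
    unfolding u'_def u_def y_def m_def l_def by (rule g_Zx n_Zx L_Zx)+
  have y: "y = 1 + u * m" unfolding u_def y_def m_def by (rule n_mult)
  have z: "z = (1 - y)\<^sup>2 * (1 + y\<^sup>2 * l)" unfolding z_def y_def l_def by (subst rec) simp_all
  have y1: "1 + y \<noteq> 0" using g_nm1[of "Suc (Suc j)"] unfolding y_def
    by (metis add_eq_0_iff minus_minus zero_less_Suc)
  have s1: "s (Suc j) = t + 1 / u" and s2: "s (Suc (Suc j)) = t + 1 / u + 1 / y"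
    and s3: "s (Suc (Suc (Suc j))) = t + 1 / u + 1 / y + 1 / z"
    by (simp_all add: s_Suc t_def u_def y_def z_def)
  have d2: "dual (y * u) (t + 1 / u + 1 / y) (- (t + 1 / u + (y - 1) / (y * u\<^sup>2)))"
    using dual_s[of "Suc j"] unfolding s2 s1 y_def u_def by (simp add: add.assoc)
  have d1: "dual (u * u') (t + 1 / u) (- (t + (u - 1) / (u * u'\<^sup>2)))"
    using dual_s[of j] unfolding s1 u'_def u_def t_def by simp
  have "specializable (t + 1 / u + 1 / y + 1 / z)
      \<longleftrightarrow> specializable (- (t + 1 / u + (y - 1) / (y * u\<^sup>2)) + 1 / ((y * u)\<^sup>2 * (1 / z)))"
    using dual_add_iff[OF d2] sp(1) s2 nz by simp
  also have "\<dots> \<longleftrightarrow> specializable (- (t + 1 / u + (y - 1) / (u\<^sup>2 * y\<^sup>2)))"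
  proof (rule specializable_cong)
    have "- (t + 1 / u + (y - 1) / (y * u\<^sup>2)) + z / (y * u)\<^sup>2
        - - (t + 1 / u + (y - 1) / (u\<^sup>2 * y\<^sup>2)) = m\<^sup>2 * l"
      using right_inverse[OF nz(2)] right_inverse[OF nz(3)] z y unfolding inverse_expand by algebra
    then show "- (t + 1 / u + (y - 1) / (y * u\<^sup>2)) + 1 / ((y * u)\<^sup>2 * (1 / z))
        - - (t + 1 / u + (y - 1) / (u\<^sup>2 * y\<^sup>2)) \<in> Zx" using mem by (simp add: Zx_intros)
  qed
  also have "\<dots> \<longleftrightarrow> specializable (t + 1 / u + (y - 1) / (u\<^sup>2 * y\<^sup>2))" by (rule specializable_neg_iff)
  finally have iff1: "specializable (t + 1 / u + 1 / y + 1 / z)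
      \<longleftrightarrow> specializable (t + 1 / u + (y - 1) / (u\<^sup>2 * y\<^sup>2))" .

  have uj: "u / g (j - 1) \<in> Zx" "u / (g (j - 1))\<^sup>2 \<in> Zx" "u / (g (j - 1))\<^sup>2 \<noteq> 0"
    using g_div_pred[of j] g_square_pred[of j] g_nz unfolding u_def by simp_all
  have yj: "y / g j \<in> Zx" "y / (g j)\<^sup>2 \<in> Zx" unfolding y_def by (rule g_div g_square)+
  define r where "r = t + 1 / u + (y - 1) / (u\<^sup>2 * y\<^sup>2)"
  define r' where "r' = - (t + 1 / u + (1 + y) / y\<^sup>2)"
  have m2: "(m + 2) / u \<in> Zx" unfolding m_def u_def by (rule n_plus_2)
  have t1: "t * (u * y\<^sup>2) \<in> Zx" unfolding t_def power2_eq_square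
    by (rule s_mult_Zx) (use uj yj mem in \<open>simp_all only: Zx_divide_intros Zx_intros\<close>)
  have t2: "t\<^sup>2 * (u * (y * y)) \<in> Zx" unfolding t_def
    by (rule s_square_Zx) (use uj yj mem in \<open>simp_all only: Zx_divide_intros Zx_intros\<close>)
  have t3: "t * (2 * y\<^sup>2 + u + u * y + m) \<in> Zx" unfolding t_def
  proof (rule s_mult_Zx)
    have eq: "2 * y\<^sup>2 + u + u * y + m = 2 * (y * y) + u * y + (u - 1) + (m + 1)"
      by (simp add: power2_eq_square)
    have "(u - 1) / g j \<in> Zx" "(m + 1) / g j \<in> Zx" unfolding u_def m_def by (rule g_mod n_plus_1)+
    then show "(2 * y\<^sup>2 + u + u * y + m) / g j \<in> Zx"
      unfolding eq using yj mem by (simp only: Zx_divide_intros Zx_intros)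
    have eq: "2 * y\<^sup>2 + u + u * y + m = u * (2 * m * (y + 1) + 1 + y + (m + 2) / u)"
      using right_inverse[OF nz(2)] y unfolding inverse_expand by algebra
    show "(2 * y\<^sup>2 + u + u * y + m) / g (j - 1) \<in> Zx"
      unfolding eq using uj mem m2 by (simp only: Zx_divide_intros Zx_intros)
  qed
  have "r * (u * y\<^sup>2) = t * (u * y\<^sup>2) + y\<^sup>2 + m" "r' * (u * y\<^sup>2) = - (t * (u * y\<^sup>2) + y\<^sup>2 + u * (1 + y))"
    "u * y\<^sup>2 * r * r' - 1 / (u * y\<^sup>2)
      = - (t\<^sup>2 * (u * (y * y)) + t * (2 * y\<^sup>2 + u + u * y + m) + m * (y + 1) + (m + 2) / u + 1 + y)"
    using right_inverse[OF nz(2)] right_inverse[OF nz(3)] y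
    unfolding r_def r'_def inverse_expand by algebra+
  then have "dual (u * y\<^sup>2) r r'"
    unfolding dual_def using nz mem t1 t2 t3 m2 by (simp add: Zx_intros)
  then have imp2: "specializable (t + 1 / u + (1 + y) / y\<^sup>2) \<Longrightarrow> specializable r"
    using dual_specializable[OF dual_sym] specializable_neg_iff unfolding r'_def by blast

  \<comment> \<open>Division of y^2 by 1 + y leaves 1, so y^2/((1 + y)(u u')^2) splits into (y -
    1)/(u u')^2 and e. The first part, added to the dual of \<open>s (j + 1)\<close>, gives -(t + v)
    modulo Z[x].\<close>
  define v where "v = 1 / (u * u'\<^sup>2)"
  define e where "e = 1 / ((1 + y) * (u * u')\<^sup>2)"
  define lu where "lu = L (Suc j)"
  have lu: "lu \<in> Zx" "n j \<in> Zx" unfolding lu_def by (rule L_Zx n_Zx)+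
  have u: "u = 1 + u' * n j" unfolding u_def u'_def by (rule n_mult)
  have m: "m = - 2 + u + (1 - u)\<^sup>2 * (u * lu)" unfolding m_def u_def lu_def by (subst n_eq) simp_all
  have "specializable (t + 1 / u + (1 + y) / y\<^sup>2)
      \<longleftrightarrow> specializable (- (t + (u - 1) / (u * u'\<^sup>2)) + 1 / ((u * u')\<^sup>2 * ((1 + y) / y\<^sup>2)))"
    using dual_add_iff[OF d1] sp(2) s1 nz y1 by simp
  also have "\<dots> \<longleftrightarrow> specializable (- (t + v) + e)"
  proof (rule specializable_cong)
    have "- (t + (u - 1) / (u * u'\<^sup>2)) + y\<^sup>2 / ((u * u')\<^sup>2 * (1 + y)) - (- (t + v) + e) = (n j)\<^sup>2 * lu"
      using right_inverse[OF nz(1)] right_inverse[OF nz(2)] right_inverse[OF y1] u y m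
      unfolding v_def e_def inverse_expand by algebra
    then show "- (t + (u - 1) / (u * u'\<^sup>2)) + 1 / ((u * u')\<^sup>2 * ((1 + y) / y\<^sup>2)) - (- (t + v) + e) \<in> Zx"
      using lu by (simp add: Zx_intros)
  qed
  finally have iff3: "specializable (t + 1 / u + (1 + y) / y\<^sup>2) \<longleftrightarrow> specializable (- (t + v) + e)" .

  obtain t' where t': "dual (u' * g (j - 1)) t t'" using dual_s_pred unfolding u'_def t_def by blast
  \<comment> \<open>t + v is the fold of t with the integral factor u/(g (j - 1))^2, whose
    denominator is u u'^2.\<close>
  have q: "(u' * g (j - 1))\<^sup>2 * (u / (g (j - 1))\<^sup>2) = u * u'\<^sup>2"
    using g_nz by (simp add: power_mult_distrib)
  have dv: "dual (u * u'\<^sup>2) (- (t + v)) (t - v)"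
    using dual_neg[OF dual_fold[OF t' uj(2,3)]] unfolding q v_def by simp
  have "specializable (- (t + v))"
    using specializable_fold[OF t' _ uj(2)] sp(3) unfolding q v_def t_def specializable_neg_iff by simp
  then have "specializable (- (t + v) + e) \<longleftrightarrow> specializable (t - v + 1 / ((u * u'\<^sup>2)\<^sup>2 * e))"
    using dual_add_iff[OF dv] nz y1 unfolding e_def by simp
  also have "\<dots> \<longleftrightarrow> specializable (t + (u - 1) / (u * u'\<^sup>2))"
  proof (rule specializable_cong)
    have "1 / ((u * u'\<^sup>2)\<^sup>2 * e) = (1 + y) / u'\<^sup>2"
      using nz y1 unfolding e_def by (simp add: field_simps power2_eq_square)
    moreover have "t - v + (1 + y) / u'\<^sup>2 - (t + (u - 1) / (u * u'\<^sup>2)) = y / (g j)\<^sup>2"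
      using right_inverse[OF nz(1)] right_inverse[OF nz(2)] unfolding v_def u'_def[symmetric] inverse_expand by algebra
    ultimately show "t - v + 1 / ((u * u'\<^sup>2)\<^sup>2 * e) - (t + (u - 1) / (u * u'\<^sup>2)) \<in> Zx"
      using yj by simp
  qed
  also have "\<dots>" using dual_specializable[OF d1] sp(2) unfolding s1 specializable_neg_iff by blast
  finally show ?thesis using iff1 imp2 iff3 unfolding s3 r_def by blast
qed

text \<open>Modulo x^2, z is 1 - 2x, so 1/x + z/x^2 becomes -(1/x - 1/x^2), the negative of a fold
  with factor -1.\<close>

lemma specializable_s_2: "specializable (s (Suc (Suc 0)))"
proof -
  define x z l where "x = g (Suc 0)" and "z = g (Suc (Suc 0))" and "l = L (Suc 0)"
  have nz: "x \<noteq> 0" "z \<noteq> 0" and x: "x \<in> Zx" and l: "l \<in> Zx"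
    unfolding x_def z_def l_def by (rule g_nz g_Zx L_Zx)+
  have z: "z = (1 - x)\<^sup>2 * (1 + x\<^sup>2 * l)" unfolding z_def x_def l_def by (subst rec) simp_all
  have d: "dual x (1 / x) (1 / x)" by (rule dual_inverse) fact+
  have sx: "specializable (1 / x)" using specializable_s_1 unfolding s_1 x_def .
  have "specializable (1 / x + 1 / z) \<longleftrightarrow> specializable (1 / x + z / x\<^sup>2)"
    using dual_add_iff[OF d sx, of "1 / z"] nz by simp
  also have "\<dots> \<longleftrightarrow> specializable (- (1 / x + 1 / (x\<^sup>2 * - 1)))"
  proof (rule specializable_cong)
    have "1 / x + z / x\<^sup>2 + 1 / x - 1 / x\<^sup>2 = 1 + (1 - x)\<^sup>2 * l"
      using right_inverse[OF nz(1)] z unfolding inverse_expand by algebra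
    then have "1 / x + z / x\<^sup>2 - - (1 / x + 1 / (x\<^sup>2 * - 1)) = 1 + (1 - x)\<^sup>2 * l" by simp
    then show "1 / x + z / x\<^sup>2 - - (1 / x + 1 / (x\<^sup>2 * - 1)) \<in> Zx"
      using x l by (simp only: Zx_intros)
  qed
  also have "\<dots>" unfolding specializable_neg_iff
    by (rule specializable_fold[OF d sx]) (simp only: Zx_intros)
  finally show ?thesis by (simp add: s_Suc s_0 x_def z_def)
qed

lemma specializable_s: "specializable (s k)"
proof -
  have "specializable (s k) \<and> specializable (s (Suc k)) \<and> specializable (s (Suc (Suc k)))"
  proof (induction k)
    case 0
    have "specializable (s 0)" unfolding s_0 by (rule specializable_Zx) (rule Zx_intros)
    then show ?case using specializable_s_1 specializable_s_2 by blast
  next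
    case (Suc k)
    then show ?case using specializable_s_step by blast
  qed
  then show ?thesis by blast
qed

end

section \<open>The critical cycle with f'(0) = -1\<close>

locale critical_cycle_1 = critical_cycle g L 1 for g L
begin

lemma n_plus_1': "(n k + 1) / g k \<in> Zx"
proof (cases k)
  case 0
  then show ?thesis using n_Zx[of 0] by (simp add: g0 Zx_intros)
next
  case (Suc j)
  have "n k + 1 = g k * (- 1 + g k + (1 - g k)\<^sup>2 * L k)"
    unfolding Suc by (subst n_eq) (simp_all add: algebra_simps power2_eq_square)
  then have "(n k + 1) / g k = - 1 + g k + (1 - g k)\<^sup>2 * L k"
    using g_nz by simp
  then show ?thesis using g_Zx L_Zx by (simp only: Zx_intros)
qed

text \<open>Compared with the other cycle, \<open>s (k - 1)\<close> replaces \<open>s k\<close>;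
  correspondingly, \<open>n k\<close> is now -1 rather than -2 modulo \<open>g k\<close>.\<close>

lemma dual_s:
  "dual (g (Suc k) * g k) (s (Suc k)) (- (s (k - 1) + (g (Suc k) - 1) / (g (Suc k) * (g k)\<^sup>2)))"
proof (cases k)
  case 0
  have "1 / g 1 - (- ((g 1 - 1) / g 1)) = 1" using g_nz[of 1] by (simp add: field_simps)
  then have "dual (g 1) (1 / g 1) (- ((g 1 - 1) / g 1))"
    using dual_cong[OF dual_inverse[OF g_Zx g_nz]] Zx_intros(3) by metis
  then show ?thesis by (simp add: 0 g0 s_0 s_Suc)
next
  case (Suc j)
  define y z t m where "y = g (Suc j)" and "z = g (Suc (Suc j))" and "t = s j" and "m = n (Suc j)"
  have nz: "y \<noteq> 0" "z \<noteq> 0" unfolding y_def z_def by (rule g_nz)+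
  have z: "z = 1 + y * m" unfolding y_def z_def m_def by (rule n_mult)
  have mem: "y \<in> Zx" "z \<in> Zx" "m \<in> Zx" unfolding y_def z_def m_def by (rule g_Zx n_Zx)+
  have m1: "(m + 1) / y \<in> Zx" unfolding m_def y_def by (rule n_plus_1')
  have yj: "y / (g (j - 1)) \<in> Zx" "y / (g (j - 1))\<^sup>2 \<in> Zx"
    unfolding y_def by (rule g_div_pred g_square_pred)+
  have zj: "z / g j \<in> Zx" "z / (g j)\<^sup>2 \<in> Zx" unfolding z_def by (rule g_div g_square)+
  have t1: "t * (y * z) \<in> Zx" unfolding t_def
    by (rule s_mult_Zx) (use yj zj mem in \<open>simp_all only: Zx_divide_intros\<close>)
  have t2: "t\<^sup>2 * (y * z) \<in> Zx" unfolding t_def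
    by (rule s_square_Zx) (use yj zj mem in \<open>simp_all only: Zx_divide_intros\<close>)
  have t3: "t * (y + z + m) \<in> Zx" unfolding t_def
  proof (rule s_mult_Zx)
    have eq: "y + z + m = (y - 1) + z + (m + 1)" by simp
    have "(y - 1) / g j \<in> Zx" "(m + 1) / g j \<in> Zx"
      unfolding y_def m_def by (rule g_mod n_plus_1)+
    then show "(y + z + m) / g j \<in> Zx"
      unfolding eq using zj by (simp only: Zx_divide_intros Zx_intros)
    have "y + z + m = y * (1 + m + (m + 1) / y)" using nz(1) z by (simp add: field_simps)
    then show "(y + z + m) / g (j - 1) \<in> Zx"
      using yj mem m1 by (simp only: Zx_divide_intros Zx_intros)
  qed
  define r where "r = t + 1 / y + 1 / z"
  define r' where "r' = - (t + m / (z * y))"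
  have "r * (z * y) = t * (y * z) + z + y" "r' * (z * y) = - (t * (y * z) + m)"
    unfolding r_def r'_def using nz by (simp_all add: field_simps)
  moreover have "z * y * r * r' - 1 / (z * y)
      = - (t\<^sup>2 * (y * z) + t * (y + z + m) + (m + 1) / y)"
    using right_inverse[OF nz(1)] right_inverse[OF nz(2)] z
    unfolding r_def r'_def inverse_expand by algebra
  ultimately have "dual (z * y) r r'"
    unfolding dual_def using nz mem t1 t2 t3 m1 by (simp add: Zx_intros)
  moreover have "s (Suc k) = r" unfolding r_def t_def y_def z_def Suc by (simp add: s_Suc)
  moreover have "s (k - 1) + (g (Suc k) - 1) / (g (Suc k) * (g k)\<^sup>2) = - r'"
  proof -
    have "(z - 1) / (z * y\<^sup>2) = m / (z * y)"
      using right_inverse[OF nz(1)] z unfolding inverse_expand by algebra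
    then show ?thesis unfolding r'_def t_def y_def z_def Suc by simp
  qed
  ultimately show ?thesis unfolding Suc y_def z_def by simp
qed

text \<open>The difference is 0 except for k = 0, where the truncated index repeats
  \<open>s 0\<close> and the dummy term contributes 1.\<close>

lemma s_pred: "s k - (s (k - 1) + 1 / g k) \<in> Zx"
  by (cases k) (simp_all add: s_0 s_Suc g0 Zx_intros)

text \<open>The induction for \<open>s\<close> does not close by itself: up to duality, \<open>s (k + 3)\<close> reduces to \<open>c (k + 1)\<close>,
  and \<open>c (k + 3)\<close> reduces to \<open>c (k + 1)\<close>.\<close>

definition c :: "nat \<Rightarrow> rat poly fract" where
  "c k = s k + 1 / (g k)\<^sup>2"

text \<open>The step for \<open>s\<close> ends at the first member of this pair; the step for
  \<open>c\<close> passes from the second member to the first.\<close>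

lemma dual_c:
  "dual (g k * (g (Suc k))\<^sup>2) (s (k - 1) + (g (Suc k) - 1) / ((g (Suc k))\<^sup>2 * (g k)\<^sup>2)) (- c (Suc k))"
proof -
  define u' u t m where "u' = g k" and "u = g (Suc k)" and "t = s (k - 1)" and "m = n k"
  have nz: "u' \<noteq> 0" "u \<noteq> 0" unfolding u'_def u_def by (rule g_nz)+
  have mem: "u' \<in> Zx" "u \<in> Zx" "m \<in> Zx" unfolding u'_def u_def m_def by (rule g_Zx n_Zx)+
  have u: "u = 1 + u' * m" unfolding u_def u'_def m_def by (rule n_mult)
  have m1: "(m + 1) / u' \<in> Zx" unfolding m_def u'_def by (rule n_plus_1')
  have uk: "u / g (k - 1) \<in> Zx" "u / (g (k - 1))\<^sup>2 \<in> Zx"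
    unfolding u_def by (rule g_div_pred g_square_pred)+
  have uk': "u' / g (k - 1 - 1) \<in> Zx" "u' / (g (k - 1 - 1))\<^sup>2 \<in> Zx"
    unfolding u'_def using g_div_pred[of "k - 1"] g_square_pred[of "k - 1"] Zx_intros(3)
    by (cases k; simp add: g0)+
  have t1: "t * (u' * (u * u)) \<in> Zx" unfolding t_def
    by (rule s_mult_Zx) (use uk uk' mem in \<open>simp_all only: Zx_divide_intros Zx_intros\<close>)
  have t2: "t\<^sup>2 * (u' * (u * u)) \<in> Zx" unfolding t_def
    by (rule s_square_Zx) (use uk uk' mem in \<open>simp_all only: Zx_divide_intros Zx_intros\<close>)
  have t3: "t * (m + u' * (1 + u) + u\<^sup>2) \<in> Zx" unfolding t_def
  proof (rule s_mult_Zx)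
    have eq: "m + u' * (1 + u) + u\<^sup>2 = (m + 1) + (u' - 1) + u' * u + u * u"
      by (simp add: algebra_simps power2_eq_square)
    have "(u' - 1) / g (k - 1) \<in> Zx" unfolding u'_def by (rule g_mod_pred)
    moreover have "(m + 1) / g (k - 1) \<in> Zx"
      using n_plus_1[of "k - 1"] mem unfolding m_def by (cases k) (simp_all add: g0 Zx_intros)
    ultimately show "(m + u' * (1 + u) + u\<^sup>2) / g (k - 1) \<in> Zx"
      unfolding eq using uk mem by (simp only: Zx_divide_intros Zx_intros)
    have eq: "m + u' * (1 + u) + u\<^sup>2 = u' * ((m + 1) / u' + 1 + u + m * (u + 1))"
      using right_inverse[OF nz(1)] u unfolding inverse_expand by algebra
    show "(m + u' * (1 + u) + u\<^sup>2) / g (k - 1 - 1) \<in> Zx"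
      unfolding eq using uk' mem m1 by (simp only: Zx_divide_intros Zx_intros)
  qed
  define r where "r = t + (u - 1) / (u\<^sup>2 * u'\<^sup>2)"
  define r' where "r' = - (t + 1 / u' + 1 / u + 1 / u\<^sup>2)"
  have "r * (u' * u\<^sup>2) = t * (u' * (u * u)) + m"
    "r' * (u' * u\<^sup>2) = - (t * (u' * (u * u)) + u\<^sup>2 + u' * (u + 1))"
    "u' * u\<^sup>2 * r * r' - 1 / (u' * u\<^sup>2)
      = - (t\<^sup>2 * (u' * (u * u)) + t * (m + u' * (1 + u) + u\<^sup>2) + (m + 1) / u')"
    using right_inverse[OF nz(1)] right_inverse[OF nz(2)] u
    unfolding r_def r'_def inverse_expand by algebra+
  then have "dual (u' * u\<^sup>2) r r'"
    unfolding dual_def using nz mem t1 t2 t3 m1 by (simp add: Zx_intros)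
  moreover have "r' - - c (Suc k) = s k - (s (k - 1) + 1 / g k)"
    unfolding r'_def c_def s_Suc u'_def u_def t_def by simp
  ultimately have "dual (u' * u\<^sup>2) r (- c (Suc k))" using dual_cong s_pred by metis
  then show ?thesis unfolding r_def u'_def u_def t_def .
qed

text \<open>Put v = \<open>g k\<close>. Modulo v^2 the next iterate is (1 - v)^2 (1 + v), whose
  square is (1 - v)^2 (1 - v^2)^2. So the difference contains (1 - v)^2 v^2, and
  \<open>g (k - 1)\<close> divides 1 - v.\<close>

lemma square_mod:
  assumes "0 < k"
  shows "((g (Suc k))\<^sup>2 - (g k - 1)\<^sup>2) / (g k * g (k - 1))\<^sup>2 \<in> Zx"
proof -
  obtain j where k: "k = Suc j" using assms gr0_conv_Suc by blast
  define v' v w m l where "v' = g j" and "v = g (Suc j)" and "w = g (Suc (Suc j))" and "m = n j"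
    and "l = L (Suc j)"
  have nz: "v' \<noteq> 0" "v \<noteq> 0" unfolding v'_def v_def by (rule g_nz)+
  have mem: "v \<in> Zx" "m \<in> Zx" "l \<in> Zx" unfolding v_def m_def l_def by (rule g_Zx n_Zx L_Zx)+
  have v: "v = 1 + v' * m" unfolding v_def v'_def m_def by (rule n_mult)
  have w: "w = (1 - v)\<^sup>2 * (1 + v + v\<^sup>2 * l)" unfolding w_def v_def l_def by (subst rec) simp_all
  have "(w\<^sup>2 - (v - 1)\<^sup>2) / (v * v')\<^sup>2
      = m\<^sup>2 * ((l * (1 - v) - 1) * (2 + v\<^sup>2 * (l * (1 - v) - 1)))"
    using right_inverse[OF nz(1)] right_inverse[OF nz(2)] v w unfolding inverse_expand by algebra
  then show ?thesis
    using mem unfolding k w_def v_def v'_def by (simp only: Zx_intros diff_Suc_1)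
qed

text \<open>Two dualities lead from \<open>s (j + 3)\<close> to \<open>s (j + 1)\<close> + 1/y^2. A
  third one, with \<open>square_mod\<close>, leads to the dual partner of
  \<open>c (j + 1)\<close>.\<close>

lemma specializable_s_step:
  assumes sp: "specializable (s (Suc (Suc j)))" "specializable (s (Suc j))" "specializable (c (Suc j))"
  shows "specializable (s (Suc (Suc (Suc j))))"
proof -
  define u' u y z t m l where "u' = g j" and "u = g (Suc j)" and "y = g (Suc (Suc j))"
    and "z = g (Suc (Suc (Suc j)))" and "t = s j" and "m = n (Suc j)" and "l = L (Suc (Suc j))"
  have nz: "u' \<noteq> 0" "u \<noteq> 0" "y \<noteq> 0" "z \<noteq> 0" unfolding u'_def u_def y_def z_def by (rule g_nz)+
  have mem: "u' \<in> Zx" "u \<in> Zx" "y \<in> Zx" "m \<in> Zx" "l \<in> Zx"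
    unfolding u'_def u_def y_def m_def l_def by (rule g_Zx n_Zx L_Zx)+
  have y: "y = 1 + u * m" unfolding u_def y_def m_def by (rule n_mult)
  have z: "z = (1 - y)\<^sup>2 * (1 + y + y\<^sup>2 * l)" unfolding z_def y_def l_def by (subst rec) simp_all
  have s1: "s (Suc j) = t + 1 / u" and s2: "s (Suc (Suc j)) = t + 1 / u + 1 / y"
    and s3: "s (Suc (Suc (Suc j))) = t + 1 / u + 1 / y + 1 / z"
    by (simp_all add: s_Suc t_def u_def y_def z_def)
  define t' where "t' = s (j - 1)"
  have d2: "dual (y * u) (t + 1 / u + 1 / y) (- (t + (y - 1) / (y * u\<^sup>2)))"
    using dual_s[of "Suc j"] unfolding s2 y_def u_def t_def by simp
  have d1: "dual (u * u') (t + 1 / u) (- (t' + (u - 1) / (u * u'\<^sup>2)))"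
    using dual_s[of j] unfolding s1 u'_def u_def t'_def by simp
  \<comment> \<open>Up to sign and modulo Z[x], this is the dual of \<open>s (j + 2)\<close> plus
    z/(y u)^2, because (y - 1) y - (y - 1)^2 (1 + y) = (y - 1)(1 + y - y^2).\<close>
  define r where "r = t + (y - 1) * (1 + y - y\<^sup>2) / (u\<^sup>2 * y\<^sup>2)"
  have "specializable (t + 1 / u + 1 / y + 1 / z)
      \<longleftrightarrow> specializable (- (t + (y - 1) / (y * u\<^sup>2)) + 1 / ((y * u)\<^sup>2 * (1 / z)))"
    using dual_add_iff[OF d2] sp(1) s2 nz by simp
  also have "\<dots> \<longleftrightarrow> specializable (- r)"
  proof (rule specializable_cong)
    have "- (t + (y - 1) / (y * u\<^sup>2)) + z / (y * u)\<^sup>2 - - r = m\<^sup>2 * l"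
      using right_inverse[OF nz(2)] right_inverse[OF nz(3)] z y unfolding r_def inverse_expand by algebra
    then show "- (t + (y - 1) / (y * u\<^sup>2)) + 1 / ((y * u)\<^sup>2 * (1 / z)) - - r \<in> Zx"
      using mem by (simp add: Zx_intros)
  qed
  also have "\<dots> \<longleftrightarrow> specializable r" by (rule specializable_neg_iff)
  finally have iff1: "specializable (t + 1 / u + 1 / y + 1 / z) \<longleftrightarrow> specializable r" .

  have uj: "u / g (j - 1) \<in> Zx" "u / (g (j - 1))\<^sup>2 \<in> Zx"
    unfolding u_def by (rule g_div_pred g_square_pred)+
  have yj: "y / g j \<in> Zx" "y / (g j)\<^sup>2 \<in> Zx" unfolding y_def by (rule g_div g_square)+
  define r' where "r' = - (t + 1 / u + 1 / y\<^sup>2)"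
  define c1 where "c1 = (m + 1) / u"
  have c1: "c1 \<in> Zx" unfolding c1_def m_def u_def by (rule n_plus_1')
  have m: "m = - 1 + u * c1" unfolding c1_def using nz by simp
  have t1: "t * (u * (y * y)) \<in> Zx" unfolding t_def
    by (rule s_mult_Zx) (use uj yj mem in \<open>simp_all only: Zx_divide_intros Zx_intros\<close>)
  have t2: "t\<^sup>2 * (u * (y * y)) \<in> Zx" unfolding t_def
    by (rule s_square_Zx) (use uj yj mem in \<open>simp_all only: Zx_divide_intros Zx_intros\<close>)
  have t3: "t * (y\<^sup>2 + u + m * (1 + y - y\<^sup>2)) \<in> Zx" unfolding t_def
  proof (rule s_mult_Zx)
    have eq: "y\<^sup>2 + u + m * (1 + y - y\<^sup>2) = y * (y + m * (1 - y)) + (u - 1) + (m + 1)"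
      by (simp add: algebra_simps power2_eq_square)
    have "(u - 1) / g j \<in> Zx" "(m + 1) / g j \<in> Zx" unfolding u_def m_def by (rule g_mod n_plus_1)+
    then show "(y\<^sup>2 + u + m * (1 + y - y\<^sup>2)) / g j \<in> Zx"
      unfolding eq using yj mem by (simp only: Zx_divide_intros Zx_intros)
    have eq: "y\<^sup>2 + u + m * (1 + y - y\<^sup>2) = u * (m * (2 * y + 1) + 1 + c1 * (1 + y - y\<^sup>2))"
      using y m by algebra
    show "(y\<^sup>2 + u + m * (1 + y - y\<^sup>2)) / g (j - 1) \<in> Zx"
      unfolding eq using uj mem c1 by (simp only: Zx_divide_intros Zx_intros)
  qed
  have "r * (u * y\<^sup>2) = t * (u * (y * y)) + m * (1 + y - y\<^sup>2)"
    "r' * (u * y\<^sup>2) = - (t * (u * (y * y)) + y\<^sup>2 + u)"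
    "u * y\<^sup>2 * r * r' - 1 / (u * y\<^sup>2)
      = - (t\<^sup>2 * (u * (y * y)) + t * (y\<^sup>2 + u + m * (1 + y - y\<^sup>2)) + c1 * (1 + y - y\<^sup>2) + m * (y - 1))"
    using right_inverse[OF nz(2)] right_inverse[OF nz(3)] y m
    unfolding r_def r'_def inverse_expand by algebra+
  then have "dual (u * y\<^sup>2) r r'"
    unfolding dual_def using nz mem t1 t2 t3 c1 by (simp add: Zx_intros)
  then have imp2: "specializable (t + 1 / u + 1 / y\<^sup>2) \<Longrightarrow> specializable r"
    using dual_specializable[OF dual_sym] specializable_neg_iff unfolding r'_def by blast

  have "specializable (t + 1 / u + 1 / y\<^sup>2)
      \<longleftrightarrow> specializable (- (t' + (u - 1) / (u * u'\<^sup>2)) + 1 / ((u * u')\<^sup>2 * (1 / y\<^sup>2)))"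
    using dual_add_iff[OF d1] sp(2) s1 nz by simp
  also have "\<dots> \<longleftrightarrow> specializable (- (t' + (u - 1) / (u\<^sup>2 * u'\<^sup>2)))"
  proof (rule specializable_cong)
    have "- (t' + (u - 1) / (u * u'\<^sup>2)) + y\<^sup>2 / (u * u')\<^sup>2 - - (t' + (u - 1) / (u\<^sup>2 * u'\<^sup>2))
        = (y\<^sup>2 - (u - 1)\<^sup>2) / (u * u')\<^sup>2"
      using right_inverse[OF nz(1)] right_inverse[OF nz(2)] unfolding inverse_expand by algebra
    also have "\<dots> \<in> Zx" using square_mod[of "Suc j"] unfolding y_def u_def u'_def by simp
    finally show "- (t' + (u - 1) / (u * u'\<^sup>2)) + 1 / ((u * u')\<^sup>2 * (1 / y\<^sup>2))
        - - (t' + (u - 1) / (u\<^sup>2 * u'\<^sup>2)) \<in> Zx" by simp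
  qed
  also have "\<dots>"
    unfolding specializable_neg_iff
    using dual_specializable[OF dual_sym[OF dual_c[of j]]] sp(3)
    unfolding specializable_neg_iff t'_def u_def u'_def by blast
  finally show ?thesis using iff1 imp2 unfolding s3 by blast
qed

text \<open>Since \<open>c (j + 3)\<close> is \<open>s (j + 2)\<close> + (1 + u)/u^2, duality leads
  to - \<open>c (j + 1)\<close> + e. A second duality, based on \<open>dual_c\<close>, leads to the
  dual of \<open>s (j + 1)\<close> up to sign.\<close>

lemma specializable_c_step:
  assumes sp: "specializable (s (Suc (Suc j)))" "specializable (s (Suc j))" "specializable (c (Suc j))"
  shows "specializable (c (Suc (Suc (Suc j))))"
proof -
  define v' v u' u where "v' = g j" and "v = g (Suc j)" and "u' = g (Suc (Suc j))"
    and "u = g (Suc (Suc (Suc j)))"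
  define m2 m1 l where "m2 = n (Suc (Suc j))" and "m1 = n (Suc j)" and "l = L (Suc (Suc j))"
  have nz: "v' \<noteq> 0" "v \<noteq> 0" "u' \<noteq> 0" "u \<noteq> 0" unfolding v'_def v_def u'_def u_def by (rule g_nz)+
  have u1: "1 + u \<noteq> 0" unfolding u_def by (rule g_plus_1_nz)
  have mem: "m1 \<in> Zx" "l \<in> Zx" "u \<in> Zx" unfolding m1_def l_def u_def by (rule n_Zx L_Zx g_Zx)+
  have u: "u = 1 + u' * m2" unfolding u_def u'_def m2_def by (rule n_mult)
  have u': "u' = 1 + v * m1" unfolding v_def u'_def m1_def by (rule n_mult)
  have m2: "m2 = - 2 + u' + (1 - u')\<^sup>2 * (1 + u' * l)"
    unfolding m2_def u'_def l_def by (subst n_eq) simp_all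
  define r where "r = - (s j + (u' - 1) / (u' * v\<^sup>2))"
  \<comment> \<open>Division of u^2 by 1 + u leaves 1; e is the contribution of this remainder to
    u^2/((1 + u)(u' v)^2).\<close>
  define e where "e = 1 / ((1 + u) * (u' * v)\<^sup>2)"
  have d: "dual (u' * v) (s (Suc (Suc j))) r"
    using dual_s[of "Suc j"] unfolding u'_def v_def r_def by simp
  have c1: "c (Suc j) = s j + 1 / v + 1 / v\<^sup>2" unfolding c_def v_def by (simp add: s_Suc)
  have "c (Suc (Suc (Suc j))) = s (Suc (Suc j)) + (1 + u) / u\<^sup>2"
    unfolding c_def s_Suc[of "Suc (Suc j)"] u_def[symmetric] using nz by (simp add: field_simps power2_eq_square)
  moreover have "specializable (s (Suc (Suc j)) + (1 + u) / u\<^sup>2)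
      \<longleftrightarrow> specializable (r + 1 / ((u' * v)\<^sup>2 * ((1 + u) / u\<^sup>2)))"
    using dual_add_iff[OF d sp(1)] nz u1 by simp
  moreover have "\<dots> \<longleftrightarrow> specializable (- c (Suc j) + e)"
  proof (rule specializable_cong)
    have "r + u\<^sup>2 / ((u' * v)\<^sup>2 * (1 + u)) - (- c (Suc j) + e) = (m1 + 1) / v + m1\<^sup>2 * l"
      using right_inverse[OF nz(2)] right_inverse[OF nz(3)] right_inverse[OF u1] u u' m2
      unfolding r_def c1 e_def inverse_expand by algebra
    moreover have "(m1 + 1) / v \<in> Zx" unfolding m1_def v_def by (rule n_plus_1')
    ultimately show "r + 1 / ((u' * v)\<^sup>2 * ((1 + u) / u\<^sup>2)) - (- c (Suc j) + e) \<in> Zx"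
      using mem by (simp add: Zx_intros)
  qed
  moreover have "\<dots> \<longleftrightarrow> specializable (s (j - 1) + (v - 1) / (v\<^sup>2 * v'\<^sup>2) + 1 / ((v' * v\<^sup>2)\<^sup>2 * e))"
    using dual_add_iff[OF dual_sym[OF dual_c[of j]]] sp(3) nz u1
    unfolding v'_def[symmetric] v_def[symmetric] e_def by simp
  moreover have "\<dots> \<longleftrightarrow> specializable (s (j - 1) + (v - 1) / (v * v'\<^sup>2))"
  proof (rule specializable_cong)
    have "1 / ((v' * v\<^sup>2)\<^sup>2 * e) = (1 + u) * u'\<^sup>2 / (v' * v)\<^sup>2"
      using nz u1 unfolding e_def by (simp add: field_simps power2_eq_square)
    moreover have "s (j - 1) + (v - 1) / (v\<^sup>2 * v'\<^sup>2) + (1 + u) * u'\<^sup>2 / (v' * v)\<^sup>2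
        - (s (j - 1) + (v - 1) / (v * v'\<^sup>2))
      = (u'\<^sup>2 - (v - 1)\<^sup>2) / (v * v')\<^sup>2 + (u / v\<^sup>2) * (u' / v')\<^sup>2"
      using right_inverse[OF nz(1)] right_inverse[OF nz(2)] unfolding inverse_expand by algebra
    moreover have "(u'\<^sup>2 - (v - 1)\<^sup>2) / (v * v')\<^sup>2 \<in> Zx"
      using square_mod[of "Suc j"] unfolding u'_def v_def v'_def by simp
    moreover have "u / v\<^sup>2 \<in> Zx" "u' / v' \<in> Zx"
      unfolding u_def v_def u'_def v'_def by (rule g_square g_div)+
    ultimately show "s (j - 1) + (v - 1) / (v\<^sup>2 * v'\<^sup>2) + 1 / ((v' * v\<^sup>2)\<^sup>2 * e)
        - (s (j - 1) + (v - 1) / (v * v'\<^sup>2)) \<in> Zx" by (simp only: Zx_intros)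
  qed
  moreover have "\<dots>"
    using dual_specializable[OF dual_s[of j] sp(2)]
    unfolding specializable_neg_iff v_def v'_def .
  ultimately show ?thesis by simp
qed

lemma specializable_initial:
  "specializable (s (Suc (Suc 0)))" "specializable (c (Suc 0))" "specializable (c (Suc (Suc 0)))"
proof -
  define x z l m where "x = g (Suc 0)" and "z = g (Suc (Suc 0))" and "l = L (Suc 0)" and "m = n (Suc 0)"
  have nz: "x \<noteq> 0" "z \<noteq> 0" and mem: "x \<in> Zx" "z \<in> Zx" "l \<in> Zx" "m \<in> Zx"
    unfolding x_def z_def l_def m_def by (rule g_nz g_Zx L_Zx n_Zx)+
  have nz1: "1 + x \<noteq> 0" "1 + z \<noteq> 0" unfolding x_def z_def by (rule g_plus_1_nz)+
  have z: "z = (1 - x)\<^sup>2 * (1 + x + x\<^sup>2 * l)" unfolding z_def x_def l_def by (subst rec) simp_all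
  have zm: "z = 1 + x * m" unfolding z_def x_def m_def by (rule n_mult)
  have d: "dual x (1 / x) (1 / x)" by (rule dual_inverse) fact+
  have sx: "specializable (1 / x)" using specializable_s_1 unfolding s_1 x_def .
  have m1: "(m + 1) / x \<in> Zx" unfolding m_def x_def by (rule n_plus_1')
  have inv: "specializable (1 / w)" if "w \<in> Zx" for w
    by (rule specializable_inverse[OF specializable_Zx[OF that]])
  have "specializable (1 / x + 1 / z) \<longleftrightarrow> specializable (1 / x + z / x\<^sup>2)"
    using dual_add_iff[OF d sx, of "1 / z"] nz by simp
  also have "\<dots> \<longleftrightarrow> specializable (1 / x\<^sup>2)"
  proof (rule specializable_cong)
    have "1 / x + z / x\<^sup>2 - 1 / x\<^sup>2 = x - 1 + (1 - x)\<^sup>2 * l"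
      using right_inverse[OF nz(1)] z unfolding inverse_expand by algebra
    then show "1 / x + z / x\<^sup>2 - 1 / x\<^sup>2 \<in> Zx" using mem by (simp only: Zx_intros)
  qed
  also have "\<dots>" using mem by (intro inv Zx_intros)
  finally show "specializable (s (Suc (Suc 0)))" by (simp add: s_Suc s_0 x_def z_def)
  have "c (Suc 0) = (1 + x) / x\<^sup>2"
    using nz unfolding c_def s_1 x_def[symmetric] by (simp add: field_simps power2_eq_square)
  moreover have "x\<^sup>2 / (1 + x) - 1 / (1 + x) = x - 1"
    using right_inverse[OF nz1(1)] unfolding inverse_expand by algebra
  ultimately have "1 / c (Suc 0) - 1 / (1 + x) = x - 1" by simp
  then have "specializable (1 / c (Suc 0)) \<longleftrightarrow> specializable (1 / (1 + x))"
    using mem specializable_cong[of "1 / c (Suc 0)" "1 / (1 + x)"] by (simp only: Zx_intros)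
  then show "specializable (c (Suc 0))"
    using inv[of "1 + x"] mem specializable_inverse_iff Zx_intros(3,5) by metis
  have "1 / z + 1 / z\<^sup>2 = (1 + z) / z\<^sup>2"
    using right_inverse[OF nz(2)] unfolding inverse_expand by algebra
  then have "c (Suc (Suc 0)) = 1 / x + (1 + z) / z\<^sup>2"
    unfolding c_def s_Suc s_0 x_def[symmetric] z_def[symmetric] by simp
  moreover have "specializable (1 / x + (1 + z) / z\<^sup>2) \<longleftrightarrow> specializable (1 / x + 1 / (x\<^sup>2 * ((1 + z) / z\<^sup>2)))"
    by (rule dual_add_iff[OF d sx]) (use nz nz1 in simp)
  moreover have "\<dots> \<longleftrightarrow> specializable (1 / (x\<^sup>2 * (1 + z)))"
  proof (rule specializable_cong)
    have "z\<^sup>2 / (x\<^sup>2 * (1 + z)) - 1 / (x\<^sup>2 * (1 + z)) = (z - 1) / x\<^sup>2"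
      using right_inverse[OF nz1(2)] unfolding inverse_expand by algebra
    then have "1 / x + z\<^sup>2 / (x\<^sup>2 * (1 + z)) - 1 / (x\<^sup>2 * (1 + z)) = (m + 1) / x"
      using nz unfolding zm by (simp add: field_simps power2_eq_square)
    then show "1 / x + 1 / (x\<^sup>2 * ((1 + z) / z\<^sup>2)) - 1 / (x\<^sup>2 * (1 + z)) \<in> Zx"
      using m1 by simp
  qed
  moreover have "\<dots>" using mem by (intro inv Zx_intros)
  ultimately show "specializable (c (Suc (Suc 0)))" by simp
qed

lemma specializable_s: "specializable (s k)"
proof -
  have "specializable (s k) \<and> specializable (s (Suc k)) \<and> specializable (s (Suc (Suc k)))
    \<and> specializable (c (Suc k)) \<and> specializable (c (Suc (Suc k)))"
  proof (induction k)
    case 0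
    have "specializable (s 0)" unfolding s_0 by (rule specializable_Zx) (rule Zx_intros)
    then show ?case using specializable_s_1 specializable_initial by blast
  next
    case (Suc k)
    then show ?case using specializable_s_step specializable_c_step by blast
  qed
  then show ?thesis by blast
qed

end

section \<open>Necessity\<close>

text \<open>One step of Euclid's algorithm with a freely chosen quotient c. Such steps produce
  fractions whose leading coefficients can be tested.\<close>

lemma specializable_reduce:
  assumes "specializable (to_Qx A / to_Qx B)" "C = A - c * B"
  shows "specializable (to_Qx B / to_Qx C)"
proof (cases "B = 0")
  case True
  then show ?thesis by (simp add: specializable_Zx Zx_intros)
next
  case False
  then have "to_Qx C / to_Qx B = to_Qx A / to_Qx B + to_Qx (- c)"
    unfolding assms(2) by (simp add: field_simps)
  then have "specializable (to_Qx C / to_Qx B)" using specializable_add[OF assms(1), of "- c"] by simp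
  from specializable_inverse[OF this] show ?thesis by simp
qed

text \<open>G collects the factors built from the unknown f and its iterates. Their leading
  coefficient cancels, so that the test concerns only the explicit cofactors A0 and B0.\<close>

lemma specializable_lead_coeff_dvd':
  assumes s: "specializable (to_Qx A / to_Qx B)" and AB: "A = G * A0 + A1" "B = G * B0 + B1"
    and B0: "B0 \<noteq> 0" "degree B0 < degree A0"
    and deg: "degree A1 < degree G + degree A0" "degree B1 < degree G + degree B0"
    and G: "G \<noteq> 0"
  shows "lead_coeff B0 dvd lead_coeff A0"
proof -
  have A0: "A0 \<noteq> 0" using B0 by auto
  have dA: "degree (G * A0) = degree G + degree A0" and dB: "degree (G * B0) = degree G + degree B0"
    using G A0 B0 by (simp_all add: degree_mult_eq)
  have sum: "degree (P + Q) = degree P" "lead_coeff (P + Q) = lead_coeff P"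
    if "degree Q < degree P" for P Q :: "int poly"
    using degree_add_eq_left[OF that] lead_coeff_add_le[OF that] by (simp_all only: add.commute[of P])
  have lt: "degree A1 < degree (G * A0)" "degree B1 < degree (G * B0)" using deg dA dB by simp_all
  have dA': "degree A = degree G + degree A0" and dB': "degree B = degree G + degree B0"
    unfolding AB sum(1)[OF lt(1)] sum(1)[OF lt(2)] dA dB by (rule refl)+
  have A: "lead_coeff A = lead_coeff G * lead_coeff A0"
    using sum(2)[OF lt(1)] lead_coeff_mult[of G A0] unfolding AB by metis
  have B: "lead_coeff B = lead_coeff G * lead_coeff B0"
    using sum(2)[OF lt(2)] lead_coeff_mult[of G B0] unfolding AB by metis
  have "B \<noteq> 0" using B G B0 by auto
  then have "lead_coeff B dvd lead_coeff A"
    using specializable_lead_coeff_dvd[OF s] dA' dB' B0(2) by simp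
  then show ?thesis using A B G by simp
qed

lemma int_square_dvd_unit: "(c::int)\<^sup>2 dvd b \<Longrightarrow> b dvd 1 \<Longrightarrow> c = 1 \<or> c = - 1"
proof -
  assume "c\<^sup>2 dvd b" "b dvd 1"
  then have "c\<^sup>2 dvd 1" by (rule dvd_trans)
  then have "c dvd 1" unfolding power2_eq_square by (rule dvd_mult_left)
  then show ?thesis by auto
qed

section \<open>Tests on sums of two and three terms\<close>

text \<open>Duality with 1/x gives (x + f)/x^2, and one division gives x^2/(c + (b + 1) x). For b =
  -1 the floor test makes c zero or a unit; otherwise it makes b + 1 a unit.\<close>

lemma necessary_1:
  fixes f k :: "int poly"
  assumes f: "f = [:c:] + [:b:] * [:0, 1:] + [:0, 1:]\<^sup>2 * k" and f0: "f \<noteq> 0"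
    and s: "specializable (1 / to_Qx [:0, 1:] + 1 / to_Qx f)"
  shows "(c = 0 \<or> c = 1 \<or> c = - 1) \<and> (b = 0 \<or> b = - 1 \<or> b = - 2)"
proof -
  let ?X = "[:0, 1:] :: int poly"
  let ?x = "to_Qx ?X"
  have nz: "?x \<noteq> 0" by simp
  have d: "dual ?x (1 / ?x) (1 / ?x)" by (intro dual_inverse Zx_intros nz)
  have "specializable (1 / ?x)" by (intro specializable_inverse) simp
  then have "specializable (1 / ?x + 1 / (?x\<^sup>2 * (1 / to_Qx f)))"
    using dual_add_iff[OF d, of "1 / to_Qx f"] s f0 by simp
  moreover have "1 / ?x + 1 / (?x\<^sup>2 * (1 / to_Qx f)) = to_Qx (?X + f) / to_Qx (?X\<^sup>2)"
    using nz f0 by (simp add: field_simps power2_eq_square del: mult_pCons_left mult_pCons_right)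
  ultimately have "specializable (to_Qx (?X + f) / to_Qx (?X\<^sup>2))" by simp
  then have s1: "specializable (to_Qx (?X\<^sup>2) / to_Qx [:c, b + 1:])"
    by (rule specializable_reduce[where c = k]) (simp add: f algebra_simps)
  have X2: "?X\<^sup>2 = [:0, 0, 1:]" by (simp add: power2_eq_square)
  show ?thesis
  proof (cases "b = - 1")
    case True
    then show ?thesis
      using specializable_lead_coeff_dvd[OF s1] by (cases "c = 0") (auto simp: X2)
  next
    case False
    then have "b + 1 \<noteq> 0" by simp
    then have "b + 1 dvd 1" using specializable_lead_coeff_dvd[OF s1] by (simp add: X2)
    then have b: "b + 1 = 1 \<or> b + 1 = - 1" by auto
    then have bb: "(b + 1) * (b + 1) = 1" by (elim disjE) (simp_all only: mult_1 minus_mult_minus)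
    \<comment> \<open>Since (b + 1)^2 = 1, dividing x^2 by c + (b + 1) x leaves the constant
      c^2.\<close>
    have s2: "specializable (to_Qx [:c, b + 1:] / to_Qx [:c * c:])"
      by (rule specializable_reduce[OF s1, where c = "[:- c, b + 1:]"]) (use bb in \<open>simp add: X2 algebra_simps\<close>)
    have "c = 0 \<or> c * c dvd b + 1"
      using specializable_lead_coeff_dvd[OF s2] b by (cases "c = 0") auto
    then have "c = 0 \<or> c = 1 \<or> c = - 1"
      using int_square_dvd_unit[of c "b + 1"] \<open>b + 1 dvd 1\<close> by (auto simp: power2_eq_square)
    then show ?thesis using b by auto
  qed
qed

text \<open>The sum 1/x + 1/y is its own dual, and z/y^2 is -2/y modulo Z[x]. This leaves 1/x - 1/y,
  which divisions bring to x^2/(-3x); but 3 does not divide 1.\<close>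

lemma necessary_2_minus_2x:
  fixes f k :: "int poly"
  assumes f: "f = - 2 * [:0, 1:] + [:0, 1:]\<^sup>2 * k" and nz: "f \<noteq> 0" "pcompose f f \<noteq> 0"
    and s1: "specializable (1 / to_Qx [:0, 1:] + 1 / to_Qx f)"
    and s2: "specializable (1 / to_Qx [:0, 1:] + 1 / to_Qx f + 1 / to_Qx (pcompose f f))"
  shows False
proof -
  let ?X = "[:0, 1:] :: int poly"
  define x y z K K' where "x = to_Qx ?X" and "y = to_Qx f" and "z = to_Qx (pcompose f f)"
    and "K = to_Qx k" and "K' = to_Qx (pcompose k f)"
  have K: "K \<in> Zx" "K' \<in> Zx" "x \<in> Zx" "y \<in> Zx" unfolding K_def K'_def x_def y_def by (rule Zx_intros)+
  have nz': "x \<noteq> 0" "y \<noteq> 0" "z \<noteq> 0" using nz by (simp_all add: x_def y_def z_def)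
  have y: "y = - 2 * x + x\<^sup>2 * K" unfolding y_def K_def x_def
    by (subst f) (simp del: mult_pCons_left mult_pCons_right)
  have c2: "pcompose 2 f = 2" using pcompose_const[of 2 f] by (simp add: numeral_poly)
  have "pcompose f f = - 2 * f + f\<^sup>2 * pcompose k f"
    by (subst f) (simp only: pcompose_hom power2_eq_square c2)
  then have z: "z = - 2 * y + y\<^sup>2 * K'" unfolding y_def K'_def z_def by simp
  have d: "dual y (1 / x + 1 / y) (1 / x + 1 / y)"
  proof -
    have "(1 / x + 1 / y) * y = - 1 + x * K" "y * (1 / x + 1 / y) * (1 / x + 1 / y) - 1 / y = K"
      using right_inverse[OF nz'(1)] right_inverse[OF nz'(2)] y unfolding inverse_expand by algebra+
    then show ?thesis unfolding dual_def using K nz' by (simp only: Zx_intros) simp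
  qed
  have "specializable (1 / x + 1 / y + 1 / (y\<^sup>2 * (1 / z)))"
    using dual_add_iff[OF d, of "1 / z"] s1 s2 nz' unfolding x_def y_def z_def by simp
  moreover have "1 / x + 1 / y + z / y\<^sup>2 - to_Qx (f - ?X) / to_Qx (?X * f) = K'"
  proof -
    have "1 / x + 1 / y + z / y\<^sup>2 - (y - x) / (x * y) = K'"
      using right_inverse[OF nz'(1)] right_inverse[OF nz'(2)] z unfolding inverse_expand by algebra
    then show ?thesis unfolding x_def y_def by (simp del: mult_pCons_left mult_pCons_right)
  qed
  ultimately have "specializable (to_Qx (f - ?X) / to_Qx (?X * f))"
    using specializable_cong[of "1 / x + 1 / y + z / y\<^sup>2" "to_Qx (f - ?X) / to_Qx (?X * f)"] K by simp
  from specializable_reduce[OF this refl, of 0]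
  have "specializable (to_Qx (?X * f) / to_Qx (f - ?X))" by simp
  then have "specializable (to_Qx (f - ?X) / to_Qx (?X\<^sup>2))"
    by (rule specializable_reduce[where c = ?X]) (simp add: algebra_simps power2_eq_square del: mult_pCons_left mult_pCons_right)
  then have "specializable (to_Qx (?X\<^sup>2) / to_Qx (- 3 * ?X))"
    by (rule specializable_reduce[where c = k]) (simp add: f algebra_simps del: mult_pCons_left mult_pCons_right)
  then show False
    using specializable_lead_coeff_dvd[of "?X\<^sup>2" "- 3 * ?X"] by (simp add: power2_eq_square numeral_poly)
qed

text \<open>Here \<open>f(1) = 1 + a + p\<close> and \<open>f'(1) = a + 2p + q\<close>, so \<open>a\<close>, \<open>p\<close> and \<open>q\<close> carry the same
  information as \<open>f'(0)\<close>, \<open>f(1)\<close> and \<open>f'(1)\<close>.\<close>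

lemma necessary_2_reduction:
  fixes f h :: "int poly"
  assumes f: "f = 1 + [:a:] * [:0, 1:] + [:0, 1:]\<^sup>2 * ([:p:] + [:q:] * ([:0, 1:] - 1) + ([:0, 1:] - 1)\<^sup>2 * h)"
    and nz: "f \<noteq> 0" "pcompose f f \<noteq> 0"
    and s1: "specializable (1 / to_Qx [:0, 1:] + 1 / to_Qx f)"
    and s2: "specializable (1 / to_Qx [:0, 1:] + 1 / to_Qx f + 1 / to_Qx (pcompose f f))"
  shows "specializable (to_Qx ([:0, 1:]\<^sup>2 * f\<^sup>2)
    / to_Qx (1 + (1 + [:a:]) * f + f\<^sup>2 * ([:p:] - 1 + (1 + [:a:] + [:a:] * [:q:]) * [:0, 1:])))"
proof -
  define X A P R where "X = ([:0, 1:] :: int poly)" and "A = [:a:]" and "P = [:p:]" and "R = [:q:]"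
  define x y z a' p' q' K H where "x = to_Qx X" and "y = to_Qx f" and "z = to_Qx (pcompose f f)"
    and "a' = to_Qx A" and "p' = to_Qx P" and "q' = to_Qx R"
    and "K = to_Qx (P + R * (X - 1) + (X - 1)\<^sup>2 * h)" and "H = to_Qx (pcompose h f)"
  define n where "n = a' + x * K"
  have mem: "x \<in> Zx" "y \<in> Zx" "a' \<in> Zx" "p' \<in> Zx" "q' \<in> Zx" "K \<in> Zx" "H \<in> Zx"
    unfolding x_def y_def a'_def p'_def q'_def K_def H_def by (rule Zx_intros)+
  then have n: "n \<in> Zx" unfolding n_def by (simp only: Zx_intros)
  have nz': "x \<noteq> 0" "y \<noteq> 0" "z \<noteq> 0" using nz by (simp_all add: x_def y_def z_def X_def)
  have f': "f = 1 + A * X + X\<^sup>2 * (P + R * (X - 1) + (X - 1)\<^sup>2 * h)"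
    using f unfolding X_def A_def P_def R_def .
  have y: "y = 1 + a' * x + x\<^sup>2 * K" unfolding y_def K_def x_def a'_def by (subst f') simp
  have "pcompose f f = 1 + A * f + f\<^sup>2 * (P + R * (f - 1) + (f - 1)\<^sup>2 * pcompose h f)"
    by (subst f) (simp only: pcompose_hom power2_eq_square pcompose_const A_def P_def R_def)
  then have z: "z = 1 + a' * y + y\<^sup>2 * (p' + q' * (y - 1) + (y - 1)\<^sup>2 * H)"
    unfolding y_def z_def a'_def p'_def q'_def H_def by simp
  define r where "r = - n / (x * y) + (1 + a') / x"
  have d: "dual (x * y) (1 / x + 1 / y) r"
  proof -
    have "(1 / x + 1 / y) * (x * y) = x + y" "r * (x * y) = - n + (1 + a') * y"
      "x * y * (1 / x + 1 / y) * r - 1 / (x * y) = (1 + a') * (n + 1) - K"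
      using right_inverse[OF nz'(1)] right_inverse[OF nz'(2)] y n_def
      unfolding r_def inverse_expand by algebra+
    then show ?thesis unfolding dual_def using mem n nz' by (simp add: Zx_intros)
  qed
  define W where "W = 1 + (1 + A) * f + f\<^sup>2 * (P - 1 + (1 + A + A * R) * X)"
  have "specializable (r + 1 / ((x * y)\<^sup>2 * (1 / z)))"
    using dual_add_iff[OF d, of "1 / z"] s1 s2 nz' unfolding x_def y_def z_def X_def by simp
  moreover have "r + z / (x * y)\<^sup>2 - to_Qx W / to_Qx (X\<^sup>2 * f\<^sup>2) = q' * K + n\<^sup>2 * H"
  proof -
    have "r + z / (x * y)\<^sup>2 - (1 + (1 + a') * y + y\<^sup>2 * (p' - 1 + (1 + a' + a' * q') * x)) / (x * y)\<^sup>2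
        = q' * K + n\<^sup>2 * H"
      using right_inverse[OF nz'(1)] right_inverse[OF nz'(2)] y n_def z
      unfolding r_def inverse_expand by algebra
    then show ?thesis unfolding x_def y_def W_def a'_def p'_def q'_def by (simp add: power_mult_distrib)
  qed
  ultimately have "specializable (to_Qx W / to_Qx (X\<^sup>2 * f\<^sup>2))"
    using specializable_cong[of "r + z / (x * y)\<^sup>2" "to_Qx W / to_Qx (X\<^sup>2 * f\<^sup>2)"] mem n
    by (simp add: Zx_intros)
  from specializable_inverse[OF this] show ?thesis
    unfolding W_def A_def P_def R_def X_def by (simp del: to_Qx_simps to_Qx_power mult_pCons_left mult_pCons_right)
qed

text \<open>This is a = 0 with u = p - 1, and the conclusion amounts to f(1) = 1. The values 1 and 0
  of u fail only at the end, where dividing x^2 by x + 3 or x + 2 leaves 9 or 4.\<close>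

lemma necessary_2_case_0:
  fixes f k :: "int poly"
  assumes f: "f = 1 + [:0, 1:]\<^sup>2 * k" and deg: "degree f \<ge> 2"
    and s: "specializable (to_Qx ([:0, 1:]\<^sup>2 * f\<^sup>2) / to_Qx (1 + f + f\<^sup>2 * ([:u:] + [:0, 1:])))"
  shows "u = - 1"
proof -
  define X U where "X = ([:0, 1:] :: int poly)" and "U = [:u:]"
  \<comment> \<open>The remainder of x^2 f^2 after division by the given denominator with quotient x
    - u.\<close>
  define V where "V = U\<^sup>2 * f\<^sup>2 - (X - U) * (1 + f)"
  have f': "f = 1 + X\<^sup>2 * k" using f unfolding X_def .
  have f0: "f \<noteq> 0" using deg by auto
  have d2: "degree (f\<^sup>2) = 2 * degree f" using f0 by (simp add: degree_power_eq)
  have d1: "degree (1 + f) \<le> degree f" by (rule degree_add_le) simp_all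
  have dX: "degree (X - U) \<le> 1" unfolding X_def U_def by simp
  have "specializable (to_Qx (X\<^sup>2 * f\<^sup>2) / to_Qx (1 + f + f\<^sup>2 * (U + X)))"
    using s unfolding X_def U_def .
  then have s1: "specializable (to_Qx (1 + f + f\<^sup>2 * (U + X)) / to_Qx V)"
    by (rule specializable_reduce[where c = "X - U"]) (insert V_def, algebra)
  have uu: "u = 0 \<or> u = 1 \<or> u = - 1"
  proof (cases "u = 0")
    case False
    have "lead_coeff (U\<^sup>2) dvd lead_coeff (U + X)"
    proof (rule specializable_lead_coeff_dvd'[OF s1, of "f\<^sup>2" _ "1 + f" _ "- ((X - U) * (1 + f))"])
      show "degree (U\<^sup>2) < degree (U + X)" unfolding U_def X_def by (simp add: power2_eq_square)
      show "degree (1 + f) < degree (f\<^sup>2) + degree (U + X)" using d1 d2 deg by linarith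
      have "degree ((X - U) * (1 + f)) \<le> 1 + degree f"
        using degree_mult_le[of "X - U" "1 + f"] d1 dX by linarith
      then show "degree (- ((X - U) * (1 + f))) < degree (f\<^sup>2) + degree (U\<^sup>2)"
        unfolding degree_minus using d2 deg by linarith
    qed (use False f0 in \<open>simp_all add: V_def U_def algebra_simps\<close>)
    then have "u\<^sup>2 dvd 1" unfolding U_def X_def by (simp add: power2_eq_square)
    then show ?thesis using int_square_dvd_unit[of u 1] by simp
  qed simp
  moreover have "u \<noteq> 1"
  proof
    assume "u = 1"
    then have U: "U = 1" by (simp add: U_def one_pCons)
    from s1 have "specializable (to_Qx V / to_Qx (X\<^sup>2 * (1 + f)))"
      by (rule specializable_reduce[where c = "X + 1"]) (insert V_def U, algebra)
    then have "specializable (to_Qx (X\<^sup>2 * (1 + f)) / to_Qx ((f + 1) * (1 - X) + 1))"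
      by (rule specializable_reduce[where c = k]) (insert f' V_def U, algebra)
    then have "specializable (to_Qx ((f + 1) * (1 - X) + 1) / to_Qx (f + X + 2))"
      by (rule specializable_reduce[where c = "- (X + 1)"]) algebra
    then have "specializable (to_Qx (f + X + 2) / to_Qx (X\<^sup>2))"
      by (rule specializable_reduce[where c = "- (X - 1)"]) algebra
    then have "specializable (to_Qx (X\<^sup>2) / to_Qx (X + 3))"
      by (rule specializable_reduce[where c = k]) (insert f', algebra)
    then have "specializable (to_Qx (X + 3) / to_Qx 9)"
      by (rule specializable_reduce[where c = "X - 3"]) algebra
    then show False using specializable_lead_coeff_dvd[of "X + 3" 9]
      by (simp add: X_def numeral_poly)
  qed
  moreover have "u \<noteq> 0"
  proof
    assume "u = 0"
    then have U: "U = 0" by (simp add: U_def)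
    from s1 have "specializable (to_Qx V / to_Qx (1 + f + X))"
      by (rule specializable_reduce[where c = "- (f - 1)"]) (insert V_def U, algebra)
    then have "specializable (to_Qx (1 + f + X) / to_Qx (X\<^sup>2))"
      by (rule specializable_reduce[where c = "- X"]) (insert V_def U, algebra)
    then have "specializable (to_Qx (X\<^sup>2) / to_Qx (X + 2))"
      by (rule specializable_reduce[where c = k]) (insert f', algebra)
    then have "specializable (to_Qx (X + 2) / to_Qx 4)"
      by (rule specializable_reduce[where c = "X - 2"]) algebra
    then show False using specializable_lead_coeff_dvd[of "X + 2" 4]
      by (simp add: X_def numeral_poly)
  qed
  ultimately show ?thesis by blast
qed

text \<open>This is a = -1, where 1 + a = 0 removes the term linear in f. Here u = p - 1 and v = -
  q.\<close>

lemma necessary_2_case_1: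
  fixes f k :: "int poly"
  assumes f: "f = 1 - [:0, 1:] + [:0, 1:]\<^sup>2 * k" and deg: "degree f \<ge> 2"
    and s: "specializable (to_Qx ([:0, 1:]\<^sup>2 * f\<^sup>2) / to_Qx (1 + f\<^sup>2 * ([:u:] + [:v:] * [:0, 1:])))"
  shows "u = 0 \<and> (v = 0 \<or> v = 1 \<or> v = - 1) \<or> u = - 1 \<and> v = - 1"
proof -
  define X U V where "X = ([:0, 1:] :: int poly)" and "U = [:u:]" and "V = [:v:]"
  have f': "f = 1 - X + X\<^sup>2 * k" using f unfolding X_def .
  have f0: "f \<noteq> 0" using deg by auto
  have d2: "degree (f\<^sup>2) = 2 * degree f" using f0 by (simp add: degree_power_eq)
  have s0: "specializable (to_Qx (X\<^sup>2 * f\<^sup>2) / to_Qx (1 + f\<^sup>2 * (U + V * X)))"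
    using s unfolding X_def U_def V_def .
  have dvd1: "lead_coeff (U + V * X) dvd 1" if "U + V * X \<noteq> 0"
  proof -
    have "lead_coeff (U + V * X) dvd lead_coeff (X\<^sup>2)"
    proof (rule specializable_lead_coeff_dvd'[OF s0, of "f\<^sup>2" _ 0 _ 1])
      show "degree (U + V * X) < degree (X\<^sup>2)" unfolding U_def V_def X_def by (simp add: power2_eq_square)
    qed (use that f0 d2 deg in \<open>simp_all add: algebra_simps X_def power2_eq_square\<close>)
    then show ?thesis by (simp add: X_def power2_eq_square)
  qed
  have v: "v = 0 \<or> v = 1 \<or> v = - 1"
    using dvd1 by (cases "v = 0") (auto simp: U_def V_def X_def)
  have "v = - 1 \<and> u = - 1" if u0: "u \<noteq> 0"
  proof (cases "v = 0")
    case True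
    then have V: "V = 0" by (simp add: V_def)
    have "u dvd 1" using dvd1 u0 by (simp add: V U_def)
    then have "u = 1 \<or> u = - 1" by auto
    then have UU: "U * U = 1" by (elim disjE) (simp_all add: U_def one_pCons)
    have "specializable (to_Qx (X\<^sup>2 * f\<^sup>2) / to_Qx (1 + f\<^sup>2 * U))" using s0 by (simp add: V)
    then have "specializable (to_Qx (1 + f\<^sup>2 * U) / to_Qx (- U * X\<^sup>2))"
      by (rule specializable_reduce[where c = "U * X\<^sup>2"]) (insert UU, algebra)
    \<comment> \<open>The quotient stems from f^2 = 1 - 2x + x^2 (1 + 2k (1 - x) + x^2 k^2).\<close>
    then have "specializable (to_Qx (- U * X\<^sup>2) / to_Qx (1 + U * (1 - 2 * X)))"
      by (rule specializable_reduce[where c = "- (1 + 2 * k * (1 - X) + X\<^sup>2 * k\<^sup>2)"])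
        (unfold f', algebra)
    moreover have "1 + U * (1 - 2 * X) = [:1 + u, - 2 * u:]" "- U * X\<^sup>2 = [:0, 0, - u:]"
      by (simp_all add: U_def X_def one_pCons numeral_poly power2_eq_square)
    ultimately have "specializable (to_Qx [:0, 0, - u:] / to_Qx [:1 + u, - 2 * u:])"
      by (simp only:)
    then have "- 2 * u dvd - u"
      using specializable_lead_coeff_dvd[of "[:0, 0, - u:]" "[:1 + u, - 2 * u:]"] u0 by simp
    then show ?thesis using \<open>u = 1 \<or> u = - 1\<close> by auto
  next
    case False
    with v have v1: "v = 1 \<or> v = - 1" by blast
    then have VV: "V * V = 1" by (elim disjE) (simp_all add: V_def one_pCons)
    from s0 have s1: "specializable (to_Qx (1 + f\<^sup>2 * (U + V * X)) / to_Qx (U\<^sup>2 * f\<^sup>2 - (V * X - U)))"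
      by (rule specializable_reduce[where c = "V * X - U"]) (insert VV, algebra)
    have "lead_coeff (U\<^sup>2) dvd lead_coeff (U + V * X)"
    proof (rule specializable_lead_coeff_dvd'[OF s1, of "f\<^sup>2" _ 1 _ "- (V * X - U)"])
      show "degree (U\<^sup>2) < degree (U + V * X)" using False by (simp add: U_def V_def X_def power2_eq_square)
      have "degree (V * X - U) \<le> 1" by (simp add: U_def V_def X_def)
      then show "degree (- (V * X - U)) < degree (f\<^sup>2) + degree (U\<^sup>2)"
        unfolding degree_minus using d2 deg by linarith
    qed (use u0 f0 d2 deg in \<open>simp_all add: U_def algebra_simps\<close>)
    then have "u\<^sup>2 dvd v" using False by (simp add: U_def V_def X_def power2_eq_square)
    moreover have "v dvd 1" using v1 by auto
    ultimately have u1: "u = 1 \<or> u = - 1" by (rule int_square_dvd_unit)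
    then have UU: "U * U = 1" by (elim disjE) (simp_all add: U_def one_pCons)
    then have U2: "U\<^sup>2 = 1" by (simp add: power2_eq_square)
    from s1 have "specializable (to_Qx (U\<^sup>2 * f\<^sup>2 - (V * X - U)) / to_Qx (X\<^sup>2))"
      by (rule specializable_reduce[where c = "V * X + U"]) (insert UU VV, algebra)
    then have s2: "specializable (to_Qx (X\<^sup>2) / to_Qx (1 + U - (2 + V) * X))"
      by (rule specializable_reduce[where c = "1 + 2 * k * (1 - X) + X\<^sup>2 * k\<^sup>2"])
        (simp only: U2 f', algebra)
    have "1 + U - (2 + V) * X = [:1 + u, - (2 + v):]"
      by (simp add: U_def V_def X_def one_pCons numeral_poly)
    then have "- (2 + v) dvd 1"
      using specializable_lead_coeff_dvd[OF s2] v1 by (auto simp: X_def power2_eq_square)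
    then have v': "v = - 1" using v1 by auto
    moreover have "u \<noteq> 1"
    proof
      assume "u = 1"
      then have UV: "U = 1" "V = - 1" using v' by (simp_all add: U_def V_def one_pCons)
      then have "1 + U - (2 + V) * X = 2 - X" by simp
      with s2 have "specializable (to_Qx (X\<^sup>2) / to_Qx (2 - X))" by simp
      then have "specializable (to_Qx (2 - X) / to_Qx 4)"
        by (rule specializable_reduce[where c = "- (X + 2)"]) algebra
      then show False using specializable_lead_coeff_dvd[of "2 - X" 4]
        by (simp add: X_def numeral_poly)
    qed
    ultimately show ?thesis using u1 by blast
  qed
  then show ?thesis using v by blast
qed

text \<open>This is a = -2 with u = p - 1 and v = - 1 - 2q, which is odd and hence nonzero.\<close>

lemma necessary_2_case_2:
  fixes f k :: "int poly"
  assumes f: "f = 1 - 2 * [:0, 1:] + [:0, 1:]\<^sup>2 * k" and deg: "degree f \<ge> 2" and v0: "v \<noteq> 0"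
    and s: "specializable (to_Qx ([:0, 1:]\<^sup>2 * f\<^sup>2) / to_Qx (1 - f + f\<^sup>2 * ([:u:] + [:v:] * [:0, 1:])))"
  shows "u = 1 \<and> (v = 1 \<or> v = - 1) \<or> u = 0 \<and> v = - 1"
proof -
  define X U V where "X = ([:0, 1:] :: int poly)" and "U = [:u:]" and "V = [:v:]"
  have f': "f = 1 - 2 * X + X\<^sup>2 * k" using f unfolding X_def .
  have f0: "f \<noteq> 0" using deg by auto
  have d2: "degree (f\<^sup>2) = 2 * degree f" using f0 by (simp add: degree_power_eq)
  have d1: "degree (1 - f) \<le> degree f" by (rule degree_diff_le) simp_all
  have d1': "degree (f - 1) = degree f"
    using degree_add_eq_left[of "- 1" f] deg by simp
  have s0: "specializable (to_Qx (X\<^sup>2 * f\<^sup>2) / to_Qx (1 - f + f\<^sup>2 * (U + V * X)))"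
    using s unfolding X_def U_def V_def .
  have "lead_coeff (U + V * X) dvd lead_coeff (X\<^sup>2)"
  proof (rule specializable_lead_coeff_dvd'[OF s0, of "f\<^sup>2" _ 0 _ "1 - f"])
    show "degree (U + V * X) < degree (X\<^sup>2)" unfolding U_def V_def X_def by (simp add: power2_eq_square)
    show "degree (1 - f) < degree (f\<^sup>2) + degree (U + V * X)" using d1 d2 deg by linarith
    show "U + V * X \<noteq> 0" using v0 by (simp add: U_def V_def X_def)
  qed (use f0 d2 deg in \<open>simp_all add: algebra_simps X_def power2_eq_square\<close>)
  then have v: "v = 1 \<or> v = - 1" using v0 by (auto simp: U_def V_def X_def power2_eq_square)
  then have VV: "V * V = 1" by (elim disjE) (simp_all add: V_def one_pCons)
  from s0 have s1: "specializable (to_Qx (1 - f + f\<^sup>2 * (U + V * X)) / to_Qx (U\<^sup>2 * f\<^sup>2 - (V * X - U) * (1 - f)))"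
    by (rule specializable_reduce[where c = "V * X - U"]) (insert VV, algebra)
  have u: "u = 0 \<or> u = 1 \<or> u = - 1"
  proof (cases "u = 0")
    case False
    have "lead_coeff (U\<^sup>2) dvd lead_coeff (U + V * X)"
    proof (rule specializable_lead_coeff_dvd'[OF s1, of "f\<^sup>2" _ "1 - f" _ "- ((V * X - U) * (1 - f))"])
      show "degree (U\<^sup>2) < degree (U + V * X)" using v0 by (simp add: U_def V_def X_def power2_eq_square)
      show "degree (1 - f) < degree (f\<^sup>2) + degree (U + V * X)" using d1 d2 deg by linarith
      have "degree (V * X - U) \<le> 1" by (simp add: U_def V_def X_def)
      then have "degree ((V * X - U) * (1 - f)) \<le> 1 + degree f"
        using degree_mult_le[of "V * X - U" "1 - f"] d1 by linarith
      then show "degree (- ((V * X - U) * (1 - f))) < degree (f\<^sup>2) + degree (U\<^sup>2)"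
        unfolding degree_minus using d2 deg by linarith
    qed (use False f0 in \<open>simp_all add: U_def algebra_simps\<close>)
    then have "u\<^sup>2 dvd v" using v0 by (simp add: U_def V_def X_def power2_eq_square)
    moreover have "v dvd 1" using v by auto
    ultimately show ?thesis using int_square_dvd_unit[of u v] by blast
  qed simp
  moreover have "v \<noteq> 1" if "u = 0"
  proof
    assume "v = 1"
    then have UV: "U = 0" "V = 1" using that by (simp_all add: U_def V_def one_pCons)
    from s1 have "specializable (to_Qx (U\<^sup>2 * f\<^sup>2 - (V * X - U) * (1 - f)) / to_Qx (1 - f + X))"
      by (rule specializable_reduce[where c = "f + 1"]) (insert UV, algebra)
    then have "specializable (to_Qx (1 - f + X) / to_Qx (X\<^sup>2))"
      by (rule specializable_reduce[where c = "- X"]) (insert UV, algebra)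
    then have "specializable (to_Qx (X\<^sup>2) / to_Qx (3 * X))"
      by (rule specializable_reduce[where c = "- k"]) (insert f', algebra)
    then show False using specializable_lead_coeff_dvd[of "X\<^sup>2" "3 * X"]
      by (simp add: X_def numeral_poly power2_eq_square)
  qed
  moreover have "u \<noteq> - 1"
  proof
    assume "u = - 1"
    then have U: "U = - 1" by (simp add: U_def one_pCons)
    from s1 have "specializable (to_Qx (U\<^sup>2 * f\<^sup>2 - (V * X - U) * (1 - f)) / to_Qx ((1 - f) * X\<^sup>2))"
      by (rule specializable_reduce[where c = "V * X - 1"]) (insert VV U, algebra)
    then have s2: "specializable (to_Qx ((1 - f) * X\<^sup>2) / to_Qx ((f - 1) * (3 + (V - 2) * X) + 1))"
      by (rule specializable_reduce[where c = "- k"]) (insert f' U, algebra)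
    have VX: "3 + (V - 2) * X = [:3, v - 2:]" by (simp add: V_def X_def numeral_poly)
    have "f - 1 \<noteq> 0" using d1' deg by auto
    \<comment> \<open>As v - 2 is -1 or -3, this test forces v = 1. The next division then leaves -9
      against the leading coefficient -1.\<close>
    have "lead_coeff [:3, v - 2:] dvd lead_coeff (- (X\<^sup>2))"
    proof (rule specializable_lead_coeff_dvd'[OF s2[unfolded VX], of "f - 1" _ 0 _ 1])
      show "(1 - f) * X\<^sup>2 = (f - 1) * - (X\<^sup>2) + 0" by (simp add: algebra_simps)
    qed (use \<open>f - 1 \<noteq> 0\<close> d1' deg v in \<open>auto simp: X_def power2_eq_square\<close>)
    then have "v - 2 dvd 1" using v by (auto simp: X_def power2_eq_square)
    then have "v = 1" using v by auto
    then have V: "V = 1" by (simp add: V_def one_pCons)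
    from s2 have s3: "specializable (to_Qx ((f - 1) * (3 + (V - 2) * X) + 1) / to_Qx (- 9 * (f - 1) - (X + 3)))"
      by (rule specializable_reduce[where c = "X + 3"]) (insert V, algebra)
    have "lead_coeff [:- 9 :: int:] dvd lead_coeff [:3, v - 2:]"
    proof (rule specializable_lead_coeff_dvd'[OF s3[unfolded VX], of "f - 1" _ 1 _ "- (X + 3)"])
      have "degree (X + 3) \<le> 1" by (simp add: X_def numeral_poly)
      then show "degree (- (X + 3)) < degree (f - 1) + degree [:- 9 :: int:]"
        unfolding degree_minus using d1' deg by linarith
      have "[:- 9:] = (- 9 :: int poly)" by (simp add: numeral_poly)
      then show "- 9 * (f - 1) - (X + 3) = (f - 1) * [:- 9:] + - (X + 3)" by (simp only:)
    qed (use \<open>f - 1 \<noteq> 0\<close> d1' deg v in auto)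
    then show False using v by auto
  qed
  ultimately show ?thesis using v by blast
qed

section \<open>Tests on sums of four terms\<close>

lemma necessary_3_reduction:
  fixes f m :: "int poly"
  assumes deg: "degree f > 1" and f: "f = 1 + [:0, 1:] * ([:0, 1:] - 1) * m"
    and s2: "specializable (\<Sum>i<3. 1 / to_Qx (poly_iter f i))"
    and s3: "specializable (\<Sum>i<4. 1 / to_Qx (poly_iter f i))"
  defines "x \<equiv> to_Qx [:0, 1:]" and "y \<equiv> to_Qx f" and "z \<equiv> to_Qx (pcompose f f)"
    and "M0 \<equiv> to_Qx m" and "M1 \<equiv> to_Qx (pcompose m f)" and "M2 \<equiv> to_Qx (pcompose m (pcompose f f))"
  shows "specializable ((x - 1)\<^sup>2 / x + ((x - 1) * M0)\<^sup>2 / y + ((x - 1) * M0 * M1)\<^sup>2 / z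
      + (x - 1) * M0 * M1 * M2 / (x * y * z) + 1 / (x * y * z)\<^sup>2)"
    and "y = 1 + x * ((x - 1) * M0)" and "z = 1 + x * y * ((x - 1) * M0 * M1)"
    and "x \<noteq> 0" "y \<noteq> 0" "z \<noteq> 0"
proof -
  have step: "pcompose f W = 1 + W * (W - 1) * pcompose m W" for W
    by (simp only: f pcompose_hom)
  show y: "y = 1 + x * ((x - 1) * M0)"
    unfolding y_def x_def M0_def by (subst f) (simp del: mult_pCons_left mult_pCons_right add: mult.assoc)
  have z': "z = 1 + y * (y - 1) * M1" unfolding z_def y_def M1_def by (subst step) simp
  then show z: "z = 1 + x * y * ((x - 1) * M0 * M1)" using y by algebra
  define w where "w = to_Qx (poly_iter f 3)"
  have it: "poly_iter f 1 = f" "poly_iter f 2 = pcompose f f" "poly_iter f 3 = pcompose f (pcompose f f)"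
    by (simp_all add: numeral_eq_Suc)
  have "w = 1 + z * (z - 1) * M2" unfolding w_def it z_def M2_def by (subst step) simp
  then have w: "w = 1 + x * y * z * ((x - 1) * M0 * M1 * M2)" using z by algebra
  have nz: "to_Qx (poly_iter f i) \<noteq> 0" for i using poly_iter_ne(1)[OF deg] by simp
  show nzs: "x \<noteq> 0" "y \<noteq> 0" "z \<noteq> 0"
    using nz[of 0] nz[of 1] nz[of 2] unfolding x_def y_def z_def it by simp_all
  have w0: "w \<noteq> 0" unfolding w_def by (rule nz)
  have mem: "x \<in> Zx" "M0 \<in> Zx" "M1 \<in> Zx" unfolding x_def M0_def M1_def by (rule Zx_intros)+
  have R: "x - 1 \<in> Zx" "(x - 1) * M0 \<in> Zx" "(x - 1) * M0 * M1 \<in> Zx"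
    using mem by (simp_all only: Zx_intros)
  have d0: "dual (1 * x) (0 + 1 / x) (0 + (x - 1)\<^sup>2 / x)"
    by (rule dual_coprime_step[OF dual_1 R(1) nzs(1)]) simp
  have d1: "dual (1 * x * y) (0 + 1 / x + 1 / y) (0 + (x - 1)\<^sup>2 / x + ((x - 1) * M0)\<^sup>2 / y)"
    by (rule dual_coprime_step[OF d0 R(2) nzs(2)]) (simp add: y)
  have d2: "dual (1 * x * y * z) (0 + 1 / x + 1 / y + 1 / z)
      (0 + (x - 1)\<^sup>2 / x + ((x - 1) * M0)\<^sup>2 / y + ((x - 1) * M0 * M1)\<^sup>2 / z)"
    by (rule dual_coprime_step[OF d1 R(3) nzs(3)]) (simp add: z)
  have S2: "(\<Sum>i<3. 1 / to_Qx (poly_iter f i)) = 0 + 1 / x + 1 / y + 1 / z"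
    and S3: "(\<Sum>i<4. 1 / to_Qx (poly_iter f i)) = 0 + 1 / x + 1 / y + 1 / z + 1 / w"
    unfolding x_def y_def z_def w_def it by (simp_all add: numeral_eq_Suc)
  show "specializable ((x - 1)\<^sup>2 / x + ((x - 1) * M0)\<^sup>2 / y + ((x - 1) * M0 * M1)\<^sup>2 / z
      + (x - 1) * M0 * M1 * M2 / (x * y * z) + 1 / (x * y * z)\<^sup>2)"
    using specializable_coprime_step_iff[OF d2, of w "(x - 1) * M0 * M1 * M2"] s2 s3 w0 w
    unfolding S2 S3 by simp
qed

text \<open>The identities \<open>e1\<close>, \<open>e2\<close>, \<open>e3\<close> eliminate M2, M1,
  M0 in turn, modulo Z[x]. The numerator N that remains has leading part (1 - 2x) f^2 g^2, so 2
  would have to divide 1.\<close>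

lemma necessary_3_case_1:
  fixes f h :: "int poly"
  assumes deg: "degree f > 1" and f: "f = 1 + [:0, 1:] * ([:0, 1:] - 1) * (1 + [:0, 1:] + [:0, 1:] * ([:0, 1:] - 1) * h)"
    and s2: "specializable (\<Sum>i<3. 1 / to_Qx (poly_iter f i))"
    and s3: "specializable (\<Sum>i<4. 1 / to_Qx (poly_iter f i))"
  shows False
proof -
  define m where "m = 1 + [:0, 1:] + [:0, 1:] * ([:0, 1:] - 1) * h"
  define X g where "X = ([:0, 1:] :: int poly)" and "g = pcompose f f"
  note red = necessary_3_reduction[OF deg f[folded m_def] s2 s3, folded X_def g_def]
  define x y z M0 M1 M2 where "x = to_Qx X" and "y = to_Qx f" and "z = to_Qx g"
    and "M0 = to_Qx m" and "M1 = to_Qx (pcompose m f)" and "M2 = to_Qx (pcompose m g)"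
  note red = red[folded x_def y_def z_def M0_def M1_def M2_def]
  define h0 h1 h2 where "h0 = to_Qx h" and "h1 = to_Qx (pcompose h f)" and "h2 = to_Qx (pcompose h g)"
  have m: "pcompose m W = 1 + W + W * (W - 1) * pcompose h W" for W
    by (simp only: m_def pcompose_hom)
  have M: "M0 = 1 + x + x * (x - 1) * h0" "M1 = 1 + y + y * (y - 1) * h1" "M2 = 1 + z + z * (z - 1) * h2"
    using m[of X] m[of f] m[of g] unfolding M0_def M1_def M2_def x_def y_def z_def h0_def h1_def h2_def
    by (simp_all add: X_def del: mult_pCons_left mult_pCons_right)
  have mem: "x \<in> Zx" "M0 \<in> Zx" "M1 \<in> Zx" "h0 \<in> Zx" "h1 \<in> Zx" "h2 \<in> Zx"
    unfolding x_def M0_def M1_def h0_def h1_def h2_def by (rule Zx_intros)+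
  define n where "n = (x - 1) * M0"
  have n: "n \<in> Zx" unfolding n_def using mem by (simp only: Zx_intros)
  note red = red[folded n_def]
  have i: "x * inverse x = 1" "y * inverse y = 1" "z * inverse z = 1" using red(4-6) by simp_all
  have e1: "(n * M1)\<^sup>2 / z + n * M1 * M2 / (x * y * z) - 2 * n * M1 / (x * y) = (n * M1)\<^sup>2 * h2"
    using i M(3) red(3) unfolding inverse_expand by algebra
  have e2: "2 * n * M1 / (x * y) - 2 * n * (1 + y) / (x * y) = 2 * n\<^sup>2 * h1"
    using i M(2) red(2) unfolding inverse_expand by algebra
  have e3: "(x - 1)\<^sup>2 / x + n\<^sup>2 / y + 2 * n * (1 + y) / (x * y)
      - (- 2 / x + 1 / x\<^sup>2 - 1 / (x\<^sup>2 * y)) = x - 2 + 3 * (x + (x - 1)\<^sup>2 * h0)"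
    using i M(1) red(2) n_def unfolding inverse_expand by algebra
  define N where "N = (1 - 2 * X) * f\<^sup>2 * g\<^sup>2 - f * g\<^sup>2 + 1"
  have e4: "- 2 / x + 1 / x\<^sup>2 - 1 / (x\<^sup>2 * y) + 1 / (x * y * z)\<^sup>2 = to_Qx N / to_Qx (X\<^sup>2 * f\<^sup>2 * g\<^sup>2)"
  proof -
    have "- 2 / x + 1 / x\<^sup>2 - 1 / (x\<^sup>2 * y) + 1 / (x * y * z)\<^sup>2
        = ((1 - 2 * x) * y\<^sup>2 * z\<^sup>2 - y * z\<^sup>2 + 1) / (x\<^sup>2 * y\<^sup>2 * z\<^sup>2)"
      using i unfolding inverse_expand by algebra
    then show ?thesis unfolding N_def x_def y_def z_def by simp
  qed
  have "(x - 1)\<^sup>2 / x + n\<^sup>2 / y + (n * M1)\<^sup>2 / z + n * M1 * M2 / (x * y * z) + 1 / (x * y * z)\<^sup>2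
      - to_Qx N / to_Qx (X\<^sup>2 * f\<^sup>2 * g\<^sup>2)
      = (n * M1)\<^sup>2 * h2 + 2 * n\<^sup>2 * h1 + (x - 2 + 3 * (x + (x - 1)\<^sup>2 * h0))"
    unfolding e1[symmetric] e2[symmetric] e3[symmetric] e4[symmetric] by (simp add: algebra_simps)
  also have "\<dots> \<in> Zx" using mem n by (simp only: Zx_intros)
  finally have "specializable (to_Qx N / to_Qx (X\<^sup>2 * f\<^sup>2 * g\<^sup>2))"
    using specializable_cong red(1) by blast
  from specializable_inverse[OF this]
  have s: "specializable (to_Qx (X\<^sup>2 * f\<^sup>2 * g\<^sup>2) / to_Qx N)" by simp
  have dg: "degree g = degree f * degree f" unfolding g_def by (rule degree_pcompose)
  have f0: "f \<noteq> 0" "g \<noteq> 0" using deg dg by auto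
  have dfg: "degree (f\<^sup>2 * g\<^sup>2) = 2 * degree f + 2 * degree g"
    using f0 by (simp add: degree_mult_eq degree_power_eq)
  have "lead_coeff (1 - 2 * X) dvd lead_coeff (X\<^sup>2)"
  proof (rule specializable_lead_coeff_dvd'[OF s, of "f\<^sup>2 * g\<^sup>2" _ 0 _ "1 - f * g\<^sup>2"])
    have "degree (f * g\<^sup>2) = degree f + 2 * degree g"
      using f0 by (simp add: degree_mult_eq degree_power_eq)
    then have "degree (1 - f * g\<^sup>2) \<le> degree f + 2 * degree g" by (intro degree_diff_le) simp_all
    then show "degree (1 - f * g\<^sup>2) < degree (f\<^sup>2 * g\<^sup>2) + degree (1 - 2 * X)"
      using dfg deg by linarith
  qed (use f0 dfg deg in \<open>simp_all add: N_def X_def power2_eq_square one_pCons numeral_poly algebra_simps\<close>)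
  then show False by (simp add: X_def power2_eq_square one_pCons numeral_poly)
qed

text \<open>The elimination is as before, but now the leading part (1 - x) f^2 g^2 of N passes the
  test. Three divisions bring the comparison down to 1 - 3x against - x^2.\<close>

lemma necessary_3_case_2:
  fixes f h :: "int poly"
  assumes deg: "degree f > 1" and f: "f = 1 + [:0, 1:] * ([:0, 1:] - 1) * (2 + [:0, 1:] * ([:0, 1:] - 1) * h)"
    and s2: "specializable (\<Sum>i<3. 1 / to_Qx (poly_iter f i))"
    and s3: "specializable (\<Sum>i<4. 1 / to_Qx (poly_iter f i))"
  shows False
proof -
  define m where "m = 2 + [:0, 1:] * ([:0, 1:] - 1) * h"
  define X g where "X = ([:0, 1:] :: int poly)" and "g = pcompose f f"
  note red = necessary_3_reduction[OF deg f[folded m_def] s2 s3, folded X_def g_def]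
  define x y z M0 M1 M2 where "x = to_Qx X" and "y = to_Qx f" and "z = to_Qx g"
    and "M0 = to_Qx m" and "M1 = to_Qx (pcompose m f)" and "M2 = to_Qx (pcompose m g)"
  note red = red[folded x_def y_def z_def M0_def M1_def M2_def]
  define h0 h1 h2 where "h0 = to_Qx h" and "h1 = to_Qx (pcompose h f)" and "h2 = to_Qx (pcompose h g)"
  have c2: "pcompose 2 W = 2" for W :: "int poly" using pcompose_const[of 2 W] by (simp add: numeral_poly)
  have m: "pcompose m W = 2 + W * (W - 1) * pcompose h W" for W
    by (simp only: m_def pcompose_hom c2)
  have M: "M0 = 2 + x * (x - 1) * h0" "M1 = 2 + y * (y - 1) * h1" "M2 = 2 + z * (z - 1) * h2"
    using m[of X] m[of f] m[of g] unfolding M0_def M1_def M2_def x_def y_def z_def h0_def h1_def h2_def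
    by (simp_all add: X_def del: mult_pCons_left mult_pCons_right)
  have mem: "x \<in> Zx" "M0 \<in> Zx" "M1 \<in> Zx" "h0 \<in> Zx" "h1 \<in> Zx" "h2 \<in> Zx"
    unfolding x_def M0_def M1_def h0_def h1_def h2_def by (rule Zx_intros)+
  define n where "n = (x - 1) * M0"
  have n: "n \<in> Zx" unfolding n_def using mem by (simp only: Zx_intros)
  note red = red[folded n_def]
  have i: "x * inverse x = 1" "y * inverse y = 1" "z * inverse z = 1" using red(4-6) by simp_all
  have e1: "(n * M1)\<^sup>2 / z + n * M1 * M2 / (x * y * z)
      - (n * M1 / (x * y) + 1 / (x\<^sup>2 * y\<^sup>2) - 1 / (x\<^sup>2 * y\<^sup>2 * z)) = (n * M1)\<^sup>2 * h2"
    using i M(3) red(3) unfolding inverse_expand by algebra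
  have e2: "n * M1 / (x * y) - 2 * n / (x * y) = n\<^sup>2 * h1"
    using i M(2) red(2) unfolding inverse_expand by algebra
  have e3: "(x - 1)\<^sup>2 / x + n\<^sup>2 / y + 2 * n / (x * y)
      - (- 1 / x + 1 / x\<^sup>2 - 1 / (x\<^sup>2 * y)) = x + (x - 1)\<^sup>2 * h0"
    using i M(1) red(2) n_def unfolding inverse_expand by algebra
  define N where "N = (1 - X) * f\<^sup>2 * g\<^sup>2 - f * g\<^sup>2 + g\<^sup>2 - g + 1"
  have e4: "- 1 / x + 1 / x\<^sup>2 - 1 / (x\<^sup>2 * y) + 1 / (x\<^sup>2 * y\<^sup>2) - 1 / (x\<^sup>2 * y\<^sup>2 * z) + 1 / (x * y * z)\<^sup>2
      = to_Qx N / to_Qx (X\<^sup>2 * f\<^sup>2 * g\<^sup>2)"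
  proof -
    have "- 1 / x + 1 / x\<^sup>2 - 1 / (x\<^sup>2 * y) + 1 / (x\<^sup>2 * y\<^sup>2) - 1 / (x\<^sup>2 * y\<^sup>2 * z) + 1 / (x * y * z)\<^sup>2
        = ((1 - x) * y\<^sup>2 * z\<^sup>2 - y * z\<^sup>2 + z\<^sup>2 - z + 1) / (x\<^sup>2 * y\<^sup>2 * z\<^sup>2)"
      using i unfolding inverse_expand by algebra
    then show ?thesis unfolding N_def x_def y_def z_def by simp
  qed
  have "(x - 1)\<^sup>2 / x + n\<^sup>2 / y + (n * M1)\<^sup>2 / z + n * M1 * M2 / (x * y * z) + 1 / (x * y * z)\<^sup>2
      - to_Qx N / to_Qx (X\<^sup>2 * f\<^sup>2 * g\<^sup>2)
      = (n * M1)\<^sup>2 * h2 + n\<^sup>2 * h1 + (x + (x - 1)\<^sup>2 * h0)"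
    unfolding e1[symmetric] e2[symmetric] e3[symmetric] e4[symmetric] by (simp add: algebra_simps)
  also have "\<dots> \<in> Zx" using mem n by (simp only: Zx_intros)
  finally have "specializable (to_Qx N / to_Qx (X\<^sup>2 * f\<^sup>2 * g\<^sup>2))"
    using specializable_cong red(1) by blast
  from specializable_inverse[OF this]
  have s: "specializable (to_Qx (X\<^sup>2 * f\<^sup>2 * g\<^sup>2) / to_Qx N)" by simp
  define V1 V2 where "V1 = g\<^sup>2 * (f\<^sup>2 + (1 + X) * (1 - f)) + (X + 1) * (1 - g)"
    and "V2 = X\<^sup>2 * (g\<^sup>2 * (1 - f) + 1 - g)"
  define k where "k = 2 + (X - 1)\<^sup>2 * h"
  have f': "f = 1 - 2 * X + X\<^sup>2 * k"
    using f unfolding X_def[symmetric] k_def by algebra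
  from s have "specializable (to_Qx N / to_Qx V1)"
    by (rule specializable_reduce[where c = "- (X + 1)"]) (unfold V1_def N_def, algebra)
  then have "specializable (to_Qx V1 / to_Qx V2)"
    by (rule specializable_reduce[where c = "- (X - 1)"]) (unfold V1_def V2_def N_def, algebra)
  then have t: "specializable (to_Qx V2 / to_Qx (g\<^sup>2 * ((f - 1) * (1 - 3 * X) + 1) + (f + 3 * X) * (1 - g)))"
    by (rule specializable_reduce[where c = "- k"]) (unfold V1_def V2_def, insert f', algebra)
  have dg: "degree g = degree f * degree f" unfolding g_def by (rule degree_pcompose)
  then have dg1: "degree g > degree f" using deg by simp
  have f0: "f \<noteq> 0" "g \<noteq> 0" "f - 1 \<noteq> 0" using deg dg by auto
  have df1: "degree (f - 1) = degree f" using degree_add_eq_left[of "- 1" f] deg by simp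
  have dG: "degree (g\<^sup>2 * (f - 1)) = 2 * degree g + degree f"
    using f0 df1 by (simp add: degree_mult_eq degree_power_eq)
  have d1g: "degree (1 - g) \<le> degree g" by (rule degree_diff_le) simp_all
  have dX2: "degree (X\<^sup>2) = 2" "degree (1 - 3 * X) = 1" "lead_coeff (1 - 3 * X) = - 3" "lead_coeff (- (X\<^sup>2)) = - 1"
    by (simp_all add: X_def power2_eq_square one_pCons numeral_poly)
  have "lead_coeff (1 - 3 * X) dvd lead_coeff (- (X\<^sup>2))"
  proof (rule specializable_lead_coeff_dvd'[OF t, of "g\<^sup>2 * (f - 1)" _ "X\<^sup>2 * (1 - g)" _ "g\<^sup>2 + (f + 3 * X) * (1 - g)"])
    show "V2 = g\<^sup>2 * (f - 1) * - (X\<^sup>2) + X\<^sup>2 * (1 - g)" unfolding V2_def by algebra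
    show "g\<^sup>2 * ((f - 1) * (1 - 3 * X) + 1) + (f + 3 * X) * (1 - g)
        = g\<^sup>2 * (f - 1) * (1 - 3 * X) + (g\<^sup>2 + (f + 3 * X) * (1 - g))" by algebra
    show "1 - 3 * X \<noteq> 0" using dX2(2) by auto
    show "degree (1 - 3 * X) < degree (- (X\<^sup>2))" using dX2 by simp
    have "degree (X\<^sup>2 * (1 - g)) \<le> 2 + degree g"
      using degree_mult_le[of "X\<^sup>2" "1 - g"] dX2 d1g by linarith
    then show "degree (X\<^sup>2 * (1 - g)) < degree (g\<^sup>2 * (f - 1)) + degree (- (X\<^sup>2))"
      unfolding dG degree_minus dX2 using dg1 deg by linarith
    have "degree (f + 3 * X) \<le> degree f"
      by (rule degree_add_le) (use deg in \<open>simp_all add: X_def numeral_poly\<close>)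
    then have "degree ((f + 3 * X) * (1 - g)) \<le> degree f + degree g"
      using degree_mult_le[of "f + 3 * X" "1 - g"] d1g by linarith
    moreover have "degree (g\<^sup>2) = 2 * degree g" using f0 by (simp add: degree_power_eq)
    ultimately have "degree (g\<^sup>2 + (f + 3 * X) * (1 - g)) \<le> 2 * degree g"
      using dg1 by (intro degree_add_le) linarith+
    then show "degree (g\<^sup>2 + (f + 3 * X) * (1 - g)) < degree (g\<^sup>2 * (f - 1)) + degree (1 - 3 * X)"
      unfolding dG dX2 using deg by linarith
    show "g\<^sup>2 * (f - 1) \<noteq> 0" using f0 by simp
  qed
  then show False unfolding dX2(3,4) by simp
qed

section \<open>The classification\<close>

lemma specializable_sum_cycle_0:
  assumes deg: "degree f > 1" and f: "f = (1 - [:0, 1:])\<^sup>2 * (1 + [:0, 1:]\<^sup>2 * h)"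
  shows "specializable (\<Sum>n<N. 1 / to_Qx (poly_iter f n))"
proof -
  \<comment> \<open>The orbit is shifted by one place to make room for the dummy element at index
    0.\<close>
  define g where "g = case_nat 1 (\<lambda>n. to_Qx (poly_iter f n))"
  define L where "L = (\<lambda>k. to_Qx (pcompose h (poly_iter f (k - 1))))"
  have g: "g 0 = 1" "g (Suc k) = to_Qx (poly_iter f k)" for k by (simp_all add: g_def)
  have it: "poly_iter f (Suc n) = (1 - poly_iter f n)\<^sup>2 * (1 + (poly_iter f n)\<^sup>2 * pcompose h (poly_iter f n))" for n
    by (simp only: poly_iter.simps) (subst f, simp only: pcompose_hom power2_eq_square)
  interpret critical_cycle_0 g L
  proof
    fix k
    show "g 0 = 1" by (rule g)
    show "g k \<in> Zx" by (cases k) (simp_all add: g Zx_intros)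
    show "L k \<in> Zx" by (simp add: L_def Zx_intros)
    show "0 \<in> Zx" by (rule Zx_intros)
    show "g k \<noteq> 0" using poly_iter_ne(1)[OF deg] by (cases k) (simp_all add: g)
    show "g k \<noteq> - 1" if "0 < k"
      using poly_iter_ne(3)[OF deg] that to_Qx_eq_iff[of _ "- 1"] by (cases k) (simp_all add: g)
    show "g (Suc k) = (1 - g k)\<^sup>2 * (1 + 0 * g k + (g k)\<^sup>2 * L k)" if "0 < k"
      using that by (cases k) (simp_all add: g L_def it del: poly_iter.simps)
  qed
  have "s N = (\<Sum>n<N. 1 / to_Qx (poly_iter f n))" by (simp add: s_def g)
  then show ?thesis using specializable_s[of N] by simp
qed

lemma specializable_sum_cycle_1:
  assumes deg: "degree f > 1" and f: "f = (1 - [:0, 1:])\<^sup>2 * (1 + [:0, 1:] + [:0, 1:]\<^sup>2 * h)"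
  shows "specializable (\<Sum>n<N. 1 / to_Qx (poly_iter f n))"
proof -
  define g where "g = case_nat 1 (\<lambda>n. to_Qx (poly_iter f n))"
  define L where "L = (\<lambda>k. to_Qx (pcompose h (poly_iter f (k - 1))))"
  have g: "g 0 = 1" "g (Suc k) = to_Qx (poly_iter f k)" for k by (simp_all add: g_def)
  have it: "poly_iter f (Suc n) = (1 - poly_iter f n)\<^sup>2
      * (1 + poly_iter f n + (poly_iter f n)\<^sup>2 * pcompose h (poly_iter f n))" for n
    by (simp only: poly_iter.simps) (subst f, simp only: pcompose_hom power2_eq_square)
  interpret critical_cycle_1 g L
  proof
    fix k
    show "g 0 = 1" by (rule g)
    show "g k \<in> Zx" by (cases k) (simp_all add: g Zx_intros)
    show "L k \<in> Zx" by (simp add: L_def Zx_intros)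
    show "1 \<in> Zx" by (rule Zx_intros)
    show "g k \<noteq> 0" using poly_iter_ne(1)[OF deg] by (cases k) (simp_all add: g)
    show "g k \<noteq> - 1" if "0 < k"
      using poly_iter_ne(3)[OF deg] that to_Qx_eq_iff[of _ "- 1"] by (cases k) (simp_all add: g)
    show "g (Suc k) = (1 - g k)\<^sup>2 * (1 + 1 * g k + (g k)\<^sup>2 * L k)" if "0 < k"
      using that by (cases k) (simp_all add: g L_def it del: poly_iter.simps)
  qed
  have "s N = (\<Sum>n<N. 1 / to_Qx (poly_iter f n))" by (simp add: s_def g)
  then show ?thesis using specializable_s[of N] by simp
qed

section \<open>The symmetry x -> -x\<close>

text \<open>The conjugate of f by x -> -x. It exchanges the cases f(0) = 1 and f(0) = -1.\<close>

definition reflect :: "int poly \<Rightarrow> int poly" where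
  "reflect f = - pcompose f [:0, - 1:]"

lemma reflect_reflect [simp]: "reflect (reflect f) = f"
proof -
  have "pcompose (pcompose f [:0, - 1:]) [:0, - 1:] = pcompose f (pcompose [:0, - 1:] [:0, - 1:])"
    by (rule pcompose_assoc[symmetric])
  also have "pcompose [:0, - 1:] [:0, - 1:] = ([:0, 1:] :: int poly)" by (simp add: pcompose_pCons)
  finally show ?thesis by (simp add: reflect_def pcompose_uminus)
qed

lemma degree_reflect [simp]: "degree (reflect f) = degree f"
  by (simp add: reflect_def degree_pcompose)

lemma poly_iter_reflect: "poly_iter (reflect f) n = reflect (poly_iter f n)"
proof (induction n)
  case 0
  show ?case by (simp add: reflect_def pcompose_pCons)
next
  case (Suc n)
  have "pcompose (pcompose f [:0, - 1:]) (reflect G) = pcompose (pcompose f G) [:0, - 1:]" for G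
  proof -
    have "pcompose [:0, - 1:] (reflect G) = pcompose G [:0, - 1:]" by (simp add: pcompose_pCons reflect_def)
    then show ?thesis by (simp add: pcompose_assoc[symmetric])
  qed
  note comp = this
  have "poly_iter (reflect f) (Suc n) = pcompose (reflect f) (reflect (poly_iter f n))"
    by (simp only: poly_iter.simps Suc)
  also have "\<dots> = - pcompose (pcompose f (poly_iter f n)) [:0, - 1:]"
    by (simp only: reflect_def[of f] pcompose_uminus comp)
  finally show ?case by (simp only: reflect_def poly_iter.simps)
qed

lemma ge2_column_pcompose: "ge2_column p q \<Longrightarrow> ge2_column (pcompose p r) (pcompose q r)"
  for p q r :: "int poly"
proof (induction rule: ge2_column.induct)
  case unit
  show ?case using ge2_column.unit by (simp add: pcompose_1)
next
  case (swap a b)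
  show ?case by (rule ge2_column.swap[OF swap.IH])
next
  case (add a b c)
  then show ?case by (simp add: pcompose_add pcompose_mult ge2_column.add)
next
  case (neg a b)
  then show ?case by (simp add: pcompose_uminus)
qed

text \<open>Substituting -x is an automorphism of Z[x] and preserves the orbit. The sum is first
  written as P/Q, so that the substitution takes place in Z[x] and not in Q(x).\<close>

lemma specializable_sum_reflect:
  assumes deg: "degree f > 1" and s: "specializable (\<Sum>n\<in>A. 1 / to_Qx (poly_iter f n))"
    and fin: "finite A"
  shows "specializable (\<Sum>n\<in>A. 1 / to_Qx (poly_iter (reflect f) n))"
proof -
  let ?m = "[:0, - 1:] :: int poly"
  have m0: "pcompose p ?m = 0 \<longleftrightarrow> p = 0" for p by (rule pcompose_eq_0_iff) simp
  have "\<exists>P Q. Q \<noteq> 0 \<and> (\<Sum>n\<in>A. 1 / to_Qx (poly_iter f n)) = to_Qx P / to_Qx Q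
      \<and> (\<Sum>n\<in>A. 1 / to_Qx (poly_iter (reflect f) n)) = - (to_Qx (pcompose P ?m) / to_Qx (pcompose Q ?m))"
    using fin
  proof induction
    case empty
    show ?case by (intro exI[of _ 0] exI[of _ 1]) simp
  next
    case (insert n A)
    then obtain P Q where *: "Q \<noteq> 0" "(\<Sum>n\<in>A. 1 / to_Qx (poly_iter f n)) = to_Qx P / to_Qx Q"
      "(\<Sum>n\<in>A. 1 / to_Qx (poly_iter (reflect f) n)) = - (to_Qx (pcompose P ?m) / to_Qx (pcompose Q ?m))"
      by blast
    let ?g = "poly_iter f n"
    have g: "?g \<noteq> 0" by (rule poly_iter_ne[OF deg])
    have "Q * ?g \<noteq> 0" using * g by simp
    moreover have "(\<Sum>n\<in>insert n A. 1 / to_Qx (poly_iter f n)) = to_Qx (P * ?g + Q) / to_Qx (Q * ?g)"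
      using insert.hyps * g by (simp add: field_simps)
    moreover have "(\<Sum>n\<in>insert n A. 1 / to_Qx (poly_iter (reflect f) n))
        = - (to_Qx (pcompose (P * ?g + Q) ?m) / to_Qx (pcompose (Q * ?g) ?m))"
    proof -
      have "1 / to_Qx (poly_iter (reflect f) n) = - (1 / to_Qx (pcompose ?g ?m))"
        by (simp only: poly_iter_reflect) (simp add: reflect_def)
      moreover have "to_Qx (pcompose Q ?m) \<noteq> 0" "to_Qx (pcompose ?g ?m) \<noteq> 0" using m0 *(1) g by simp_all
      ultimately show ?thesis
        by (simp only: sum.insert[OF insert.hyps] *(3)) (simp add: pcompose_add pcompose_mult field_simps)
    qed
    ultimately show ?case by blast
  qed
  then obtain P Q where PQ: "Q \<noteq> 0" "(\<Sum>n\<in>A. 1 / to_Qx (poly_iter f n)) = to_Qx P / to_Qx Q"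
    "(\<Sum>n\<in>A. 1 / to_Qx (poly_iter (reflect f) n)) = - (to_Qx (pcompose P ?m) / to_Qx (pcompose Q ?m))"
    by blast
  obtain p q where pq: "ge2_column p q" "q \<noteq> 0" "to_Qx P / to_Qx Q = to_Qx p / to_Qx q"
    using s unfolding PQ specializable_iff by blast
  then have "to_Qx (P * q) = to_Qx (p * Q)" using PQ(1) by (simp add: field_simps)
  then have "P * q = p * Q" by (simp only: to_Qx_eq_iff)
  from arg_cong[OF this, of "\<lambda>r. to_Qx (pcompose r ?m)"]
  have "to_Qx (pcompose P ?m) / to_Qx (pcompose Q ?m) = to_Qx (pcompose p ?m) / to_Qx (pcompose q ?m)"
    using PQ(1) pq(2) m0 by (simp add: pcompose_mult field_simps)
  moreover have "ge2_column (pcompose p ?m) (pcompose q ?m)" "pcompose q ?m \<noteq> 0"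
    using ge2_column_pcompose[OF pq(1)] pq(2) m0 by simp_all
  ultimately show ?thesis unfolding PQ(3) specializable_neg_iff unfolding specializable_iff by blast
qed

section \<open>From residues to the list of classes\<close>

text \<open>These are the listed classes with f(0) = 1. Those with f(0) = -1 are their
  reflections.\<close>

definition special_form :: "int poly \<Rightarrow> bool" where
  "special_form f \<longleftrightarrow>
     [f \<equiv> 1] (polymod \<x>^2 * (\<x> - 1))
   \<or> [f \<equiv> \<x>^3 - \<x>^2 - \<x> + 1] (polymod \<x>^2 * (\<x> - 1)^2)
   \<or> [f \<equiv> -(\<x>^3) + 2*\<x>^2 - \<x> + 1] (polymod \<x>^2 * (\<x> - 1)^2)
   \<or> [f \<equiv> -(\<x>^3) + 3*\<x>^2 - 2*\<x> + 1] (polymod \<x>^2 * (\<x> - 1)^2)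
   \<or> [f \<equiv> \<x>^2 - \<x> + 1] (polymod \<x>^2 * (\<x> - 1)^2)
   \<or> [f \<equiv> \<x>^2 - 2*\<x> + 1] (polymod \<x>^2 * (\<x> - 1)^2)"

lemma poly_cong_iff: "[f \<equiv> g] (polymod m) \<longleftrightarrow> (\<exists>h. f = g + m * h)"
  by (auto simp: poly_cong_def dvd_def algebra_simps)

lemma special_form_sufficient:
  assumes deg: "degree f > 1" and "special_form f"
  shows "specializable (\<Sum>n<N. 1 / to_Qx (poly_iter f n))"
proof -
  define X where "X = (\<x> :: int poly)"
  consider h where "f = 1 + X^2 * (X - 1) * h"
    | h where "f = X^3 - X^2 - X + 1 + X^2 * (X - 1)^2 * h"
    | h where "f = -(X^3) + 2*X^2 - X + 1 + X^2 * (X - 1)^2 * h"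
    | h where "f = -(X^3) + 3*X^2 - 2*X + 1 + X^2 * (X - 1)^2 * h"
    | h where "f = X^2 - X + 1 + X^2 * (X - 1)^2 * h"
    | h where "f = X^2 - 2*X + 1 + X^2 * (X - 1)^2 * h"
    using assms(2) unfolding special_form_def poly_cong_iff X_def by blast
  then show ?thesis
  proof cases
    case 1
    then have "f = 1 + X * (X - 1) * (X * h)" by algebra
    then show ?thesis unfolding X_def by (rule specializable_sum_coprime_0[OF deg])
  next
    case 2
    then have "f = (1 - X)^2 * (1 + X + X^2 * h)" by algebra
    then show ?thesis unfolding X_def by (rule specializable_sum_cycle_1[OF deg])
  next
    case 3
    then have "f = 1 + X * (X - 1) * (1 - X + X * (X - 1) * h)" by algebra
    then show ?thesis unfolding X_def by (rule specializable_sum_coprime_3[OF deg])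
  next
    case 4
    then have "f = 1 + X * (X - 1) * (2 - X + X * (X - 1) * h)" by algebra
    then show ?thesis unfolding X_def by (rule specializable_sum_coprime_2[OF deg])
  next
    case 5
    then have "f = 1 + X * (X - 1) * (1 + X * (X - 1) * h)" by algebra
    then show ?thesis unfolding X_def by (rule specializable_sum_coprime_1[OF deg])
  next
    case 6
    then have "f = (1 - X)^2 * (1 + X^2 * h)" by algebra
    then show ?thesis unfolding X_def by (rule specializable_sum_cycle_0[OF deg])
  qed
qed

lemma int_poly_expand_at_1:
  fixes k :: "int poly"
  obtains p h where "k = [:p:] + (\<x> - 1) * h"
proof -
  have "poly (k - [:poly k 1:]) 1 = 0" by simp
  then have "[:- 1, 1:] dvd k - [:poly k 1:]" by (simp only: poly_eq_0_iff_dvd)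
  then obtain h where "k - [:poly k 1:] = [:- 1, 1:] * h" by (rule dvdE)
  moreover have "[:- 1, 1:] = \<x> - 1" by (simp add: one_pCons)
  ultimately have "k = [:poly k 1:] + (\<x> - 1) * h" by (simp add: algebra_simps)
  then show ?thesis by (rule that)
qed

text \<open>The integers a, p, q determine f modulo x^2 (x - 1)^2. The tests on three terms leave
  the family a = p = 0 with q arbitrary and seven single triples, two of which fail with four
  terms.\<close>

lemma special_form_necessary:
  assumes deg: "degree f > 1" and f: "f = 1 + [:a:] * \<x> + \<x>\<^sup>2 * k" and a: "a = 0 \<or> a = - 1 \<or> a = - 2"
    and sp: "\<And>N. specializable (\<Sum>n<N. 1 / to_Qx (poly_iter f n))"
  shows "special_form f"
proof -
  obtain p k1 where k: "k = [:p:] + (\<x> - 1) * k1" by (rule int_poly_expand_at_1)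
  obtain q h where k1: "k1 = [:q:] + (\<x> - 1) * h" by (rule int_poly_expand_at_1)
  have K: "k = [:p:] + [:q:] * (\<x> - 1) + (\<x> - 1)\<^sup>2 * h"
    unfolding k k1 by (simp add: algebra_simps power2_eq_square)
  define X A P R where "X = (\<x> :: int poly)" and "A = [:a:]" and "P = [:p:]" and "R = [:q:]"
  have fX: "f = 1 + A * X + X\<^sup>2 * k" and KX: "k = P + R * (X - 1) + (X - 1)\<^sup>2 * h"
    using f K unfolding X_def A_def P_def R_def by blast+
  have deg2: "degree f \<ge> 2" using deg by simp
  have it: "poly_iter f 1 = f" "poly_iter f 2 = pcompose f f" by (simp_all add: numeral_eq_Suc)
  have nz: "f \<noteq> 0" "pcompose f f \<noteq> 0"
    using poly_iter_ne(1)[OF deg, of 1] poly_iter_ne(1)[OF deg, of 2] unfolding it .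
  have s1: "specializable (1 / to_Qx \<x> + 1 / to_Qx f)"
    using sp[of 2] by (simp add: numeral_eq_Suc)
  have s2: "specializable (1 / to_Qx \<x> + 1 / to_Qx f + 1 / to_Qx (pcompose f f))"
    using sp[of 3] by (simp add: numeral_eq_Suc)
  have W: "specializable (to_Qx (X\<^sup>2 * f\<^sup>2) / to_Qx (1 + (1 + A) * f + f\<^sup>2 * (P - 1 + (1 + A + A * R) * X)))"
    using necessary_2_reduction[OF f[unfolded K] nz s1 s2] unfolding X_def A_def P_def R_def .
  have P1: "P - 1 = [:p - 1:]" by (simp add: P_def one_pCons)
  from a consider "a = 0" | "a = - 1" | "a = - 2" by blast
  then show ?thesis
  proof cases
    case 1
    then have A: "A = 0" by (simp add: A_def)
    have "p - 1 = - 1"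
      by (rule necessary_2_case_0[of f k, OF _ deg2]) (use fX W A P1 in \<open>simp_all add: X_def\<close>)
    then have "P = 0" by (simp add: P_def)
    then have "f = 1 + X\<^sup>2 * (X - 1) * (R + (X - 1) * h)" using A fX KX by algebra
    then show ?thesis unfolding special_form_def poly_cong_iff X_def by blast
  next
    case 2
    then have A: "A = - 1" by (simp add: A_def one_pCons)
    have "p - 1 = 0 \<and> (- q = 0 \<or> - q = 1 \<or> - q = - 1) \<or> p - 1 = - 1 \<and> - q = - 1"
      by (rule necessary_2_case_1[of f k, OF _ deg2]) (use fX W A P1 in \<open>simp_all add: X_def R_def\<close>)
    then consider "p = 1" "q = 0" | "p = 1" "q = - 1" | "p = 1" "q = 1" | "p = 0" "q = 1" by fastforce
    then show ?thesis
    proof cases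
      case 1
      then have "P = 1" "R = 0" by (simp_all add: P_def R_def one_pCons)
      then have "f = X^2 - X + 1 + X^2 * (X - 1)^2 * h" using A fX KX by algebra
      then show ?thesis unfolding special_form_def poly_cong_iff X_def by blast
    next
      case 2
      then have "P = 1" "R = - 1" by (simp_all add: P_def R_def one_pCons)
      then have "f = -(X^3) + 2*X^2 - X + 1 + X^2 * (X - 1)^2 * h" using A fX KX by algebra
      then show ?thesis unfolding special_form_def poly_cong_iff X_def by blast
    next
      case 3
      then have "P = 1" "R = 1" by (simp_all add: P_def R_def one_pCons)
      then have "f = 1 + X * (X - 1) * (1 + X + X * (X - 1) * h)" using A fX KX by algebra
      then have False unfolding X_def by (rule necessary_3_case_1[OF deg]) (rule sp)+
      then show ?thesis ..
    next
      case 4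
      then have "P = 0" "R = 1" by (simp_all add: P_def R_def one_pCons)
      then have "f = X^3 - X^2 - X + 1 + X^2 * (X - 1)^2 * h" using A fX KX by algebra
      then show ?thesis unfolding special_form_def poly_cong_iff X_def by blast
    qed
  next
    case 3
    then have A: "A = - 2" by (simp add: A_def numeral_poly)
    have v: "1 + A + A * R = [:- 1 - 2 * q:]" by (simp add: A R_def one_pCons numeral_poly)
    have "p - 1 = 1 \<and> (- 1 - 2 * q = 1 \<or> - 1 - 2 * q = - 1) \<or> p - 1 = 0 \<and> - 1 - 2 * q = - 1"
    proof (rule necessary_2_case_2[of f k, OF _ deg2])
      show "f = 1 - 2 * \<x> + \<x>\<^sup>2 * k" using fX unfolding A X_def by simp
      have "(1 + A) * f = - f" unfolding A by simp
      then show "specializable (to_Qx (\<x>\<^sup>2 * f\<^sup>2) / to_Qx (1 - f + f\<^sup>2 * ([:p - 1:] + [:- 1 - 2 * q:] * \<x>)))"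
        using W unfolding P1 v X_def by simp
      show "- 1 - 2 * q \<noteq> 0" by presburger
    qed
    then consider "p = 2" "q = - 1" | "p = 2" "q = 0" | "p = 1" "q = 0" by fastforce
    then show ?thesis
    proof cases
      case 1
      then have "P = 2" "R = - 1" by (simp_all add: P_def R_def one_pCons numeral_poly)
      then have "f = 1 - 2 * X + X^2 * (2 - (X - 1) + (X - 1)^2 * h)" using A fX KX by simp
      then have "f = -(X^3) + 3*X^2 - 2*X + 1 + X^2 * (X - 1)^2 * h" by algebra
      then show ?thesis unfolding special_form_def poly_cong_iff X_def by blast
    next
      case 2
      then have "P = 2" "R = 0" by (simp_all add: P_def R_def numeral_poly)
      then have "f = 1 - 2 * X + X^2 * (2 + (X - 1)^2 * h)" using A fX KX by simp
      then have "f = 1 + X * (X - 1) * (2 + X * (X - 1) * h)" by algebra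
      then have False unfolding X_def by (rule necessary_3_case_2[OF deg]) (rule sp)+
      then show ?thesis ..
    next
      case 3
      then have "P = 1" "R = 0" by (simp_all add: P_def R_def one_pCons)
      then have "f = X^2 - 2*X + 1 + X^2 * (X - 1)^2 * h" using A fX KX by algebra
      then show ?thesis unfolding special_form_def poly_cong_iff X_def by blast
    qed
  qed
qed

lemma reflect_cong:
  "[reflect f \<equiv> g] (polymod m) \<longleftrightarrow> [f \<equiv> reflect g] (polymod pcompose m [:0, - 1:])"
proof -
  have *: "reflect (p - m * k) = reflect p - pcompose m [:0, - 1:] * reflect k" for p m k
    by (simp add: reflect_def pcompose_diff pcompose_mult)
  have imp: "[f \<equiv> reflect g] (polymod pcompose m [:0, - 1:])"
    if cong: "[reflect f \<equiv> g] (polymod m)" for f g m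
  proof -
    obtain k where "reflect f - g = m * k" using cong unfolding poly_cong_def dvd_def by blast
    then have "reflect f - m * k = g" by (simp add: algebra_simps)
    then have "f - pcompose m [:0, - 1:] * reflect k = reflect g" using *[of "reflect f" m k] by simp
    then have "f - reflect g = pcompose m [:0, - 1:] * reflect k" by (simp add: algebra_simps)
    then show ?thesis unfolding poly_cong_def by simp
  qed
  have "pcompose (pcompose m [:0, - 1:]) [:0, - 1:] = m"
    using reflect_reflect[of m] unfolding reflect_def by (simp add: pcompose_uminus)
  then show ?thesis
    using imp[of f g m] imp[of "reflect f" "reflect g" "pcompose m [:0, - 1:]"] by auto
qed

lemma special_form_reflect:
  "special_form (reflect f) \<longleftrightarrow>
     [f \<equiv> -1] (polymod \<x>^2 * (\<x> + 1))
   \<or> [f \<equiv> \<x>^3 + \<x>^2 - \<x> - 1] (polymod \<x>^2 * (\<x> + 1)^2)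
   \<or> [f \<equiv> -(\<x>^3) - 2*\<x>^2 - \<x> - 1] (polymod \<x>^2 * (\<x> + 1)^2)
   \<or> [f \<equiv> -(\<x>^3) - 3*\<x>^2 - 2*\<x> - 1] (polymod \<x>^2 * (\<x> + 1)^2)
   \<or> [f \<equiv> -(\<x>^2) - \<x> - 1] (polymod \<x>^2 * (\<x> + 1)^2)
   \<or> [f \<equiv> -(\<x>^2) - 2*\<x> - 1] (polymod \<x>^2 * (\<x> + 1)^2)"
proof -
  let ?m = "[:0, - 1:] :: int poly"
  define X where "X = (\<x> :: int poly)"
  have hom: "pcompose X ?m = - X" "pcompose 2 ?m = 2" "pcompose 3 ?m = 3"
    using pcompose_const[of 2 ?m] pcompose_const[of 3 ?m] by (simp_all add: X_def pcompose_pCons numeral_poly)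
  have pow: "pcompose (p ^ n) ?m = (pcompose p ?m) ^ n" for p n
    by (induction n) (simp_all add: pcompose_1 pcompose_mult)
  note simps = reflect_def pcompose_add pcompose_diff pcompose_mult pcompose_uminus pcompose_1 hom pow
  have m: "pcompose (\<x>^2 * (\<x> - 1)) ?m = - (X^2 * (X + 1))"
    "pcompose (\<x>^2 * (\<x> - 1)^2) ?m = X^2 * (X + 1)^2"
    by (simp_all only: simps X_def[symmetric]) algebra+
  have r: "reflect 1 = - 1" "reflect (\<x>^3 - \<x>^2 - \<x> + 1) = X^3 + X^2 - X - 1"
    "reflect (-(\<x>^3) + 2*\<x>^2 - \<x> + 1) = -(X^3) - 2*X^2 - X - 1"
    "reflect (-(\<x>^3) + 3*\<x>^2 - 2*\<x> + 1) = -(X^3) - 3*X^2 - 2*X - 1"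
    "reflect (\<x>^2 - \<x> + 1) = -(X^2) - X - 1"
    "reflect (\<x>^2 - 2*\<x> + 1) = -(X^2) - 2*X - 1"
    by (simp_all only: simps X_def[symmetric]) algebra+
  have neg: "[f \<equiv> g] (polymod - m) \<longleftrightarrow> [f \<equiv> g] (polymod m)" for g m
    by (simp add: poly_cong_def)
  show ?thesis unfolding special_form_def reflect_cong m r neg X_def by (rule refl)
qed

theorem theorem7p9:
  fixes f :: "int poly"
  assumes "degree f > 1"
  shows "(\<forall>N::nat. specializable (\<Sum>n=0..N. 1 / to_Qx (poly_iter f n))) \<longleftrightarrow>
      ([f \<equiv> 0] (polymod \<x>^2)
     \<or> [f \<equiv> -\<x>] (polymod \<x>^2)
     \<or> [f \<equiv> 1] (polymod \<x>^2 * (\<x> - 1))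
     \<or> [f \<equiv> -1] (polymod \<x>^2 * (\<x> + 1))
     \<or> [f \<equiv> \<x>^3 - \<x>^2 - \<x> + 1] (polymod \<x>^2 * (\<x> - 1)^2)
     \<or> [f \<equiv> -(\<x>^3) + 2*\<x>^2 - \<x> + 1] (polymod \<x>^2 * (\<x> - 1)^2)
     \<or> [f \<equiv> -(\<x>^3) + 3*\<x>^2 - 2*\<x> + 1] (polymod \<x>^2 * (\<x> - 1)^2)
     \<or> [f \<equiv> \<x>^3 + \<x>^2 - \<x> - 1] (polymod \<x>^2 * (\<x> + 1)^2)
     \<or> [f \<equiv> -(\<x>^3) - 2*\<x>^2 - \<x> - 1] (polymod \<x>^2 * (\<x> + 1)^2)
     \<or> [f \<equiv> -(\<x>^3) - 3*\<x>^2 - 2*\<x> - 1] (polymod \<x>^2 * (\<x> + 1)^2)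
     \<or> [f \<equiv> \<x>^2 - \<x> + 1] (polymod \<x>^2 * (\<x> - 1)^2)
     \<or> [f \<equiv> \<x>^2 - 2*\<x> + 1] (polymod \<x>^2 * (\<x> - 1)^2)
     \<or> [f \<equiv> -(\<x>^2) - \<x> - 1] (polymod \<x>^2 * (\<x> + 1)^2)
     \<or> [f \<equiv> -(\<x>^2) - 2*\<x> - 1] (polymod \<x>^2 * (\<x> + 1)^2))"
proof -
  have "(\<forall>N::nat. specializable (\<Sum>n=0..N. 1 / to_Qx (poly_iter f n))) \<longleftrightarrow>
    [f \<equiv> 0] (polymod \<x>^2) \<or> [f \<equiv> -\<x>] (polymod \<x>^2) \<or> special_form f \<or> special_form (reflect f)"
    (is "?L \<longleftrightarrow> ?R")
  proof
    assume ?R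
    then consider "[f \<equiv> 0] (polymod \<x>^2)" | "[f \<equiv> -\<x>] (polymod \<x>^2)" | "special_form f"
      | "special_form (reflect f)" by blast
    then show ?L
    proof cases
      case 1
      then obtain h where "f = \<x>^2 * h" unfolding poly_cong_iff by auto
      then show ?thesis using specializable_sum_0_mod_x2[OF assms] by blast
    next
      case 2
      then obtain h where "f = - \<x> + \<x>^2 * h" unfolding poly_cong_iff by blast
      then show ?thesis using specializable_sum_minus_x_mod_x2[OF assms] by blast
    next
      case 3
      then show ?thesis
        using special_form_sufficient[OF assms] by (simp only: atLeast0AtMost lessThan_Suc_atMost[symmetric] simp_thms)
    next
      case 4
      have deg: "degree (reflect f) > 1" using assms by simp
      have "specializable (\<Sum>n<N. 1 / to_Qx (poly_iter f n))" for N
        using specializable_sum_reflect[OF deg special_form_sufficient[OF deg 4]] by simp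
      then show ?thesis by (simp only: atLeast0AtMost lessThan_Suc_atMost[symmetric] simp_thms)
    qed
  next
    assume L: ?L
    have sp: "specializable (\<Sum>n<N. 1 / to_Qx (poly_iter f n))" for N
    proof (cases N)
      case 0
      then show ?thesis by (simp add: specializable_Zx Zx_intros)
    next
      case (Suc M)
      then show ?thesis using L by (simp add: atLeast0AtMost lessThan_Suc_atMost)
    qed
    obtain c b k where f: "f = [:c:] + [:b:] * \<x> + \<x>\<^sup>2 * k"
    proof -
      obtain c g where g: "f = pCons c g" by (cases f)
      obtain b k where "g = pCons b k" by (cases g)
      then have "f = [:c:] + [:b:] * \<x> + \<x>\<^sup>2 * k" using g by (simp add: power2_eq_square)
      then show thesis by (rule that)
    qed
    have it: "poly_iter f 1 = f" "poly_iter f 2 = pcompose f f" by (simp_all add: numeral_eq_Suc)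
    have nz: "f \<noteq> 0" "pcompose f f \<noteq> 0"
      using poly_iter_ne(1)[OF assms, of 1] poly_iter_ne(1)[OF assms, of 2] unfolding it .
    have s1: "specializable (1 / to_Qx \<x> + 1 / to_Qx f)"
      using sp[of 2] by (simp add: numeral_eq_Suc)
    have s2: "specializable (1 / to_Qx \<x> + 1 / to_Qx f + 1 / to_Qx (pcompose f f))"
      using sp[of 3] by (simp add: numeral_eq_Suc)
    have cb: "c = 0 \<or> c = 1 \<or> c = - 1" "b = 0 \<or> b = - 1 \<or> b = - 2"
      using necessary_1[OF f nz(1) s1] by blast+
    from cb(1) consider "c = 0" | "c = 1" | "c = - 1" by blast
    then show ?R
    proof cases
      case 1
      from cb(2) consider "b = 0" | "b = - 1" | "b = - 2" by blast
      then show ?thesis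
      proof cases
        case 1
        then have "f = 0 + \<x>^2 * k" using f \<open>c = 0\<close> by simp
        then show ?thesis unfolding poly_cong_iff by blast
      next
        case 2
        then have "f = - \<x> + \<x>^2 * k" using f \<open>c = 0\<close> by simp
        then show ?thesis unfolding poly_cong_iff by blast
      next
        case 3
        then have "f = - 2 * \<x> + \<x>^2 * k" using f \<open>c = 0\<close> by (simp add: numeral_poly)
        then have False by (rule necessary_2_minus_2x[OF _ nz s1 s2])
        then show ?thesis ..
      qed
    next
      case 2
      then have "f = 1 + [:b:] * \<x> + \<x>\<^sup>2 * k" using f by (simp add: one_pCons)
      then show ?thesis using special_form_necessary[OF assms _ cb(2) sp] by blast
    next
      case 3
      \<comment> \<open>Reflection changes the sign of f(0) but keeps f'(0), so b is the same and
        its restriction still applies.\<close>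
      have rf: "reflect f = 1 + [:b:] * \<x> + \<x>\<^sup>2 * reflect k"
        by (simp add: f 3 reflect_def pcompose_add pcompose_mult power2_eq_square pcompose_pCons one_pCons)
      have "degree (reflect f) > 1" using assms by simp
      from special_form_necessary[OF this rf cb(2) specializable_sum_reflect[OF assms sp]]
      show ?thesis by simp
    qed
  qed
  then show ?thesis unfolding special_form_reflect special_form_def[of f] by argo
qed

end
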